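(* Let $$A_8=\begin{pmatrix}4&1\\8&3\end{pmatrix},\qquad A_6=\begin{pmatrix}3/2&1/2\\3&2\end{pmatrix},\qquad D_m=\operatorname{diag}(1,m).$$ For $m\in\{6,8\}$ and $A\in\{A_m,A_m^{-1}\}$, there are no rational numbers $a,b,c$ for which $$q^c\sum_{r,s\ge0}\frac{q^{\frac12(r,s)AD_m(r,s)^T+ar+bs}}{(q;q)_r\,(q^m;q^m)_s}$$ is a meromorphic modular function of weight zero for a congruence subgroup, allowing a finite-order multiplier.
   Context: Here $q=e^{2\pi i\tau}$ with $\tau$ in the upper half-plane, fractional powers mean $q^t=e^{2\pi i t\tau}$, and $(x;q)_n=\prod_{j=0}^{n-1}(1-xq^j)$. The sum is over nonnegative integers $r,s$. In each of the four cases $AD_m$ is a symmetric positive definite matrix, so the series converges. "Meromorphic modular function of weight zero for a congruence subgroup, allowing a finite-order multiplier" means a function meromorphic on the upper half-plane and at the cusps which satisfies $g(\gamma\tau)=\chi(\gamma)g(\tau)$ for all $\gamma$ in some congruence subgroup $\Gamma\subset SL_2(\mathbb Z)$ and some character $\chi$ of $\Gamma$ of finite order. *)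

theory Defs
  imports "HOL-Complex_Analysis.Complex_Analysis" "HOL-Number_Theory.Cong" "HOL-Algebra.Group"
begin

subsection \<open>Modular functions of weight zero\<close>

definition upper_half_plane :: "complex set" where
  "upper_half_plane = {\<tau>. Im \<tau> > 0}"

definition SL2Z :: "(int^2^2) monoid" where
  "SL2Z = \<lparr>carrier = {\<gamma>. det \<gamma> = 1}, monoid.mult = (**), one = mat 1\<rparr>"

definition principal_congruence_subgroup :: "nat \<Rightarrow> (int^2^2) set" where
  "principal_congruence_subgroup N =
     {\<gamma> \<in> carrier SL2Z. \<forall>i j. [\<gamma> $ i $ j = (mat 1 :: int^2^2) $ i $ j] (mod int N)}"

definition congruence_subgroup :: "(int^2^2) set \<Rightarrow> bool" where
  "congruence_subgroup \<Gamma> \<longleftrightarrow>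
     subgroup \<Gamma> SL2Z \<and> (\<exists>N\<ge>1. principal_congruence_subgroup N \<subseteq> \<Gamma>)"

definition moebius_act :: "int^2^2 \<Rightarrow> complex \<Rightarrow> complex" where
  "moebius_act \<gamma> \<tau> =
     (of_int (\<gamma> $ 1 $ 1) * \<tau> + of_int (\<gamma> $ 1 $ 2)) /
     (of_int (\<gamma> $ 2 $ 1) * \<tau> + of_int (\<gamma> $ 2 $ 2))"

text \<open>The condition \<open>chi \<gamma> ^ n = 1\<close> also makes the values of \<open>chi\<close> nonzero.\<close>

definition finite_order_character :: "(int^2^2) set \<Rightarrow> (int^2^2 \<Rightarrow> complex) \<Rightarrow> bool" where
  "finite_order_character \<Gamma> chi \<longleftrightarrow>
     (\<forall>\<gamma>\<in>\<Gamma>. \<forall>\<delta>\<in>\<Gamma>. chi (\<gamma> ** \<delta>) = chi \<gamma> * chi \<delta>) \<and>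
     (\<exists>n\<ge>1. \<forall>\<gamma>\<in>\<Gamma>. chi \<gamma> ^ n = 1)"

text \<open>
  Every cusp is \<open>\<delta> \<infinity>\<close> for some \<open>\<delta>\<close> in \<open>SL\<^sub>2(\<int>)\<close>. Meromorphy there says that
  \<open>g (\<delta> \<tau>)\<close>, for large \<open>Im \<tau>\<close>, is a Laurent series with finite principal part in
  \<open>exp (2 \<pi> i \<tau> / h)\<close> for some positive integer \<open>h\<close>. The width \<open>h\<close> may depend on the cusp;
  it need only be a period of \<open>g \<circ> \<delta>\<close>, so it also absorbs the multiplier.
\<close>

definition meromorphic_at_cusps :: "(complex \<Rightarrow> complex) \<Rightarrow> bool" where
  "meromorphic_at_cusps g \<longleftrightarrow>
     (\<forall>\<delta>\<in>carrier SL2Z. \<exists>h::nat. h \<ge> 1 \<and>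
        (\<exists>G y. G meromorphic_on {0} \<and>
           (\<forall>\<tau>\<in>upper_half_plane. Im \<tau> > y \<longrightarrow>
              g (moebius_act \<delta> \<tau>) = G (exp (2 * of_real pi * \<i> * \<tau> / of_nat h)))))"

text \<open>
  \<open>nicely_meromorphic_on\<close> fixes the value 0 at poles and excludes removable singularities,
  so that the transformation law can be required at every point.
\<close>

definition meromorphic_modular_function :: "(complex \<Rightarrow> complex) \<Rightarrow> bool" where
  "meromorphic_modular_function g \<longleftrightarrow>
     g nicely_meromorphic_on upper_half_plane \<and> meromorphic_at_cusps g \<and>
     (\<exists>\<Gamma> chi. congruence_subgroup \<Gamma> \<and> finite_order_character \<Gamma> chi \<and>
        (\<forall>\<gamma>\<in>\<Gamma>. \<forall>\<tau>\<in>upper_half_plane. g (moebius_act \<gamma> \<tau>) = chi \<gamma> * g \<tau>))"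


subsection \<open>The Nahm sums\<close>

definition q_power :: "complex \<Rightarrow> real \<Rightarrow> complex" where
  "q_power \<tau> t = exp (2 * of_real pi * \<i> * of_real t * \<tau>)"

definition q_pochhammer :: "complex \<Rightarrow> complex \<Rightarrow> nat \<Rightarrow> complex" where
  "q_pochhammer x q n = (\<Prod>j<n. 1 - x * q ^ j)"

definition D_mat :: "nat \<Rightarrow> real^2^2" where
  "D_mat m = vector [vector [1, 0], vector [0, real m]]"

definition A8 :: "real^2^2" where
  "A8 = vector [vector [4, 1], vector [8, 3]]"

definition A6 :: "real^2^2" where
  "A6 = vector [vector [3/2, 1/2], vector [3, 2]]"

definition nahm_exponent :: "real^2^2 \<Rightarrow> nat \<Rightarrow> real \<Rightarrow> real \<Rightarrow> nat \<Rightarrow> nat \<Rightarrow> real" where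
  "nahm_exponent A m a b r s =
     (let v = vector [real r, real s] :: real^2
      in 1/2 * (v \<bullet> ((A ** D_mat m) *v v)) + a * real r + b * real s)"

definition nahm_sum ::
    "real^2^2 \<Rightarrow> nat \<Rightarrow> real \<Rightarrow> real \<Rightarrow> real \<Rightarrow> complex \<Rightarrow> complex" where
  "nahm_sum A m a b c \<tau> =
     (let q = q_power \<tau> 1
      in q_power \<tau> c *
         (\<Sum>\<^sub>\<infinity>(r, s)\<in>UNIV. q_power \<tau> (nahm_exponent A m a b r s) /
            (q_pochhammer q q r * q_pochhammer (q ^ m) (q ^ m) s)))"

end

theory Submission
  imports Defs "HOL-Probability.Probability" "HOL-Real_Asymp.Real_Asymp"
begin

text \<open>
  The idea is to compare two descriptions of \<open>F(\<epsilon>) = nahm_sum A m a b c (i \<epsilon> / 2\<pi>)\<close>, where \<open>q = e\<^sup>-\<^sup>\<epsilon>\<close>,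
  as \<open>\<epsilon>\<close> tends to 0 from above.

  If the function is modular, then it is meromorphic at the cusp 0, so \<open>F(\<epsilon>)\<close> is a Laurent series
  in \<open>e\<^bsup>-K/\<epsilon>\<^esup>\<close> for some \<open>K > 0\<close>. Up to a factor \<open>e\<^bsup>V/\<epsilon>\<^esup>\<close> it is a nonzero constant with an exponentially
  small error, and its asymptotic expansion in powers of \<open>\<epsilon>\<close> has no term linear in \<open>\<epsilon>\<close>
  (\<open>cusp_expansion_no_linear_term\<close>).

  On the other hand, Nahm sums of rank two with a positive definite matrix have an expansion
  \<open>F(\<epsilon>) = C e\<^bsup>V/\<epsilon>\<^esup> (1 + (c\<^sub>1(a,b) - c) \<epsilon> + o(\<epsilon>))\<close> with an explicit quadratic polynomial \<open>c\<^sub>1\<close>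
  (\<open>nahm_saddle.asymptotics\<close>). To obtain it, write \<open>M = A D\<^sub>m\<close> and let \<open>W\<close> be a centred Gaussian vector
  with covariance matrix \<open>M\<close>. Since \<open>e\<^bsup>-\<epsilon> n\<^sup>T M n / 2\<^esup>\<close> is a value of the characteristic function of \<open>W\<close>
  and Euler's identity sums \<open>x\<^sup>r / (q;q)\<^sub>r\<close> in closed form, the double sum is the expectation of the
  exponential of an explicit function of \<open>\<surd>\<epsilon> W\<close> (\<open>nahm_saddle.integral_representation\<close>). Exponential tilting
  moves the integration contour through the positive solution of Nahm's equations
  \<open>1 - X = X\<^bsup>\<alpha>\<^esup> Y\<^bsup>\<beta>/m\<^esup>\<close>, \<open>1 - Y = X\<^bsup>\<beta>\<^esup> Y\<^bsup>\<gamma>/m\<^esup>\<close>, where \<open>M = (\<alpha>, \<beta>; \<beta>, \<gamma>)\<close>. There the exponent is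
  given by convergent power series, hence its expansion in \<open>\<surd>\<epsilon>\<close> has an error that grows at most
  polynomially in \<open>W\<close>, uniformly over the plane, and Laplace's method reduces to Gaussian moments of
  degree at most six.

  Consequently modularity forces \<open>c\<^sub>1(a,b) = c\<close>. In the four cases Nahm's equations are solved in
  \<open>\<rat>(\<surd>3)\<close> (for \<open>m = 8\<close>) or \<open>\<rat>(\<surd>2)\<close> (for \<open>m = 6\<close>), and \<open>c\<^sub>1\<close> has coefficients in this field. For
  rational \<open>a\<close>, \<open>b\<close>, \<open>c\<close> the irrational part of \<open>c\<^sub>1(a,b)\<close> must therefore vanish, which says that \<open>(a,b)\<close> is a
  rational point of a conic. Completing squares turns these conics into \<open>X\<^sup>2 + 3 Y\<^sup>2 = 220\<close> for \<open>m = 8\<close> and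
  \<open>X\<^sup>2 - 21 Y\<^sup>2 = -145\<close> or \<open>2900\<close> for \<open>m = 6\<close>. They have no rational points, since 5 is inert in
  \<open>\<rat>(\<surd>-3)\<close> and divides 220 exactly once, and 29 is inert in \<open>\<rat>(\<surd>21)\<close> and divides 145 and 2900
  exactly once.
\<close>

section \<open>Gaussian integrals in the plane\<close>

definition normal_plane :: "(real \<times> real) measure" where
  "normal_plane = std_normal_distribution \<Otimes>\<^sub>M std_normal_distribution"

interpretation std_normal: real_distribution std_normal_distribution
  by (rule real_dist_normal_dist)

interpretation normal_plane: pair_prob_space std_normal_distribution std_normal_distribution ..

lemma prob_space_normal_plane: "prob_space normal_plane"
  unfolding normal_plane_def by (rule normal_plane.P.prob_space_axioms)

lemma sets_normal_plane [measurable_cong]: "sets normal_plane = sets borel"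
proof -
  have "sets normal_plane = sets (borel \<Otimes>\<^sub>M borel)"
    unfolding normal_plane_def by (intro sets_pair_measure_cong) simp_all
  then show ?thesis by (simp only: borel_prod)
qed

lemma normal_plane_density:
  "normal_plane = density lborel (\<lambda>z. ennreal (std_normal_density (fst z) * std_normal_density (snd z)))"
proof -
  have "normal_plane = density (lborel \<Otimes>\<^sub>M lborel)
      (\<lambda>(x, y). ennreal (std_normal_density x) * ennreal (std_normal_density y))"
    unfolding normal_plane_def
    by (intro pair_measure_density std_normal.sigma_finite_measure sigma_finite_lborel) auto
  also have "\<dots> = density lborel (\<lambda>z. ennreal (std_normal_density (fst z) * std_normal_density (snd z)))"
    by (simp add: lborel_prod ennreal_mult'' case_prod_beta')
  finally show ?thesis .
qed

lemma integral_normal_plane: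
  fixes f :: "real \<times> real \<Rightarrow> 'b::{banach, second_countable_topology}"
  assumes [measurable]: "f \<in> borel_measurable borel"
  shows "integral\<^sup>L normal_plane f =
    (LINT z|lborel. (exp (- ((fst z)\<^sup>2 + (snd z)\<^sup>2) / 2) / (2 * pi)) *\<^sub>R f z)"
proof -
  have [simp]: "std_normal_density x * std_normal_density y = exp (- (x\<^sup>2 + y\<^sup>2) / 2) / (2 * pi)" for x y :: real
    by (simp add: std_normal_density_def exp_add[symmetric] field_simps)
  show ?thesis
    unfolding normal_plane_density by (subst integral_density) (auto intro!: borel_measurable_continuous_onI continuous_intros)
qed

text \<open>
  Fubini reduces this linear change of variables to two affine ones on the line: first the second
  coordinate, which is scaled by \<open>r\<close> and translated by an amount depending on the first one, and then the
  first coordinate.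
\<close>

lemma distr_triangular_lborel:
  fixes p q r :: real
  assumes "p > 0" "r > 0"
  shows "distr lborel borel (\<lambda>z. (p * fst z, q * fst z + r * snd z)) = density lborel (\<lambda>_. ennreal (1 / (p * r)))"
    (is "distr _ _ ?T = _")
proof (rule measure_eqI)
  fix A assume "A \<in> sets (distr lborel borel ?T)"
  then have A [measurable]: "A \<in> sets (borel :: (real\<times>real) measure)" by simp
  have [measurable]: "?T \<in> borel_measurable borel" by (intro borel_measurable_continuous_onI continuous_intros)
  have indm [measurable]: "(\<lambda>z. indicator A z :: ennreal) \<in> borel_measurable borel" by measurable
  have im: "(\<lambda>(x,y). indicator A (x, y) :: ennreal) \<in> borel_measurable (borel \<Otimes>\<^sub>M borel)"
    using indm by (simp add: borel_prod case_prod_beta')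
  have mi: "(\<lambda>x. \<integral>\<^sup>+y. indicator A (x, y) \<partial>lborel) \<in> borel_measurable borel"
    by (rule lborel.borel_measurable_nn_integral)
      (use im in \<open>simp add: sets_pair_measure_cong[of borel borel lborel borel, THEN measurable_cong_sets, OF _ _ refl]\<close>)
  have aff: "(\<integral>\<^sup>+x. g x \<partial>lborel) = ennreal c * (\<integral>\<^sup>+x. g (b + c * x) \<partial>lborel)"
    if "c > 0" "g \<in> borel_measurable borel" for g :: "real \<Rightarrow> ennreal" and b c
    using nn_integral_real_affine[of g c b] that by simp
  have aff': "(\<integral>\<^sup>+x. g (b + c * x) \<partial>lborel) = ennreal (1/c) * (\<integral>\<^sup>+x. g x \<partial>lborel)"
    if "c > 0" "g \<in> borel_measurable borel" for g :: "real \<Rightarrow> ennreal" and b c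
    using aff[OF that, of b] that by (simp add: mult.assoc[symmetric] ennreal_mult[symmetric])
  have "emeasure (distr lborel borel ?T) A = (\<integral>\<^sup>+z. indicator A (?T z) \<partial>lborel)"
    using nn_integral_distr[of ?T lborel borel "indicator A"] by simp
  also have "\<dots> = (\<integral>\<^sup>+z. (case z of (x, y) \<Rightarrow> indicator A (p * x, q * x + r * y)) \<partial>(lborel \<Otimes>\<^sub>M lborel))"
    by (simp add: lborel_prod case_prod_beta)
  also have "\<dots> = (\<integral>\<^sup>+x. \<integral>\<^sup>+y. indicator A (p * x, q * x + r * y) \<partial>lborel \<partial>lborel)"
    by (subst lborel.nn_integral_fst[symmetric]) (auto simp: lborel_prod case_prod_beta)
  also have "\<dots> = (\<integral>\<^sup>+x. ennreal (1/r) * \<integral>\<^sup>+y. indicator A (p * x, y) \<partial>lborel \<partial>lborel)"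
    by (intro nn_integral_cong aff' assms) measurable
  also have "\<dots> = ennreal (1/r) * (\<integral>\<^sup>+x. (\<lambda>x. \<integral>\<^sup>+y. indicator A (x, y) \<partial>lborel) (0 + p * x) \<partial>lborel)"
    by (subst nn_integral_cmult) (use mi in auto)
  also have "\<dots> = ennreal (1/r) * (ennreal (1/p) * (\<integral>\<^sup>+x. \<integral>\<^sup>+y. indicator A (x, y) \<partial>lborel \<partial>lborel))"
    by (simp only: aff'[OF assms(1) mi])
  also have "\<dots> = ennreal (1 / (p * r)) * (\<integral>\<^sup>+z. indicator A z \<partial>(lborel \<Otimes>\<^sub>M lborel))"
  proof -
    have "(\<integral>\<^sup>+x. \<integral>\<^sup>+y. indicator A (x, y) \<partial>lborel \<partial>lborel) = (\<integral>\<^sup>+z. indicator A z \<partial>(lborel \<Otimes>\<^sub>M lborel))"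
      by (rule lborel.nn_integral_fst) (simp add: lborel_prod)
    moreover have "ennreal (1 / r) * ennreal (1 / p) = ennreal (1 / (p * r))"
      using assms by (subst ennreal_mult[symmetric]) (auto simp: mult.commute)
    ultimately show ?thesis by (simp only: mult.assoc[symmetric])
  qed
  also have "\<dots> = emeasure (density lborel (\<lambda>_. ennreal (1 / (p * r)))) A"
    by (simp add: emeasure_density nn_integral_cmult lborel_prod)
  finally show "emeasure (distr lborel borel ?T) A = emeasure (density lborel (\<lambda>_. ennreal (1 / (p * r)))) A" .
qed simp

lemma integral_triangular_lborel:
  fixes f :: "real \<times> real \<Rightarrow> 'b::{banach, second_countable_topology}"
  assumes [measurable]: "f \<in> borel_measurable borel" and "p > 0" "r > 0"
  shows "(LINT z|lborel. f (p * fst z, q * fst z + r * snd z)) = (1 / (p * r)) *\<^sub>R (LINT w|lborel. f w)"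
proof -
  have [measurable]: "(\<lambda>z. (p * fst z, q * fst z + r * snd z)) \<in> borel_measurable borel"
    by (intro borel_measurable_continuous_onI continuous_intros)
  have "(LINT z|lborel. f (p * fst z, q * fst z + r * snd z)) =
    integral\<^sup>L (distr lborel borel (\<lambda>z. (p * fst z, q * fst z + r * snd z))) f"
    by (rule integral_distr[symmetric]) auto
  also have "\<dots> = (1 / (p * r)) *\<^sub>R (LINT w|lborel. f w)"
    unfolding distr_triangular_lborel[OF assms(2,3)] using assms
    by (subst integral_density) auto
  finally show ?thesis .
qed

text \<open>
  The Cholesky factor of the matrix \<open>(\<alpha>, \<beta>; \<beta>, \<gamma>)\<close> applied to a standard normal vector \<open>z\<close>, so that the
  result has this covariance matrix. Keeping \<open>z\<close> as the sample point lets vectors with different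
  covariances live on one probability space.
\<close>

definition gauss_pair :: "real \<Rightarrow> real \<Rightarrow> real \<Rightarrow> real \<times> real \<Rightarrow> real \<times> real" where
  "gauss_pair \<alpha> \<beta> \<gamma> z = (sqrt \<alpha> * fst z, \<beta> / sqrt \<alpha> * fst z + sqrt (\<gamma> - \<beta>\<^sup>2 / \<alpha>) * snd z)"

lemma gauss_pair_factors:
  assumes "\<alpha> > 0" "\<alpha> * \<gamma> - \<beta>\<^sup>2 > 0"
  obtains p q r where "p > 0" "p\<^sup>2 = \<alpha>" "r > 0" "q * p = \<beta>" "\<gamma> = q\<^sup>2 + r\<^sup>2"
    "gauss_pair \<alpha> \<beta> \<gamma> = (\<lambda>z. (p * fst z, q * fst z + r * snd z))"
proof -
  have pos: "\<gamma> - \<beta>\<^sup>2 / \<alpha> > 0" using assms by (simp add: field_simps)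
  show thesis
    by (rule that[of "sqrt \<alpha>" "sqrt (\<gamma> - \<beta>\<^sup>2 / \<alpha>)" "\<beta> / sqrt \<alpha>"])
      (use assms pos in \<open>auto simp: gauss_pair_def[abs_def] power_divide\<close>)
qed

lemma gauss_pair_measurable [measurable]: "gauss_pair \<alpha> \<beta> \<gamma> \<in> borel_measurable borel"
  unfolding gauss_pair_def[abs_def] by (intro borel_measurable_continuous_onI continuous_intros)

text \<open>
  The density of the Gaussian vector contains the inverse matrix
  \<open>(\<gamma>, -\<beta>; -\<beta>, \<alpha>) / (\<alpha> \<gamma> - \<beta>\<^sup>2)\<close>.
\<close>

lemma integral_gauss_pair:
  fixes f :: "real \<times> real \<Rightarrow> 'b::{banach, second_countable_topology}"
  assumes [measurable]: "f \<in> borel_measurable borel" and "\<alpha> > 0" "\<alpha> * \<gamma> - \<beta>\<^sup>2 > 0"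
  shows "(LINT z|normal_plane. f (gauss_pair \<alpha> \<beta> \<gamma> z)) =
    (1 / (2 * pi * sqrt (\<alpha> * \<gamma> - \<beta>\<^sup>2))) *\<^sub>R
    (LINT w|lborel. exp (- (\<gamma> * (fst w)\<^sup>2 - 2 * \<beta> * fst w * snd w + \<alpha> * (snd w)\<^sup>2) / (2 * (\<alpha> * \<gamma> - \<beta>\<^sup>2))) *\<^sub>R f w)"
proof -
  obtain p q r where p: "p > 0" "p\<^sup>2 = \<alpha>" and r: "r > 0" and q: "q * p = \<beta>" and \<gamma>: "\<gamma> = q\<^sup>2 + r\<^sup>2"
    and T: "gauss_pair \<alpha> \<beta> \<gamma> = (\<lambda>z. (p * fst z, q * fst z + r * snd z))"
    by (rule gauss_pair_factors[OF assms(2,3)])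
  have D: "\<alpha> * \<gamma> - \<beta>\<^sup>2 = (p * r)\<^sup>2"
    unfolding \<gamma> q[symmetric] p(2)[symmetric] by algebra
  have pr: "p * r > 0" using p r by simp
  have quad: "(\<gamma> * (p * x)\<^sup>2 - 2 * \<beta> * (p * x) * (q * x + r * y) + \<alpha> * (q * x + r * y)\<^sup>2) / (2 * (\<alpha> * \<gamma> - \<beta>\<^sup>2))
     = (x\<^sup>2 + y\<^sup>2) / 2" for x y
  proof -
    have "\<gamma> * (p * x)\<^sup>2 - 2 * \<beta> * (p * x) * (q * x + r * y) + \<alpha> * (q * x + r * y)\<^sup>2 = (p * r)\<^sup>2 * (x\<^sup>2 + y\<^sup>2)"
      unfolding \<gamma> q[symmetric] p(2)[symmetric] by algebra
    then show ?thesis unfolding D using p r by simp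
  qed
  define g where "g w = exp (- (\<gamma> * (fst w)\<^sup>2 - 2 * \<beta> * fst w * snd w + \<alpha> * (snd w)\<^sup>2) / (2 * (\<alpha> * \<gamma> - \<beta>\<^sup>2))) *\<^sub>R f w" for w
  have gm: "g \<in> borel_measurable borel" unfolding g_def
    by (intro borel_measurable_scaleR assms(1) borel_measurable_continuous_onI continuous_intros) (use assms in auto)
  have "(LINT z|normal_plane. f (gauss_pair \<alpha> \<beta> \<gamma> z)) =
      (LINT z|lborel. (1 / (2 * pi)) *\<^sub>R g (p * fst z, q * fst z + r * snd z))"
    unfolding integral_normal_plane[OF measurable_compose[OF gauss_pair_measurable assms(1)]]
  proof (intro Bochner_Integration.integral_cong refl)
    fix z :: "real \<times> real"
    have "g (p * fst z, q * fst z + r * snd z) = exp (- ((fst z)\<^sup>2 + (snd z)\<^sup>2) / 2) *\<^sub>R f (gauss_pair \<alpha> \<beta> \<gamma> z)"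
      unfolding g_def fst_conv snd_conv minus_divide_left[symmetric] quad T ..
    then show "(exp (- ((fst z)\<^sup>2 + (snd z)\<^sup>2) / 2) / (2 * pi)) *\<^sub>R f (gauss_pair \<alpha> \<beta> \<gamma> z) =
        (1 / (2 * pi)) *\<^sub>R g (p * fst z, q * fst z + r * snd z)"
      by (simp only: scaleR_scaleR times_divide_eq_left mult_1)
  qed
  also have "\<dots> = (1 / (2 * pi)) *\<^sub>R (1 / (p * r)) *\<^sub>R (LINT w|lborel. g w)"
    by (simp only: integral_scaleR_right integral_triangular_lborel[OF gm p(1) r(1)])
  also have "\<dots> = (1 / (2 * pi * sqrt (\<alpha> * \<gamma> - \<beta>\<^sup>2))) *\<^sub>R (LINT w|lborel. g w)"
  proof -
    have "sqrt (\<alpha> * \<gamma> - \<beta>\<^sup>2) = p * r"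
      unfolding D real_sqrt_abs using pr by (rule abs_of_pos)
    then show ?thesis by (simp only: scaleR_scaleR times_divide_eq_left times_divide_eq_right mult_1 divide_divide_eq_left mult.commute)
  qed
  finally show ?thesis unfolding g_def .
qed

lemma has_bochner_integral_normal_plane_mult:
  fixes f g :: "real \<Rightarrow> 'b::{real_normed_field, banach, second_countable_topology}"
  assumes f: "integrable std_normal_distribution f" and g: "integrable std_normal_distribution g"
  shows "has_bochner_integral normal_plane (\<lambda>z. f (fst z) * g (snd z))
    (integral\<^sup>L std_normal_distribution f * integral\<^sup>L std_normal_distribution g)"
proof -
  have [measurable]: "f \<in> borel_measurable borel" "g \<in> borel_measurable borel"
    using f g by auto
  have int: "integrable normal_plane (\<lambda>z. f (fst z) * g (snd z))"
    unfolding normal_plane_def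
    by (rule normal_plane.Fubini_integrable) (use f g in \<open>auto simp: norm_mult\<close>)
  have "(LINT z|normal_plane. f (fst z) * g (snd z)) =
    (LINT x|std_normal_distribution. LINT y|std_normal_distribution. f x * g y)"
    using normal_plane.integral_fst'[of "\<lambda>z. f (fst z) * g (snd z)"] int
    unfolding normal_plane_def by simp
  also have "\<dots> = integral\<^sup>L std_normal_distribution f * integral\<^sup>L std_normal_distribution g"
    by simp
  finally show ?thesis using int by (simp add: has_bochner_integral_iff)
qed

lemma char_gauss_pair:
  assumes "\<alpha> > 0" "\<alpha> * \<gamma> - \<beta>\<^sup>2 > 0"
  shows "(LINT z|normal_plane. iexp (u * fst (gauss_pair \<alpha> \<beta> \<gamma> z) + v * snd (gauss_pair \<alpha> \<beta> \<gamma> z)))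
    = of_real (exp (- (\<alpha> * u\<^sup>2 + 2 * \<beta> * u * v + \<gamma> * v\<^sup>2) / 2))"
proof -
  obtain p q r where p: "p > 0" "p\<^sup>2 = \<alpha>" and r: "r > 0" and q: "q * p = \<beta>" and \<gamma>: "\<gamma> = q\<^sup>2 + r\<^sup>2"
    and T: "gauss_pair \<alpha> \<beta> \<gamma> = (\<lambda>z. (p * fst z, q * fst z + r * snd z))"
    by (rule gauss_pair_factors[OF assms])
  have chr: "(LINT x|std_normal_distribution. iexp (t * x)) = of_real (exp (- t\<^sup>2 / 2))" for t
    using char_std_normal_distribution unfolding char_def fun_eq_iff by auto
  have int: "integrable std_normal_distribution (\<lambda>x. iexp (t * x))" for t
    by (rule std_normal.integrable_const_bound[where B = 1]) auto
  have "(LINT z|normal_plane. iexp (u * fst (gauss_pair \<alpha> \<beta> \<gamma> z) + v * snd (gauss_pair \<alpha> \<beta> \<gamma> z)))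
    = (LINT z|normal_plane. iexp ((u * p + v * q) * fst z) * iexp ((v * r) * snd z))"
  proof (intro Bochner_Integration.integral_cong refl)
    fix z :: "real \<times> real"
    have "u * fst (gauss_pair \<alpha> \<beta> \<gamma> z) + v * snd (gauss_pair \<alpha> \<beta> \<gamma> z) = (u * p + v * q) * fst z + (v * r) * snd z"
      by (simp add: T algebra_simps)
    then have "iexp (u * fst (gauss_pair \<alpha> \<beta> \<gamma> z) + v * snd (gauss_pair \<alpha> \<beta> \<gamma> z)) =
        iexp ((u * p + v * q) * fst z + (v * r) * snd z)" by (rule arg_cong)
    also have "\<dots> = iexp ((u * p + v * q) * fst z) * iexp ((v * r) * snd z)"
      unfolding of_real_add distrib_left exp_add ..
    finally show "iexp (u * fst (gauss_pair \<alpha> \<beta> \<gamma> z) + v * snd (gauss_pair \<alpha> \<beta> \<gamma> z)) =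
        iexp ((u * p + v * q) * fst z) * iexp ((v * r) * snd z)" .
  qed
  also have "\<dots> = (LINT x|std_normal_distribution. iexp ((u * p + v * q) * x)) *
      (LINT x|std_normal_distribution. iexp ((v * r) * x))"
    by (rule has_bochner_integral_integral_eq[OF has_bochner_integral_normal_plane_mult[OF int int]])
  also have "\<dots> = of_real (exp (- ((u * p + v * q)\<^sup>2 + (v * r)\<^sup>2) / 2))"
    unfolding chr of_real_mult[symmetric] exp_add[symmetric] minus_add_distrib add_divide_distrib ..
  also have "(u * p + v * q)\<^sup>2 + (v * r)\<^sup>2 = \<alpha> * u\<^sup>2 + 2 * \<beta> * u * v + \<gamma> * v\<^sup>2"
    unfolding \<gamma> q[symmetric] p(2)[symmetric] by (simp add: power2_eq_square algebra_simps)
  finally show ?thesis .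
qed

definition normal_moment :: "nat \<Rightarrow> real" where
  "normal_moment n = (if odd n then 0 else fact n / (2 ^ (n div 2) * fact (n div 2)))"

lemma has_bochner_integral_normal_moment:
  "has_bochner_integral std_normal_distribution (\<lambda>x. x ^ n) (normal_moment n)"
proof -
  have "(LINT x|std_normal_distribution. x ^ n) = normal_moment n"
    using std_normal_distribution_even_moments(1)[of "n div 2"]
    by (cases "odd n") (auto simp: normal_moment_def integral_std_normal_distribution_moment_odd)
  then show ?thesis
    using integrable_std_normal_distribution_moment[of n] by (simp add: has_bochner_integral_iff)
qed

lemma has_bochner_integral_plane_moment:
  "has_bochner_integral normal_plane (\<lambda>z. fst z ^ i * snd z ^ j) (normal_moment i * normal_moment j)"
  using has_bochner_integral_normal_plane_mult[of "\<lambda>x. x ^ i" "\<lambda>x. x ^ j"]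
    has_bochner_integral_normal_moment[of i] has_bochner_integral_normal_moment[of j]
  by (simp add: has_bochner_integral_iff)

text \<open>
  Binomial expansion of the second factor, followed by independence of the two coordinates.
\<close>

lemma has_bochner_integral_triangular_moment:
  "has_bochner_integral normal_plane (\<lambda>z. (p * fst z) ^ i * (q * fst z + r * snd z) ^ n)
    (p ^ i * (\<Sum>k\<le>n. real (n choose k) * q ^ k * r ^ (n - k) * (normal_moment (i + k) * normal_moment (n - k))))"
proof -
  have eq: "(p * fst z) ^ i * (q * fst z + r * snd z) ^ n =
      p ^ i * (\<Sum>k\<le>n. real (n choose k) * q ^ k * r ^ (n - k) * (fst z ^ (i + k) * snd z ^ (n - k)))" for z :: "real \<times> real"
    unfolding binomial_ring by (simp add: power_mult_distrib power_add sum_distrib_left mult_ac)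
  show ?thesis unfolding eq
    by (intro has_bochner_integral_mult_right has_bochner_integral_sum has_bochner_integral_plane_moment)
qed

text \<open>
  These are the cases of Wick's formula that enter the coefficient of \<open>\<epsilon>\<close>: besides the vanishing odd
  moments, products of two of the monomials \<open>X\<close>, \<open>X\<^sup>3\<close>, \<open>Y\<close>, \<open>Y\<^sup>3\<close>, and the even monomials of degree two and four.
\<close>

lemma gauss_pair_moments:
  assumes "\<alpha> > 0" "\<alpha> * \<gamma> - \<beta>\<^sup>2 > 0"
  defines "X \<equiv> \<lambda>z. fst (gauss_pair \<alpha> \<beta> \<gamma> z)" and "Y \<equiv> \<lambda>z. snd (gauss_pair \<alpha> \<beta> \<gamma> z)"
  shows "has_bochner_integral normal_plane (\<lambda>z. X z) 0"
    and "has_bochner_integral normal_plane (\<lambda>z. Y z) 0"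
    and "has_bochner_integral normal_plane (\<lambda>z. X z ^ 3) 0"
    and "has_bochner_integral normal_plane (\<lambda>z. Y z ^ 3) 0"
    and "has_bochner_integral normal_plane (\<lambda>z. X z ^ 2) \<alpha>"
    and "has_bochner_integral normal_plane (\<lambda>z. X z * Y z) \<beta>"
    and "has_bochner_integral normal_plane (\<lambda>z. Y z ^ 2) \<gamma>"
    and "has_bochner_integral normal_plane (\<lambda>z. X z ^ 4) (3 * \<alpha>\<^sup>2)"
    and "has_bochner_integral normal_plane (\<lambda>z. X z ^ 3 * Y z) (3 * \<alpha> * \<beta>)"
    and "has_bochner_integral normal_plane (\<lambda>z. X z * Y z ^ 3) (3 * \<beta> * \<gamma>)"
    and "has_bochner_integral normal_plane (\<lambda>z. Y z ^ 4) (3 * \<gamma>\<^sup>2)"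
    and "has_bochner_integral normal_plane (\<lambda>z. X z ^ 6) (15 * \<alpha> ^ 3)"
    and "has_bochner_integral normal_plane (\<lambda>z. X z ^ 3 * Y z ^ 3) (9 * \<alpha> * \<beta> * \<gamma> + 6 * \<beta> ^ 3)"
    and "has_bochner_integral normal_plane (\<lambda>z. Y z ^ 6) (15 * \<gamma> ^ 3)"
proof -
  obtain p q r where p: "p > 0" "p\<^sup>2 = \<alpha>" and r: "r > 0" and q: "q * p = \<beta>" and \<gamma>: "\<gamma> = q\<^sup>2 + r\<^sup>2"
    and T: "gauss_pair \<alpha> \<beta> \<gamma> = (\<lambda>z. (p * fst z, q * fst z + r * snd z))"
    by (rule gauss_pair_factors[OF assms(1,2)])
  have m: "has_bochner_integral normal_plane (\<lambda>z. X z ^ i * Y z ^ n) c"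
    if "p ^ i * (\<Sum>k\<le>n. real (n choose k) * q ^ k * r ^ (n - k) * (normal_moment (i + k) * normal_moment (n - k))) = c" for i n c
    using has_bochner_integral_triangular_moment[of p i q r n] unfolding that X_def Y_def T fst_conv snd_conv .
  note rew = \<gamma> q[symmetric] p(2)[symmetric]
  have nm: "normal_moment 0 = 1" "normal_moment 1 = 0" "normal_moment 2 = 1" "normal_moment 3 = 0"
    "normal_moment (Suc (Suc 0)) = 1" "normal_moment 4 = 3" "normal_moment 5 = 0" "normal_moment 6 = 15" "normal_moment (Suc 0) = 0"
    by (simp_all add: normal_moment_def fact_numeral)
  have at: "{..1::nat} = {0,1}" "{..2::nat} = {0,1,2}" "{..3::nat} = {0,1,2,3}" "{..4::nat} = {0,1,2,3,4}"
    "{..6::nat} = {0,1,2,3,4,5,6}" by auto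
  have ch: "(2::nat) choose 2 = 1" "(3::nat) choose 2 = 3" "(3::nat) choose 3 = 1" "(4::nat) choose 2 = 6" "(4::nat) choose 3 = 4"
    "(4::nat) choose 4 = 1" "(6::nat) choose 2 = 15" "(6::nat) choose 3 = 20" "(6::nat) choose 4 = 15"
    "(6::nat) choose 5 = 6" "(6::nat) choose 6 = 1"
    by (simp_all add: eval_nat_numeral)
  note s = nm at ch
  show "has_bochner_integral normal_plane (\<lambda>z. X z) 0"
    using m[of 1 0 0] by (simp add: s)
  show "has_bochner_integral normal_plane (\<lambda>z. Y z) 0"
    using m[of 0 1 0] by (simp add: s)
  show "has_bochner_integral normal_plane (\<lambda>z. X z ^ 3) 0"
    using m[of 3 0 0] by (simp add: s)
  show "has_bochner_integral normal_plane (\<lambda>z. Y z ^ 3) 0"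
    using m[of 0 3 0] by (simp add: s)
  show "has_bochner_integral normal_plane (\<lambda>z. X z ^ 2) \<alpha>"
    using m[of 2 0 \<alpha>] p by (simp add: s)
  show "has_bochner_integral normal_plane (\<lambda>z. X z * Y z) \<beta>"
    using m[of 1 1 \<beta>] q by (simp add: s mult_ac)
  show "has_bochner_integral normal_plane (\<lambda>z. Y z ^ 2) \<gamma>"
    using m[of 0 2 \<gamma>] \<gamma> by (simp add: s)
  have "p ^ 4 * 3 = 3 * \<alpha>\<^sup>2"
    unfolding p(2)[symmetric] by algebra
  then show "has_bochner_integral normal_plane (\<lambda>z. X z ^ 4) (3 * \<alpha>\<^sup>2)"
    using m[of 4 0 "3 * \<alpha>\<^sup>2"] by (simp add: s)
  have "p ^ 3 * (q * 3) = 3 * \<alpha> * \<beta>"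
    unfolding rew by algebra
  then show "has_bochner_integral normal_plane (\<lambda>z. X z ^ 3 * Y z) (3 * \<alpha> * \<beta>)"
    using m[of 3 1 "3 * \<alpha> * \<beta>"] by (simp add: s)
  have "p * (3 * q * r\<^sup>2 + q ^ 3 * 3) = 3 * \<beta> * \<gamma>"
    unfolding rew by algebra
  then show "has_bochner_integral normal_plane (\<lambda>z. X z * Y z ^ 3) (3 * \<beta> * \<gamma>)"
    using m[of 1 3 "3 * \<beta> * \<gamma>"] by (simp add: s)
  have "r ^ 4 * 3 + (6 * q\<^sup>2 * r\<^sup>2 + q ^ 4 * 3) = 3 * \<gamma>\<^sup>2"
    unfolding rew by algebra
  then show "has_bochner_integral normal_plane (\<lambda>z. Y z ^ 4) (3 * \<gamma>\<^sup>2)"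
    using m[of 0 4 "3 * \<gamma>\<^sup>2"] by (simp add: s)
  have "p ^ 6 * 15 = 15 * \<alpha> ^ 3"
    unfolding p(2)[symmetric] by algebra
  then show "has_bochner_integral normal_plane (\<lambda>z. X z ^ 6) (15 * \<alpha> ^ 3)"
    using m[of 6 0 "15 * \<alpha> ^ 3"] by (simp add: s)
  have "p ^ 3 * (3 * q * r\<^sup>2 * 3 + q ^ 3 * 15) = 9 * \<alpha> * \<beta> * \<gamma> + 6 * \<beta> ^ 3"
    unfolding rew by algebra
  then show "has_bochner_integral normal_plane (\<lambda>z. X z ^ 3 * Y z ^ 3) (9 * \<alpha> * \<beta> * \<gamma> + 6 * \<beta> ^ 3)"
    using m[of 3 3 "9 * \<alpha> * \<beta> * \<gamma> + 6 * \<beta> ^ 3"] by (simp add: s)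
  have "r ^ 6 * 15 + (15 * q\<^sup>2 * r ^ 4 * 3 + (15 * q ^ 4 * r\<^sup>2 * 3 + q ^ 6 * 15)) = 15 * \<gamma> ^ 3"
    unfolding rew by algebra
  then show "has_bochner_integral normal_plane (\<lambda>z. Y z ^ 6) (15 * \<gamma> ^ 3)"
    using m[of 0 6 "15 * \<gamma> ^ 3"] by (simp add: s)
qed

text \<open>
  Multiplying a Gaussian density by \<open>exp (- (P X\<^sup>2 + R Y\<^sup>2) / 2)\<close> adds \<open>diag(P, R)\<close> to the inverse covariance.
  The three equations for \<open>s\<close>, \<open>u\<close>, \<open>v\<close> say that \<open>(s, u; u, v)\<close> is the inverse of that sum. In the Laplace
  method this factor is the part of the exponent that is quadratic at the saddle point.
\<close>

lemma integral_gauss_pair_tilt: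
  fixes f :: "real \<times> real \<Rightarrow> 'b::{banach, second_countable_topology}"
  assumes f [measurable]: "f \<in> borel_measurable borel"
    and M: "\<alpha> > 0" "\<alpha> * \<gamma> - \<beta>\<^sup>2 > 0" and S: "s > 0" "s * v - u\<^sup>2 > 0"
    and inv: "v / (s * v - u\<^sup>2) = \<gamma> / (\<alpha> * \<gamma> - \<beta>\<^sup>2) + P" "s / (s * v - u\<^sup>2) = \<alpha> / (\<alpha> * \<gamma> - \<beta>\<^sup>2) + R"
      "u / (s * v - u\<^sup>2) = \<beta> / (\<alpha> * \<gamma> - \<beta>\<^sup>2)"
  defines "X \<equiv> \<lambda>z. fst (gauss_pair \<alpha> \<beta> \<gamma> z)" and "Y \<equiv> \<lambda>z. snd (gauss_pair \<alpha> \<beta> \<gamma> z)"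
  shows "(LINT z|normal_plane. exp (- (P * (X z)\<^sup>2 + R * (Y z)\<^sup>2) / 2) *\<^sub>R f (gauss_pair \<alpha> \<beta> \<gamma> z)) =
    sqrt ((s * v - u\<^sup>2) / (\<alpha> * \<gamma> - \<beta>\<^sup>2)) *\<^sub>R (LINT z|normal_plane. f (gauss_pair s u v z))"
proof -
  define D D' where "D = \<alpha> * \<gamma> - \<beta>\<^sup>2" and "D' = s * v - u\<^sup>2"
  define g where "g w = exp (- (P * (fst w)\<^sup>2 + R * (snd w)\<^sup>2) / 2) *\<^sub>R f w" for w :: "real \<times> real"
  have D: "D > 0" "D' > 0" using M S by (auto simp: D_def D'_def)
  have gm: "g \<in> borel_measurable borel" unfolding g_def
    by (intro borel_measurable_scaleR f borel_measurable_continuous_onI continuous_intros) auto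
  have e: "exp (- (\<gamma> * (fst w)\<^sup>2 - 2 * \<beta> * fst w * snd w + \<alpha> * (snd w)\<^sup>2) / (2 * D)) *\<^sub>R g w =
      exp (- (v * (fst w)\<^sup>2 - 2 * u * fst w * snd w + s * (snd w)\<^sup>2) / (2 * D')) *\<^sub>R f w" for w
  proof -
    have "(v * (fst w)\<^sup>2 - 2 * u * fst w * snd w + s * (snd w)\<^sup>2) / (2 * D') =
        (v / D' * (fst w)\<^sup>2 - 2 * (u / D') * fst w * snd w + s / D' * (snd w)\<^sup>2) / 2"
      using D by (simp add: field_simps)
    also have "\<dots> = (\<gamma> * (fst w)\<^sup>2 - 2 * \<beta> * fst w * snd w + \<alpha> * (snd w)\<^sup>2) / (2 * D) +
        (P * (fst w)\<^sup>2 + R * (snd w)\<^sup>2) / 2"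
      using D unfolding inv[folded D_def D'_def] by (simp add: field_simps)
    finally show ?thesis
      unfolding g_def scaleR_scaleR exp_add[symmetric] minus_divide_left[symmetric] by simp
  qed
  have "(LINT z|normal_plane. exp (- (P * (X z)\<^sup>2 + R * (Y z)\<^sup>2) / 2) *\<^sub>R f (gauss_pair \<alpha> \<beta> \<gamma> z)) =
      (LINT z|normal_plane. g (gauss_pair \<alpha> \<beta> \<gamma> z))"
    by (simp only: g_def X_def Y_def)
  also have "\<dots> = (1 / (2 * pi * sqrt D)) *\<^sub>R
      (LINT w|lborel. exp (- (v * (fst w)\<^sup>2 - 2 * u * fst w * snd w + s * (snd w)\<^sup>2) / (2 * D')) *\<^sub>R f w)"
    unfolding integral_gauss_pair[OF gm M] D_def[symmetric] e ..
  also have "1 / (2 * pi * sqrt D) = sqrt (D' / D) * (1 / (2 * pi * sqrt D'))"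
    using D by (simp add: real_sqrt_divide)
  also have "\<dots> *\<^sub>R (LINT w|lborel. exp (- (v * (fst w)\<^sup>2 - 2 * u * fst w * snd w + s * (snd w)\<^sup>2) / (2 * D')) *\<^sub>R f w)
      = sqrt (D' / D) *\<^sub>R (LINT z|normal_plane. f (gauss_pair s u v z))"
    unfolding integral_gauss_pair[OF f S] D'_def[symmetric] scaleR_scaleR ..
  finally show ?thesis unfolding D_def D'_def .
qed

definition poly_weight :: "real \<times> real \<Rightarrow> real" where
  "poly_weight z = (1 + \<bar>fst z\<bar>) * (1 + \<bar>snd z\<bar>)"

lemma integrable_poly_weight_power: "integrable normal_plane (\<lambda>z. poly_weight z ^ n)"
proof -
  have 1: "integrable std_normal_distribution (\<lambda>x::real. (1 + \<bar>x\<bar>) ^ n)"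
  proof -
    have "integrable std_normal_distribution (\<lambda>x. \<Sum>k\<le>n. real (n choose k) * \<bar>x ^ (n - k)\<bar>)"
      by (intro Bochner_Integration.integrable_sum integrable_mult_right integrable_abs integrable_std_normal_distribution_moment)
    then show ?thesis by (simp add: binomial_ring power_abs)
  qed
  show ?thesis
    using has_bochner_integral_normal_plane_mult[OF 1 1]
    by (simp add: has_bochner_integral_iff poly_weight_def power_mult_distrib)
qed

section \<open>Error terms of polynomial growth\<close>

text \<open>
  All Gaussian moments of the weight are finite, so an estimate of this kind can be integrated
  (\<open>poly_bigo_integral\<close>). As it holds on the whole plane and not only near the saddle point, the Laplace
  method needs no separate treatment of the tails.
\<close>

definition poly_bigo :: "nat \<Rightarrow> (real \<Rightarrow> real \<times> real \<Rightarrow> complex) \<Rightarrow> bool" where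
  "poly_bigo k f \<longleftrightarrow> (\<exists>C N. \<forall>\<^sub>F h in at_right 0. \<forall>z. norm (f h z) \<le> C * h ^ k * poly_weight z ^ N)"

lemma poly_weight_ge_1: "poly_weight z \<ge> 1"
  unfolding poly_weight_def using mult_mono[of 1 "1 + \<bar>fst z\<bar>" 1 "1 + \<bar>snd z\<bar>"] by simp

lemma eventually_at_right_01: "\<forall>\<^sub>F h in at_right (0::real). 0 < h \<and> h < 1"
  using eventually_at_right_real[of 0 1] by simp

lemma poly_bigoI:
  assumes "\<And>h z. 0 < h \<Longrightarrow> h < h0 \<Longrightarrow> norm (f h z) \<le> C * h ^ k * poly_weight z ^ N" "h0 > 0"
  shows "poly_bigo k f"
  unfolding poly_bigo_def
  by (intro exI[of _ C] exI[of _ N] eventually_mono[OF eventually_at_right_real[OF assms(2)]]) (use assms(1) in auto)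

lemma poly_bigoE:
  assumes "poly_bigo k f"
  obtains C N where "C \<ge> 0" "\<forall>\<^sub>F h in at_right 0. 0 < h \<and> h < 1 \<and> (\<forall>z. norm (f h z) \<le> C * h ^ k * poly_weight z ^ N)"
proof -
  obtain C N where 1: "\<forall>\<^sub>F h in at_right 0. \<forall>z. norm (f h z) \<le> C * h ^ k * poly_weight z ^ N"
    using assms unfolding poly_bigo_def by blast
  have "\<forall>\<^sub>F h in at_right 0. 0 < h \<and> h < 1 \<and> (\<forall>z. norm (f h z) \<le> \<bar>C\<bar> * h ^ k * poly_weight z ^ N)"
    using 1 eventually_at_right_01
  proof eventually_elim
    case (elim h)
    have "C * h ^ k * poly_weight z ^ N \<le> \<bar>C\<bar> * h ^ k * poly_weight z ^ N" for z
      using elim poly_weight_ge_1[of z] by (intro mult_right_mono) auto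
    then show ?case using elim by (meson order_trans)
  qed
  then show ?thesis using that[of "\<bar>C\<bar>" N] by simp
qed

lemma poly_bigo_cong:
  assumes "poly_bigo k f" "\<And>h z. h > 0 \<Longrightarrow> f h z = g h z"
  shows "poly_bigo k g"
proof -
  obtain C N where "C \<ge> 0" and 1: "\<forall>\<^sub>F h in at_right 0. 0 < h \<and> h < 1 \<and> (\<forall>z. norm (f h z) \<le> C * h ^ k * poly_weight z ^ N)"
    by (rule poly_bigoE[OF assms(1)])
  show ?thesis unfolding poly_bigo_def
    by (intro exI[of _ C] exI[of _ N] eventually_mono[OF 1]) (use assms(2) in auto)
qed

lemma poly_bigo_mono:
  assumes "poly_bigo k f" "j \<le> k"
  shows "poly_bigo j f"
proof -
  obtain C N where C: "C \<ge> 0" and 1: "\<forall>\<^sub>F h in at_right 0. 0 < h \<and> h < 1 \<and> (\<forall>z. norm (f h z) \<le> C * h ^ k * poly_weight z ^ N)"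
    by (rule poly_bigoE[OF assms(1)])
  have "\<forall>\<^sub>F h in at_right 0. \<forall>z. norm (f h z) \<le> C * h ^ j * poly_weight z ^ N"
    using 1
  proof eventually_elim
    case (elim h)
    have "C * h ^ k * poly_weight z ^ N \<le> C * h ^ j * poly_weight z ^ N" for z
      using elim C poly_weight_ge_1[of z] assms(2) by (intro mult_right_mono mult_left_mono power_decreasing) auto
    then show ?case using elim by (meson order_trans)
  qed
  then show ?thesis unfolding poly_bigo_def by blast
qed

lemma poly_bigo_add:
  assumes "poly_bigo k f" "poly_bigo k g"
  shows "poly_bigo k (\<lambda>h z. f h z + g h z)"
proof -
  obtain C N where C: "C \<ge> 0" and 1: "\<forall>\<^sub>F h in at_right 0. 0 < h \<and> h < 1 \<and> (\<forall>z. norm (f h z) \<le> C * h ^ k * poly_weight z ^ N)"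
    by (rule poly_bigoE[OF assms(1)])
  obtain D M where D: "D \<ge> 0" and 2: "\<forall>\<^sub>F h in at_right 0. 0 < h \<and> h < 1 \<and> (\<forall>z. norm (g h z) \<le> D * h ^ k * poly_weight z ^ M)"
    by (rule poly_bigoE[OF assms(2)])
  have "\<forall>\<^sub>F h in at_right 0. \<forall>z. norm (f h z + g h z) \<le> (C + D) * h ^ k * poly_weight z ^ (N + M)"
    using 1 2
  proof eventually_elim
    case (elim h)
    show ?case
    proof
      fix z
      have "norm (f h z + g h z) \<le> C * h ^ k * poly_weight z ^ N + D * h ^ k * poly_weight z ^ M"
        using elim norm_triangle_ineq[of "f h z" "g h z"] by (smt (verit))
      also have "\<dots> \<le> C * h ^ k * poly_weight z ^ (N + M) + D * h ^ k * poly_weight z ^ (N + M)"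
        using elim C D poly_weight_ge_1[of z] by (intro add_mono mult_left_mono power_increasing) auto
      finally show "norm (f h z + g h z) \<le> (C + D) * h ^ k * poly_weight z ^ (N + M)" by (simp add: algebra_simps)
    qed
  qed
  then show ?thesis unfolding poly_bigo_def by blast
qed

lemma poly_bigo_mult:
  assumes "poly_bigo j f" "poly_bigo k g" "i \<le> j + k"
  shows "poly_bigo i (\<lambda>h z. f h z * g h z)"
proof -
  obtain C N where C: "C \<ge> 0" and 1: "\<forall>\<^sub>F h in at_right 0. 0 < h \<and> h < 1 \<and> (\<forall>z. norm (f h z) \<le> C * h ^ j * poly_weight z ^ N)"
    by (rule poly_bigoE[OF assms(1)])
  obtain D M where D: "D \<ge> 0" and 2: "\<forall>\<^sub>F h in at_right 0. 0 < h \<and> h < 1 \<and> (\<forall>z. norm (g h z) \<le> D * h ^ k * poly_weight z ^ M)"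
    by (rule poly_bigoE[OF assms(2)])
  have "\<forall>\<^sub>F h in at_right 0. \<forall>z. norm (f h z * g h z) \<le> (C * D) * h ^ (j + k) * poly_weight z ^ (N + M)"
    using 1 2
  proof eventually_elim
    case (elim h)
    show ?case
    proof
      fix z
      have "norm (f h z * g h z) \<le> (C * h ^ j * poly_weight z ^ N) * (D * h ^ k * poly_weight z ^ M)"
        unfolding norm_mult using elim C poly_weight_ge_1[of z] by (intro mult_mono) (simp_all del: split_paired_All)
      then show "norm (f h z * g h z) \<le> (C * D) * h ^ (j + k) * poly_weight z ^ (N + M)"
        by (simp add: power_add mult_ac)
    qed
  qed
  then have "poly_bigo (j + k) (\<lambda>h z. f h z * g h z)" unfolding poly_bigo_def by blast
  then show ?thesis using poly_bigo_mono assms(3) by blast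
qed

lemma poly_bigo_const: "poly_bigo 0 (\<lambda>h z. c)"
  by (rule poly_bigoI[of 1 _ "norm c" _ 0]) auto

lemma poly_bigo_h: "poly_bigo k (\<lambda>h z. of_real h ^ k)"
  by (rule poly_bigoI[of 1 _ 1 _ 0]) (auto simp: norm_power)

lemma poly_bigo_cmult: "poly_bigo k f \<Longrightarrow> poly_bigo k (\<lambda>h z. c * f h z)"
  using poly_bigo_mult[OF poly_bigo_const] by (metis add_0 order_refl)

lemma poly_bigo_minus: "poly_bigo k f \<Longrightarrow> poly_bigo k (\<lambda>h z. - f h z)"
  using poly_bigo_cmult[of k f "-1"] by simp

lemma poly_bigo_diff:
  assumes "poly_bigo k f" "poly_bigo k g"
  shows "poly_bigo k (\<lambda>h z. f h z - g h z)"
  using poly_bigo_add[OF assms(1) poly_bigo_minus[OF assms(2)]] by simp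

lemma poly_bigo_power:
  assumes "poly_bigo 0 f"
  shows "poly_bigo 0 (\<lambda>h z. f h z ^ n)"
  by (induction n) (use assms poly_bigo_const[of 1] poly_bigo_mult[of 0 f 0 _ 0] in auto)

lemma poly_bigo_fst: "poly_bigo 0 (\<lambda>h z. of_real (fst z))"
proof (rule poly_bigoI[of 1 _ 1 _ 1])
  fix h :: real and z :: "real \<times> real"
  have "\<bar>fst z\<bar> * 1 \<le> (1 + \<bar>fst z\<bar>) * (1 + \<bar>snd z\<bar>)" by (intro mult_mono) auto
  then show "norm (complex_of_real (fst z)) \<le> 1 * h ^ 0 * poly_weight z ^ 1" by (simp add: poly_weight_def)
qed simp

lemma poly_bigo_snd: "poly_bigo 0 (\<lambda>h z. of_real (snd z))"
proof (rule poly_bigoI[of 1 _ 1 _ 1])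
  fix h :: real and z :: "real \<times> real"
  have "1 * \<bar>snd z\<bar> \<le> (1 + \<bar>fst z\<bar>) * (1 + \<bar>snd z\<bar>)" by (intro mult_mono) auto
  then show "norm (complex_of_real (snd z)) \<le> 1 * h ^ 0 * poly_weight z ^ 1" by (simp add: poly_weight_def)
qed simp

lemma poly_bigo_integral:
  assumes f: "poly_bigo k f" and m: "\<And>h. f h \<in> borel_measurable borel"
  shows "\<exists>C. \<forall>\<^sub>F h in at_right 0. integrable normal_plane (f h) \<and> norm (LINT z|normal_plane. f h z) \<le> C * h ^ k"
proof -
  obtain C N where C: "C \<ge> 0" and 1: "\<forall>\<^sub>F h in at_right 0. 0 < h \<and> h < 1 \<and> (\<forall>z. norm (f h z) \<le> C * h ^ k * poly_weight z ^ N)"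
    by (rule poly_bigoE[OF f])
  have "\<forall>\<^sub>F h in at_right 0. integrable normal_plane (f h) \<and>
      norm (LINT z|normal_plane. f h z) \<le> (C * (LINT z|normal_plane. poly_weight z ^ N)) * h ^ k"
    using 1
  proof eventually_elim
    case (elim h)
    have ib: "integrable normal_plane (\<lambda>z. C * h ^ k * poly_weight z ^ N)"
      by (intro integrable_mult_right integrable_poly_weight_power)
    have i: "integrable normal_plane (f h)"
    proof (rule Bochner_Integration.integrable_bound[OF ib])
      show "f h \<in> borel_measurable normal_plane"
        using m[of h] by (simp add: measurable_cong_sets[OF sets_normal_plane refl])
      show "AE z in normal_plane. norm (f h z) \<le> norm (C * h ^ k * poly_weight z ^ N)"
        using elim by (intro AE_I2) (metis abs_ge_self order_trans real_norm_def)
    qed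
    have "norm (LINT z|normal_plane. f h z) \<le> (LINT z|normal_plane. norm (f h z))"
      by (rule integral_norm_bound)
    also have "\<dots> \<le> (LINT z|normal_plane. C * h ^ k * poly_weight z ^ N)"
      using i ib elim by (intro integral_mono integrable_norm) auto
    finally show ?case using i by (simp add: mult_ac)
  qed
  then show ?thesis by blast
qed

text \<open>
  The factor \<open>exp (max 0 (Re z))\<close> instead of \<open>exp (norm z)\<close> matters: the estimate is applied to functions of
  polynomial growth that are multiplied by \<open>exp (- Q / 2)\<close>, and only their real part is bounded above by
  \<open>Q / 2\<close> plus a constant.
\<close>

lemma exp_taylor2:
  "norm (exp z - (1 + z + z\<^sup>2 / 2)) \<le> exp (max 0 (Re z)) * norm z ^ 3"
proof -
  have A: "norm (exp z - (\<Sum>k\<le>2. exp 0 * (z - 0) ^ k / fact k)) \<le> exp (max 0 (Re z)) * cmod (z - 0) ^ (Suc 2) / fact 2"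
  proof (rule complex_Taylor[of "closed_segment 0 z" 2 "\<lambda>k. exp"])
    show "convex (closed_segment 0 z)" by (rule convex_closed_segment)
  next
    fix x assume "x \<in> closed_segment 0 z"
    then obtain u where u: "x = of_real u * z" "0 \<le> u" "u \<le> 1"
      by (auto simp: closed_segment_def scaleR_conv_of_real)
    then have "Re x = u * Re z" by simp
    also have "\<dots> \<le> max 0 (Re z)"
      using u mult_left_le_one_le[of "Re z" u] mult_nonneg_nonpos[of u "Re z"] by (cases "Re z \<ge> 0") auto
    finally show "cmod (exp x) \<le> exp (max 0 (Re z))" by simp
  qed (auto intro: DERIV_subset[OF DERIV_exp])
  have B: "(\<Sum>k\<le>2. exp 0 * (z - 0) ^ k / fact k) = 1 + z + z\<^sup>2 / 2"
    by (simp add: numeral_eq_Suc)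
  have C: "exp (max 0 (Re z)) * cmod (z - 0) ^ (Suc 2) / fact 2 = (exp (max 0 (Re z)) * norm z ^ 3) / 2"
    by (simp only: diff_zero fact_2 Suc_numeral semiring_norm)
  have D: "(exp (max 0 (Re z)) * norm z ^ 3) / 2 \<le> exp (max 0 (Re z)) * norm z ^ 3"
    by simp
  show ?thesis using A unfolding B C using D by (rule order_trans)
qed

text \<open>
  This is the Laplace method: an exponent \<open>- Q / 2 + h e\<^sub>1 + h\<^sup>2 e\<^sub>2 + O(h\<^sup>3)\<close> is expanded around its quadratic
  part. The hypothesis on \<open>B\<close> bounds the modulus of the full exponential \<open>exp (\<delta> - Q / 2)\<close>, which keeps the
  Taylor remainder polynomial although \<open>exp \<delta>\<close> alone may grow like a Gaussian.
\<close>

lemma poly_bigo_exp: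
  fixes Q :: "real \<times> real \<Rightarrow> real"
  assumes e: "poly_bigo 0 (\<lambda>h. e1)" "poly_bigo 0 (\<lambda>h. e2)"
    and \<delta>: "poly_bigo 3 (\<lambda>h z. \<delta> h z - (of_real h * e1 z + of_real h ^ 2 * e2 z))"
    and Q: "\<And>z. Q z \<ge> 0" and B: "\<forall>\<^sub>F h in at_right 0. \<forall>z. Re (\<delta> h z) - Q z / 2 \<le> B"
  shows "poly_bigo 3 (\<lambda>h z. of_real (exp (- Q z / 2)) *
     (exp (\<delta> h z) - (1 + of_real h * e1 z + of_real h ^ 2 * (e2 z + e1 z ^ 2 / 2))))"
proof -
  define \<rho> where "\<rho> h z = \<delta> h z - (of_real h * e1 z + of_real h ^ 2 * e2 z)" for h z
  have \<rho>: "poly_bigo 3 \<rho>" using \<delta> unfolding \<rho>_def .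
  have he1: "poly_bigo 1 (\<lambda>h z. of_real h * e1 z)"
    using poly_bigo_mult[OF poly_bigo_h[of 1] e(1), of 1] by simp
  have he2: "poly_bigo 2 (\<lambda>h z. of_real h ^ 2 * e2 z)"
    using poly_bigo_mult[OF poly_bigo_h[of 2] e(2), of 2] by simp
  have d: "poly_bigo 1 \<delta>"
    by (rule poly_bigo_cong[OF poly_bigo_add[OF poly_bigo_mono[OF \<rho>] poly_bigo_add[OF he1 poly_bigo_mono[OF he2]]]])
      (auto simp: \<rho>_def)
  have E: "poly_bigo 0 (\<lambda>h z. of_real (exp (- Q z / 2)))"
    using Q by (intro poly_bigoI[of 1 _ 1 _ 0]) auto
  have d3: "poly_bigo 3 (\<lambda>h z. \<delta> h z * (\<delta> h z * \<delta> h z))"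
    by (intro poly_bigo_mult[where j = 1 and k = 2] poly_bigo_mult[where j = 1 and k = 1 and i = 2] d) simp_all
  have 1: "poly_bigo 3 (\<lambda>h z. of_real (exp (- Q z / 2)) * (exp (\<delta> h z) - (1 + \<delta> h z + \<delta> h z ^ 2 / 2)))"
  proof -
    obtain C N where C: "C \<ge> 0" and 1: "\<forall>\<^sub>F h in at_right 0. 0 < h \<and> h < 1 \<and>
        (\<forall>z. norm (\<delta> h z * (\<delta> h z * \<delta> h z)) \<le> C * h ^ 3 * poly_weight z ^ N)"
      by (rule poly_bigoE[OF d3])
    have "\<forall>\<^sub>F h in at_right 0. \<forall>z. norm (of_real (exp (- Q z / 2)) * (exp (\<delta> h z) - (1 + \<delta> h z + \<delta> h z ^ 2 / 2)))
        \<le> exp (max 0 B) * C * h ^ 3 * poly_weight z ^ N"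
      using 1 B
    proof eventually_elim
      case (elim h)
      show ?case
      proof
        fix z
        have "norm (of_real (exp (- Q z / 2)) * (exp (\<delta> h z) - (1 + \<delta> h z + \<delta> h z ^ 2 / 2)))
            \<le> exp (- Q z / 2) * (exp (max 0 (Re (\<delta> h z))) * norm (\<delta> h z) ^ 3)"
          unfolding norm_mult by (intro mult_mono exp_taylor2) auto
        also have "\<dots> = exp (max 0 (Re (\<delta> h z)) - Q z / 2) * norm (\<delta> h z * (\<delta> h z * \<delta> h z))"
          by (simp add: exp_add[symmetric] norm_mult power3_eq_cube mult.assoc[symmetric])
        also have "\<dots> \<le> exp (max 0 B) * (C * h ^ 3 * poly_weight z ^ N)"
        proof (intro mult_mono)
          have "Re (\<delta> h z) - Q z / 2 \<le> B" "Q z \<ge> 0" using elim(2) Q by blast+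
          then show "exp (max 0 (Re (\<delta> h z)) - Q z / 2) \<le> exp (max 0 B)" by (auto simp: max_def)
          show "norm (\<delta> h z * (\<delta> h z * \<delta> h z)) \<le> C * h ^ 3 * poly_weight z ^ N" using elim(1) by blast
        qed simp_all
        finally show "norm (of_real (exp (- Q z / 2)) * (exp (\<delta> h z) - (1 + \<delta> h z + \<delta> h z ^ 2 / 2)))
          \<le> exp (max 0 B) * C * h ^ 3 * poly_weight z ^ N" by (simp add: mult_ac)
      qed
    qed
    then show ?thesis unfolding poly_bigo_def by blast
  qed
  \<comment> \<open>The second summand is half the difference of the squares of \<open>\<delta>\<close> and of its leading term.\<close>
  have 2: "poly_bigo 3 (\<lambda>h z. \<rho> h z + 1/2 * ((\<rho> h z + of_real h ^ 2 * e2 z) * (\<delta> h z + of_real h * e1 z)))"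
    by (intro poly_bigo_add \<rho> poly_bigo_cmult poly_bigo_mult[where j = 2 and k = 1] poly_bigo_mono[OF \<rho>] he2 d he1) auto
  have 3: "poly_bigo 3 (\<lambda>h z. of_real (exp (- Q z / 2)) * (\<rho> h z + 1/2 * ((\<rho> h z + of_real h ^ 2 * e2 z) * (\<delta> h z + of_real h * e1 z))))"
    by (rule poly_bigo_mult[OF E 2]) simp
  show ?thesis
  proof (rule poly_bigo_cong[OF poly_bigo_add[OF 1 3]])
    fix h :: real and z :: "real \<times> real"
    have "(exp (\<delta> h z) - (1 + \<delta> h z + \<delta> h z ^ 2 / 2)) +
       (\<rho> h z + 1/2 * ((\<rho> h z + of_real h ^ 2 * e2 z) * (\<delta> h z + of_real h * e1 z))) =
       exp (\<delta> h z) - (1 + of_real h * e1 z + of_real h ^ 2 * (e2 z + e1 z ^ 2 / 2))"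
      unfolding \<rho>_def by (simp add: power2_eq_square field_simps)
    then show "of_real (exp (- Q z / 2)) * (exp (\<delta> h z) - (1 + \<delta> h z + \<delta> h z ^ 2 / 2)) +
      of_real (exp (- Q z / 2)) * (\<rho> h z + 1/2 * ((\<rho> h z + of_real h ^ 2 * e2 z) * (\<delta> h z + of_real h * e1 z))) =
      of_real (exp (- Q z / 2)) * (exp (\<delta> h z) - (1 + of_real h * e1 z + of_real h ^ 2 * (e2 z + e1 z ^ 2 / 2)))"
      by (simp only: distrib_left[symmetric])
  qed
qed

section \<open>Polylogarithms of order at most two\<close>

text \<open>
  A single term of the exponential series gives \<open>n\<^sup>j \<le> j! \<tau>\<^sup>-\<^sup>j exp (n \<tau>)\<close>. With \<open>x = exp (- 2 \<tau>)\<close> this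
  leaves a geometric series of ratio \<open>exp (- \<tau>)\<close>.
\<close>

lemma summable_power_times_geometric:
  fixes x :: real assumes "0 < x" "x < 1"
  shows "summable (\<lambda>k. real (Suc k) ^ j * x ^ Suc k)"
proof -
  define \<tau> where "\<tau> = - ln x / 2"
  have \<tau>: "\<tau> > 0" "x = exp (- \<tau>) * exp (- \<tau>)"
    using assms by (auto simp: \<tau>_def exp_add[symmetric])
  have bd: "norm (real (Suc k) ^ j * x ^ Suc k) \<le> fact j / \<tau> ^ j * exp (- \<tau>) ^ Suc k" for k
  proof -
    let ?n = "real (Suc k)"
    have pos: "0 \<le> ?n * \<tau>" using \<tau> by simp
    have "(?n * \<tau>) ^ j / fact j \<le> (\<Sum>i\<le>j. (?n * \<tau>) ^ i / fact i)"
      using pos by (intro member_le_sum) auto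
    also have "\<dots> \<le> exp (?n * \<tau>)"
    proof -
      have "(\<lambda>i. (?n * \<tau>) ^ i / fact i) sums exp (?n * \<tau>)"
        using exp_converges[of "?n * \<tau>"] by (simp add: field_simps)
      then show ?thesis
        using sum_le_suminf[of "\<lambda>i. (?n * \<tau>) ^ i / fact i" "{..j}"] pos by (auto simp: sums_iff)
    qed
    finally have "?n ^ j \<le> fact j / \<tau> ^ j * exp (?n * \<tau>)"
      using \<tau>(1) by (simp add: power_mult_distrib field_simps del: of_nat_Suc)
    moreover have "x ^ Suc k = exp (- (?n * \<tau>)) * exp (- \<tau>) ^ Suc k"
      unfolding \<tau>(2) power_mult_distrib exp_of_nat_mult[symmetric] by simp
    ultimately have "?n ^ j * x ^ Suc k \<le> (fact j / \<tau> ^ j * exp (?n * \<tau>)) * (exp (- (?n * \<tau>)) * exp (- \<tau>) ^ Suc k)"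
      using \<tau>(1) assms by (intro mult_mono) auto
    also have "\<dots> = fact j / \<tau> ^ j * exp (- \<tau>) ^ Suc k"
      by (simp add: exp_minus)
    finally show ?thesis using assms by simp
  qed
  have "summable (\<lambda>k. fact j / \<tau> ^ j * exp (- \<tau>) ^ Suc k)"
    using \<tau> by (intro summable_mult summable_Suc_iff[THEN iffD2] summable_geometric) auto
  then show ?thesis
    by (rule summable_comparison_test[rotated]) (use bd in blast)
qed

definition polylog :: "int \<Rightarrow> real \<Rightarrow> real" where
  "polylog s x = (\<Sum>k. x ^ Suc k / real (Suc k) powi s)"

lemma polylog_sums:
  assumes "0 < x" "x < 1"
  shows "(\<lambda>k. x ^ Suc k / real (Suc k) powi s) sums polylog s x"
proof -
  have "summable (\<lambda>k. x ^ Suc k / real (Suc k) powi s)"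
  proof (rule summable_comparison_test[OF _ summable_power_times_geometric[OF assms, of "nat (- s)"]], intro exI allI impI)
    fix k :: nat
    have "1 \<le> real (Suc k) powi s * real (Suc k) ^ nat (- s)"
      by (cases "s \<ge> 0") (auto simp: power_int_def power_mult_distrib[symmetric] simp del: of_nat_Suc)
    then have "1 / real (Suc k) powi s \<le> real (Suc k) ^ nat (- s)"
      by (simp add: field_simps del: of_nat_Suc)
    then have "x ^ Suc k * (1 / real (Suc k) powi s) \<le> x ^ Suc k * real (Suc k) ^ nat (- s)"
      using assms by (intro mult_left_mono) auto
    then show "norm (x ^ Suc k / real (Suc k) powi s) \<le> real (Suc k) ^ nat (- s) * x ^ Suc k"
      using assms by (simp add: mult.commute del: of_nat_Suc)
  qed
  then show ?thesis unfolding polylog_def by (rule summable_sums)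
qed

lemma polylog_1:
  assumes "0 < x" "x < 1" shows "polylog 1 x = - ln (1 - x)"
proof -
  have "(\<lambda>n. - ((- (- x)) ^ n) / real n) sums ln (1 + (- x))"
    by (rule ln_series') (use assms in auto)
  then have "(\<lambda>n. - (- ((- (- x)) ^ n) / real n)) sums - ln (1 - x)"
    using sums_minus by fastforce
  then have "(\<lambda>n. x ^ n / real n) sums - ln (1 - x)" by simp
  then have "(\<lambda>n. x ^ Suc n / real (Suc n)) sums - ln (1 - x)"
    using sums_Suc_iff[of "\<lambda>n. x ^ n / real n"] by simp
  then show ?thesis using polylog_sums[OF assms, of 1] sums_unique2 by simp blast
qed

lemma polylog_0:
  assumes "0 < x" "x < 1" shows "polylog 0 x = x / (1 - x)"
proof -
  have "(\<lambda>k. x * x ^ k) sums (x * (1 / (1 - x)))"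
    by (intro sums_mult geometric_sums) (use assms in auto)
  then show ?thesis using polylog_sums[OF assms, of 0] sums_unique2 by simp blast
qed

text \<open>
  For negative orders, multiplying by \<open>1 - x\<close> takes differences of the coefficients, which lowers the
  power of \<open>k\<close> by one.
\<close>

lemma polylog_minus_1:
  assumes "0 < x" "x < 1" shows "polylog (-1) x = x / (1 - x)\<^sup>2"
proof -
  have s: "(\<lambda>k. real (Suc k) * x ^ Suc k) sums polylog (-1) x"
    using polylog_sums[OF assms, of "-1"] by (simp add: mult.commute field_simps)
  have "(\<lambda>k. real k * x ^ k) sums polylog (-1) x"
    using s sums_Suc_iff[of "\<lambda>k. real k * x ^ k"] by simp
  then have "(\<lambda>k. x * (real k * x ^ k)) sums (x * polylog (-1) x)" by (rule sums_mult)
  from sums_diff[OF s this] have "(\<lambda>k. x ^ Suc k) sums (polylog (-1) x - x * polylog (-1) x)"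
    by (simp add: algebra_simps)
  then have "polylog (-1) x - x * polylog (-1) x = x / (1 - x)"
    using polylog_sums[OF assms, of 0] polylog_0[OF assms] sums_unique2 by simp blast
  then have "polylog (-1) x * (1 - x) = x / (1 - x)" by (simp add: algebra_simps)
  then have "polylog (-1) x = x / (1 - x) / (1 - x)" using assms by (subst nonzero_eq_divide_eq) auto
  then show ?thesis by (simp add: power2_eq_square)
qed

lemma polylog_minus_2:
  assumes "0 < x" "x < 1" shows "polylog (-2) x = x * (1 + x) / (1 - x) ^ 3"
proof -
  have s: "(\<lambda>k. real (Suc k) ^ 2 * x ^ Suc k) sums polylog (-2) x"
    using polylog_sums[OF assms, of "-2"] by (simp add: power_int_minus divide_inverse mult.commute)
  have "(\<lambda>k. real k ^ 2 * x ^ k) sums polylog (-2) x"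
    using s sums_Suc_iff[of "\<lambda>k. real k ^ 2 * x ^ k"] by simp
  then have "(\<lambda>k. x * (real k ^ 2 * x ^ k)) sums (x * polylog (-2) x)" by (rule sums_mult)
  from sums_diff[OF s this] have "(\<lambda>k. 2 * (real (Suc k) * x ^ Suc k) - x ^ Suc k) sums (polylog (-2) x - x * polylog (-2) x)"
    by (simp add: algebra_simps power2_eq_square)
  moreover have "(\<lambda>k. 2 * (real (Suc k) * x ^ Suc k) - x ^ Suc k) sums (2 * polylog (-1) x - polylog 0 x)"
    using polylog_sums[OF assms, of "-1"] polylog_sums[OF assms, of 0]
    by (intro sums_diff sums_mult) (simp_all add: mult.commute field_simps)
  ultimately have "polylog (-2) x - x * polylog (-2) x = 2 * (x / (1 - x)\<^sup>2) - x / (1 - x)"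
    unfolding polylog_0[OF assms] polylog_minus_1[OF assms] by (rule sums_unique2)
  then have "polylog (-2) x * (1 - x) = 2 * (x / (1 - x)\<^sup>2) - x / (1 - x)" by (simp add: algebra_simps)
  also have "\<dots> = (2 * x - x * (1 - x)) / (1 - x)\<^sup>2"
    using assms by (simp add: diff_divide_distrib power2_eq_square)
  also have "2 * x - x * (1 - x) = x * (1 + x)" by (simp add: algebra_simps)
  finally have "polylog (-2) x = x * (1 + x) / (1 - x)\<^sup>2 / (1 - x)"
    using assms by (subst nonzero_eq_divide_eq) auto
  then show ?thesis using assms by (simp add: power2_eq_square power3_eq_cube)
qed

text \<open>
  The beginning of the expansion of \<open>1 / (1 - exp (- s))\<close> in Bernoulli numbers, with an error that is
  valid for all positive \<open>s\<close>. The next term is of order \<open>s\<^sup>3\<close>; the weaker bound \<open>s\<^sup>2\<close> also covers large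
  \<open>s\<close>, where the left-hand side grows like \<open>s / 12\<close>.
\<close>

lemma bernoulli_bound:
  fixes s :: real assumes "s > 0"
  shows "\<bar>1 / (1 - exp (- s)) - (1 / s + 1 / 2 + s / 12)\<bar> \<le> s\<^sup>2"
proof (cases "s \<ge> 1")
  case True
  have "1 + s \<le> exp s" by simp
  then have "exp (- s) \<le> 1 / (1 + s)" using assms by (simp add: exp_minus field_simps)
  then have 1: "1 - exp (- s) \<ge> s / (1 + s)" using assms by (simp add: field_simps)
  have 2: "1 - exp (- s) \<le> s" using exp_ge_add_one_self[of "- s"] by simp
  have p: "1 - exp (- s) > 0" using assms by simp
  have "1 / (1 - exp (- s)) \<le> 1 / (s / (1 + s))" using 1 assms by (intro divide_left_mono) auto
  then have u: "1 / (1 - exp (- s)) \<le> 1 / s + 1" using assms by (simp add: field_simps)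
  have l: "1 / (1 - exp (- s)) \<ge> 1 / s" using 2 p assms by (intro divide_left_mono) auto
  have "s \<le> s\<^sup>2" using True by (simp add: power2_eq_square)
  then show ?thesis using u l True by (simp add: abs_if)
next
  case False
  then have s: "0 < s" "s < 1" using assms by auto
  define D where "D = 1 - exp (- s)"
  define e where "e = exp (- s) - (1 - s + s\<^sup>2 / 2 - s ^ 3 / 6)"
  have e: "0 \<le> e" "e \<le> s ^ 4 / 8"
  proof -
    obtain t where t: "\<bar>t\<bar> \<le> \<bar>- s\<bar>" "exp (- s) = (\<Sum>m<4. (- s) ^ m / fact m) + exp t / fact 4 * (- s) ^ 4"
      using Maclaurin_exp_le[of "- s" 4] by blast
    have "(\<Sum>m<4. (- s) ^ m / fact m) = 1 - s + s\<^sup>2 / 2 - s ^ 3 / 6"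
      by (simp add: eval_nat_numeral)
    then have "e = exp t / fact 4 * s ^ 4" using t unfolding e_def by simp
    then show "0 \<le> e" by simp
    have "exp t \<le> exp 1" using t(1) s by (subst exp_le_cancel_iff) linarith
    then have "exp t \<le> 3" using exp_le by (rule order_trans)
    then have "exp t * s ^ 4 \<le> 3 * s ^ 4" using s by (intro mult_right_mono) auto
    then show "e \<le> s ^ 4 / 8" using \<open>e = exp t / fact 4 * s ^ 4\<close> by (simp add: fact_numeral)
  qed
  have De: "D = s - s\<^sup>2 / 2 + s ^ 3 / 6 - e" unfolding D_def e_def by simp
  have p: "s ^ 3 \<ge> s ^ 4" "s ^ 3 \<ge> s ^ 5" "s \<ge> s\<^sup>2" "s ^ 3 > 0" "s ^ 4 > 0" "s ^ 5 > 0"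
    using s power_decreasing[of 3 4 s] power_decreasing[of 3 5 s] power_decreasing[of 1 2 s] by auto
  have D: "D \<ge> s / 2" unfolding De using p e by linarith
  have "s\<^sup>2 * (s / 2) \<le> s\<^sup>2 * D" using D by (intro mult_left_mono) auto
  then have sD: "s ^ 3 / 2 \<le> s\<^sup>2 * D" by (simp add: power2_eq_square power3_eq_cube)
  define b where "b = 1 / s + 1 / 2 + s / 12"
  have b: "b > 0" "s ^ 4 * b = s ^ 3 + s ^ 4 / 2 + s ^ 5 / 12"
    using s by (auto simp: b_def field_simps eval_nat_numeral intro!: add_pos_pos)
  have "1 - D * b = e * b - (s ^ 3 / 24 + s ^ 4 / 72)"
    unfolding De b_def using s by (simp add: field_simps eval_nat_numeral)
  moreover have "0 \<le> e * b" using e b by simp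
  moreover have "e * b \<le> s ^ 4 / 8 * b" using e b by (intro mult_right_mono) auto
  ultimately have "\<bar>1 - D * (1 / s + 1 / 2 + s / 12)\<bar> \<le> s\<^sup>2 * D"
    unfolding b_def[symmetric] using sD b p by (intro abs_leI) linarith+
  then have "\<bar>1 - D * (1 / s + 1 / 2 + s / 12)\<bar> / D \<le> s\<^sup>2"
    using D s by (simp add: field_simps)
  moreover have "\<bar>1 - D * (1 / s + 1 / 2 + s / 12)\<bar> / D = \<bar>1 / D - (1 / s + 1 / 2 + s / 12)\<bar>"
  proof -
    have "1 / D - (1 / s + 1 / 2 + s / 12) = (1 - D * (1 / s + 1 / 2 + s / 12)) / D"
      using D s by (simp add: diff_divide_distrib)
    then show ?thesis using D s by (simp add: abs_divide)
  qed
  ultimately show ?thesis unfolding D_def by simp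
qed

section \<open>The quantum dilogarithm\<close>

text \<open>
  The logarithm of \<open>1 / (x;q)\<^sub>\<infinity>\<close> at \<open>x = exp u\<close> and \<open>q = exp (- e)\<close>, where \<open>Re u < 0\<close>. The series defines a
  logarithm without any choice of branch.
\<close>

definition qdilog :: "real \<Rightarrow> complex \<Rightarrow> complex" where
  "qdilog e u = (\<Sum>k. exp (of_nat (Suc k) * u) / of_real (real (Suc k) * (1 - exp (- (real (Suc k) * e)))))"

lemma qdilog_summable:
  assumes "Re u < 0" "e > 0"
  shows "summable (\<lambda>k. exp (of_nat (Suc k) * u) / of_real (real (Suc k) * (1 - exp (- (real (Suc k) * e)))))"
proof (rule summable_comparison_test)
  define x where "x = exp (Re u)"
  have x: "0 < x" "x < 1" using assms by (auto simp: x_def)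
  show "summable (\<lambda>k. x ^ Suc k / (1 - exp (- e)))"
    using x by (intro summable_divide summable_Suc_iff[THEN iffD2] summable_geometric) auto
  show "\<exists>N. \<forall>k\<ge>N. norm (exp (of_nat (Suc k) * u) / of_real (real (Suc k) * (1 - exp (- (real (Suc k) * e)))))
      \<le> x ^ Suc k / (1 - exp (- e))"
  proof (intro exI allI impI)
    fix k :: nat
    have p: "0 < 1 - exp (- e)" using assms by simp
    have "1 * e \<le> real (Suc k) * e" using assms by (intro mult_right_mono) auto
    then have "1 - exp (- e) \<le> 1 - exp (- (real (Suc k) * e))" by simp
    then have "1 * (1 - exp (- e)) \<le> real (Suc k) * (1 - exp (- (real (Suc k) * e)))"
      using p by (intro mult_mono) auto
    then have le: "1 - exp (- e) \<le> real (Suc k) * (1 - exp (- (real (Suc k) * e)))" by simp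
    have "norm (exp (of_nat (Suc k) * u)) = x ^ Suc k"
      unfolding exp_of_nat_mult norm_power by (simp add: x_def)
    moreover have "norm (complex_of_real (real (Suc k) * (1 - exp (- (real (Suc k) * e))))) = real (Suc k) * (1 - exp (- (real (Suc k) * e)))"
      using le p by (simp only: norm_of_real abs_of_pos)
    ultimately show "norm (exp (of_nat (Suc k) * u) / of_real (real (Suc k) * (1 - exp (- (real (Suc k) * e)))))
      \<le> x ^ Suc k / (1 - exp (- e))"
      unfolding norm_divide using le p x by (intro frac_le) auto
  qed
qed

text \<open>
  All coefficients of the power series are positive.
\<close>

lemma Re_qdilog_le:
  assumes "Re u < 0" "e > 0"
  shows "Re (qdilog e u) \<le> Re (qdilog e (of_real (Re u)))"
proof -
  let ?d = "\<lambda>k. real (Suc k) * (1 - exp (- (real (Suc k) * e)))"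
  have d: "?d k > 0" for k using assms by (intro mult_pos_pos) auto
  have s: "summable (\<lambda>k. Re (exp (of_nat (Suc k) * v) / of_real (?d k)))" if "Re v < 0" for v
    using qdilog_summable[OF that assms(2)] by (rule summable_Re)
  have "Re (qdilog e u) = (\<Sum>k. Re (exp (of_nat (Suc k) * u) / of_real (?d k)))"
    unfolding qdilog_def by (rule Re_suminf[OF qdilog_summable[OF assms]])
  also have "\<dots> \<le> (\<Sum>k. Re (exp (of_nat (Suc k) * of_real (Re u)) / of_real (?d k)))"
  proof (rule suminf_le[OF _ s[OF assms(1)] s])
    fix k
    have "Re (exp (of_nat (Suc k) * u) / of_real (?d k)) = Re (exp (of_nat (Suc k) * u)) / ?d k"
      by (rule Re_divide_of_real)
    also have "\<dots> \<le> norm (exp (of_nat (Suc k) * u)) / ?d k"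
      using d[of k] by (intro divide_right_mono complex_Re_le_cmod) simp
    also have "norm (exp (of_nat (Suc k) * u)) = Re (exp (of_nat (Suc k) * of_real (Re u)))"
      by (simp add: Re_exp)
    also have "\<dots> / ?d k = Re (exp (of_nat (Suc k) * of_real (Re u)) / of_real (?d k))"
      by (rule Re_divide_of_real[symmetric])
    finally show "Re (exp (of_nat (Suc k) * u) / of_real (?d k)) \<le> Re (exp (of_nat (Suc k) * of_real (Re u)) / of_real (?d k))" .
  qed (use assms in simp)
  also have "\<dots> = Re (qdilog e (of_real (Re u)))"
    unfolding qdilog_def by (rule Re_suminf[OF qdilog_summable, symmetric]) (use assms in auto)
  finally show ?thesis .
qed

definition qfact :: "real \<Rightarrow> nat \<Rightarrow> real" where
  "qfact q n = (\<Prod>j<n. 1 - q ^ Suc j)"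

lemma qfact_pos: "0 < q \<Longrightarrow> q < 1 \<Longrightarrow> qfact q n > 0"
  unfolding qfact_def by (intro prod_pos) (auto intro!: power_less_one_iff[THEN iffD2] simp del: power_Suc)

lemma qexp_summable:
  fixes w :: complex
  assumes q: "0 < q" "q < 1" and w: "norm w < 1"
  shows "summable (\<lambda>n. w ^ n / of_real (qfact q n))"
proof -
  define c where "c = (1 + norm w) / 2"
  have c: "norm w < c" "c < 1" "0 < c" using w by (auto simp: c_def intro: add_pos_nonneg)
  have "(\<lambda>n. norm w / (1 - q ^ Suc n)) \<longlonglongrightarrow> norm w / (1 - 0)"
    by (intro tendsto_divide tendsto_const tendsto_diff LIMSEQ_Suc[OF LIMSEQ_realpow_zero]) (use q in auto)
  then have "\<forall>\<^sub>F n in sequentially. norm w / (1 - q ^ Suc n) < c"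
    using c by (intro order_tendstoD(2)) auto
  then obtain N where N: "\<And>n. n \<ge> N \<Longrightarrow> norm w / (1 - q ^ Suc n) < c"
    unfolding eventually_sequentially by blast
  show ?thesis
  proof (rule summable_ratio_test[OF c(2), of N])
    fix n assume n: "n \<ge> N"
    have p: "1 - q ^ Suc n > 0" using q by (simp add: power_less_one_iff del: power_Suc)
    have f: "qfact q (Suc n) = qfact q n * (1 - q ^ Suc n)" by (simp add: qfact_def)
    have "norm (w ^ Suc n / of_real (qfact q (Suc n))) = (norm w / (1 - q ^ Suc n)) * norm (w ^ n / of_real (qfact q n))"
      unfolding f norm_divide norm_power norm_of_real abs_mult using p by (simp del: power_Suc add: power_Suc[of "norm w"])
    also have "\<dots> \<le> c * norm (w ^ n / of_real (qfact q n))"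
      using N[OF n] by (intro mult_right_mono) auto
    finally show "norm (w ^ Suc n / of_real (qfact q (Suc n))) \<le> c * norm (w ^ n / of_real (qfact q n))" .
  qed
qed

lemma isCont_powser_0:
  fixes a :: "nat \<Rightarrow> complex"
  assumes "\<And>w. norm w < 1 \<Longrightarrow> summable (\<lambda>n. a n * w ^ n)"
  shows "isCont (\<lambda>w. \<Sum>n. a n * w ^ n) 0"
  by (rule isCont_powser[where K = "1/2"]) (use assms in auto)

text \<open>
  Euler's identity \<open>\<Sum> x\<^sup>n / (q;q)\<^sub>n = 1 / (x;q)\<^sub>\<infinity>\<close>. Both sides satisfy \<open>f(x) (1 - x) = f(q x)\<close>, so their quotient
  is invariant under \<open>x \<mapsto> q x\<close>. Iteration and continuity at 0 show that the quotient is its value at 0, which is 1.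
\<close>

lemma exp_qdilog_sums:
  assumes u: "Re u < 0" and e: "e > 0"
  shows "(\<lambda>n. exp (of_nat n * u) / of_real (qfact (exp (- e)) n)) sums exp (qdilog e u)"
proof -
  define q where "q = exp (- e)"
  have q: "0 < q" "q < 1" using e by (auto simp: q_def)
  define f where "f w = (\<Sum>n. w ^ n / of_real (qfact q n))" for w :: complex
  define a where "a n = (if n = 0 then 0 else 1 / complex_of_real (real n * (1 - q ^ n)))" for n
  define L where "L w = (\<Sum>n. a n * w ^ n)" for w
  have asum: "summable (\<lambda>n. a n * w ^ n)" if w: "norm w < 1" for w
  proof (cases "w = 0")
    case True
    then show ?thesis by (auto intro!: summable_finite[of "{0}"] simp: a_def)
  next
    case False
    have "summable (\<lambda>k. exp (of_nat (Suc k) * Ln w) / of_real (real (Suc k) * (1 - exp (- (real (Suc k) * e)))))"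
      by (rule qdilog_summable) (use False w e in auto)
    then have "summable (\<lambda>k. a (Suc k) * w ^ Suc k)"
      unfolding exp_of_nat_mult using False
      by (simp add: a_def q_def exp_of_nat_mult[symmetric] del: of_nat_Suc power_Suc)
    then show ?thesis by (subst (asm) summable_Suc_iff)
  qed
  have L: "L (exp v) = qdilog e v" if v: "Re v < 0" for v
  proof -
    have "(\<lambda>k. a (Suc k) * exp v ^ Suc k) = (\<lambda>k. exp (of_nat (Suc k) * v) / of_real (real (Suc k) * (1 - exp (- (real (Suc k) * e)))))"
      unfolding exp_of_nat_mult
      by (simp add: a_def q_def exp_of_nat_mult[symmetric] fun_eq_iff del: of_nat_Suc power_Suc)
    moreover have "L (exp v) = (\<Sum>k. a (Suc k) * exp v ^ Suc k)"
      unfolding L_def using suminf_split_head[OF asum[of "exp v"]] v by (simp add: a_def)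
    ultimately show ?thesis by (simp only: qdilog_def)
  qed
  have fsum: "summable (\<lambda>n. w ^ n / of_real (qfact q n))" if "norm w < 1" for w :: complex
    by (rule qexp_summable[OF q that])
  have nq: "norm (of_real q * w) < 1" if "norm w < 1" for w :: complex
  proof -
    have "norm (of_real q * w) \<le> 1 * norm w"
      unfolding norm_mult using q by (intro mult_right_mono) auto
    then show ?thesis using that by simp
  qed
  have fq: "f w * (1 - w) = f (of_real q * w)" if w: "norm w < 1" for w
  proof -
    have s1: "summable (\<lambda>n. w ^ Suc n / of_real (qfact q (Suc n)))" using fsum[OF w] by (subst summable_Suc_iff)
    have s2: "summable (\<lambda>n. w * (w ^ n / of_real (qfact q n)))" using fsum[OF w] by (rule summable_mult)
    have "f w - w * f w = 1 + ((\<Sum>n. w ^ Suc n / of_real (qfact q (Suc n))) - (\<Sum>n. w * (w ^ n / of_real (qfact q n))))"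
      unfolding suminf_mult[OF fsum[OF w]] f_def[symmetric]
      using suminf_split_head[OF fsum[OF w]] by (simp add: f_def qfact_def)
    also have "(\<Sum>n. w ^ Suc n / of_real (qfact q (Suc n))) - (\<Sum>n. w * (w ^ n / of_real (qfact q n)))
       = (\<Sum>n. w ^ Suc n / of_real (qfact q (Suc n)) - w * (w ^ n / of_real (qfact q n)))"
      by (rule suminf_diff[OF s1 s2])
    also have "\<dots> = (\<Sum>n. (of_real q * w) ^ Suc n / of_real (qfact q (Suc n)))"
    proof (rule suminf_cong)
      fix n
      define F Q W where "F = complex_of_real (qfact q n)" and "Q = complex_of_real (q ^ Suc n)" and "W = w ^ Suc n"
      have F: "F \<noteq> 0" using qfact_pos[OF q, of n] by (simp add: F_def)
      have "1 - q ^ Suc n \<noteq> 0" using q power_less_one_iff[of q "Suc n"] by (simp del: power_Suc)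
      then have "complex_of_real (1 - q ^ Suc n) \<noteq> 0" unfolding of_real_eq_0_iff .
      then have Q: "1 - Q \<noteq> 0" unfolding Q_def of_real_diff of_real_1 .
      have 1: "complex_of_real (qfact q (Suc n)) = F * (1 - Q)" by (simp add: qfact_def F_def Q_def)
      have 2: "(of_real q * w) ^ Suc n = Q * W" unfolding power_mult_distrib Q_def W_def by simp
      have 3: "w * (w ^ n / of_real (qfact q n)) = W / F" by (simp add: W_def F_def)
      have 4: "W / (F * (1 - Q)) - W / F = Q * W / (F * (1 - Q))"
        using F Q by (simp add: divide_simps) (simp add: algebra_simps)
      show "w ^ Suc n / of_real (qfact q (Suc n)) - w * (w ^ n / of_real (qfact q n)) = (of_real q * w) ^ Suc n / of_real (qfact q (Suc n))"
        unfolding 1 2 3 W_def[symmetric] by (rule 4)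
    qed
    also have "1 + \<dots> = f (of_real q * w)"
      unfolding f_def using suminf_split_head[OF fsum[OF nq[OF w]]] by (simp add: qfact_def)
    finally show ?thesis by (simp add: algebra_simps)
  qed
  have Lq: "exp (L w) * (1 - w) = exp (L (of_real q * w))" if w: "norm w < 1" for w
  proof -
    have "L w - L (of_real q * w) = (\<Sum>n. a n * w ^ n - a n * (of_real q * w) ^ n)"
      unfolding L_def by (rule suminf_diff[OF asum[OF w] asum[OF nq[OF w]]])
    also have "\<dots> = (\<Sum>n. - (- ((- (- w)) ^ n) / of_nat n))"
    proof (rule suminf_cong)
      fix n show "a n * w ^ n - a n * (of_real q * w) ^ n = - (- ((- (- w)) ^ n) / of_nat n)"
      proof (cases "n = 0")
        case False
        have "1 - q ^ n \<noteq> 0" using q power_less_one_iff[of q n] False by simp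
        then have "complex_of_real (1 - q ^ n) \<noteq> 0" unfolding of_real_eq_0_iff .
        then have "1 - complex_of_real q ^ n \<noteq> 0" by simp
        moreover have "a n * w ^ n - a n * (of_real q * w) ^ n = a n * (1 - of_real q ^ n) * w ^ n"
          by (simp add: power_mult_distrib algebra_simps)
        ultimately show ?thesis using False by (simp add: a_def)
      qed (simp add: a_def)
    qed
    also have "\<dots> = - Ln (1 + (- w))"
      using sums_unique[OF sums_minus[OF Ln_series'[of "- w"]]] w by simp
    finally have "L w = L (of_real q * w) + - Ln (1 - w)" by (simp add: diff_eq_eq add.commute)
    then have "exp (L w) = exp (L (of_real q * w)) * exp (- Ln (1 - w))" by (simp only: exp_add)
    moreover have "1 - w \<noteq> 0" using w by auto
    ultimately show ?thesis by (simp add: exp_minus)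
  qed
  define r where "r w = f w / exp (L w)" for w
  have rq: "r w = r (of_real q * w)" if w: "norm w < 1" for w
  proof -
    have "1 - w \<noteq> 0" using w by auto
    then have "r w = (f w * (1 - w)) / (exp (L w) * (1 - w))" by (simp add: r_def)
    then show ?thesis unfolding fq[OF w] Lq[OF w] r_def .
  qed
  have rqn: "r w = r (of_real (q ^ n) * w)" if w: "norm w < 1" for w n
  proof (induction n)
    case (Suc n)
    have "norm (of_real (q ^ n) * w) \<le> 1 * norm w"
      unfolding norm_mult using q by (intro mult_right_mono) (auto simp: power_le_one norm_power)
    then have "r (of_real (q ^ n) * w) = r (of_real q * (of_real (q ^ n) * w))" using w by (intro rq) simp
    then show ?case using Suc by (simp add: mult_ac)
  qed simp
  have cf: "isCont f 0"
  proof -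
    have "f = (\<lambda>w. \<Sum>n. (1 / of_real (qfact q n)) * w ^ n)" by (simp add: f_def fun_eq_iff)
    then show ?thesis using isCont_powser_0[of "\<lambda>n. 1 / of_real (qfact q n)"] fsum by simp
  qed
  have cL: "isCont L 0" unfolding L_def[abs_def] using isCont_powser_0[of a] asum by simp
  have cr: "isCont r 0" unfolding r_def[abs_def] by (intro continuous_intros cf cL) simp
  have r0: "r 0 = 1"
  proof -
    have "f 0 = 1" unfolding f_def using powser_zero[of "\<lambda>n. 1 / complex_of_real (qfact q n)"] by (simp add: qfact_def)
    moreover have "L 0 = 0" unfolding L_def powser_zero by (simp add: a_def)
    ultimately show ?thesis by (simp add: r_def)
  qed
  define w where "w = exp u"
  have w: "norm w < 1" using u by (simp add: w_def)
  have "(\<lambda>n. complex_of_real (q ^ n) * w) \<longlonglongrightarrow> of_real 0 * w"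
    by (intro tendsto_mult tendsto_const tendsto_of_real LIMSEQ_realpow_zero) (use q in auto)
  then have "(\<lambda>n. r (complex_of_real (q ^ n) * w)) \<longlonglongrightarrow> r 0"
    using isCont_tendsto_compose[OF cr] by simp
  moreover have "(\<lambda>n. r (complex_of_real (q ^ n) * w)) = (\<lambda>n. r w)" using rqn[OF w] by metis
  ultimately have "r w = 1" using r0 LIMSEQ_unique[OF tendsto_const] by metis
  then have "f w = exp (qdilog e u)" unfolding r_def using L[OF u] by (simp add: w_def)
  moreover have "(\<lambda>n. w ^ n / of_real (qfact q n)) sums f w" unfolding f_def using fsum[OF w] by (rule summable_sums)
  ultimately show ?thesis unfolding q_def w_def exp_of_nat_mult by simp
qed

text \<open>
  The \<open>n\<close>-th term of \<open>qdilog\<close> at \<open>e = \<mu> h\<^sup>2\<close> and \<open>u = - t + \<theta>\<close>, divided by \<open>exp (- n t)\<close> and truncated: the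
  three summands come from \<open>1/s\<close>, \<open>1/2\<close> and \<open>s/12\<close> with \<open>s = n \<mu> h\<^sup>2\<close>. As \<open>\<theta>\<close> has order \<open>h\<close>, the exponential
  \<open>exp (n \<theta>)\<close> is needed up to degree 4, 2 and 0, respectively, for an error of order \<open>h\<^sup>3\<close>.
\<close>

definition qdilog_term_poly :: "real \<Rightarrow> real \<Rightarrow> complex \<Rightarrow> real \<Rightarrow> complex" where
  "qdilog_term_poly \<mu> h \<theta> n = (1 / of_real n ^ 2 + \<theta> / of_real n + \<theta> ^ 2 / 2 + of_real n * \<theta> ^ 3 / 6 + of_real n ^ 2 * \<theta> ^ 4 / 24) / of_real (\<mu> * h\<^sup>2)
     + (1 / of_real n + \<theta> + of_real n * \<theta> ^ 2 / 2) / 2 + of_real (\<mu> * h\<^sup>2) / 12"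

lemma qdilog_term_bound:
  fixes n \<mu> h \<tau> B :: real and \<theta> :: complex
  assumes n: "n \<ge> 1" and \<mu>: "\<mu> > 0" and h: "0 < h" "h \<le> 1" and B: "B \<ge> 1" and \<theta>: "norm \<theta> \<le> h * B" "\<bar>Re \<theta>\<bar> \<le> \<tau>"
  shows "norm (exp (of_real n * \<theta>) / of_real (n * (1 - exp (- (n * (\<mu> * h\<^sup>2))))) - qdilog_term_poly \<mu> h \<theta> n)
    \<le> (1 / \<mu> + 1 + \<mu> + \<mu>\<^sup>2) * h ^ 3 * B ^ 5 * (n ^ 3 * exp (n * \<tau>))"
proof -
  define s where "s = n * (\<mu> * h\<^sup>2)"
  have s: "s > 0" using n \<mu> h by (simp add: s_def)
  define \<rho> where "\<rho> = 1 / (1 - exp (- s)) - (1 / s + 1 / 2 + s / 12)"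
  have \<rho>: "\<bar>\<rho>\<bar> \<le> s\<^sup>2" unfolding \<rho>_def by (rule bernoulli_bound[OF s])
  define z where "z = of_real n * \<theta>"
  define E where "E = exp (n * \<tau>)"
  define T where "T = n * h * B"
  have nz: "norm z \<le> T" using n \<theta> by (simp add: z_def T_def norm_mult mult.assoc mult_left_mono)
  have T0: "T \<ge> 0" using nz norm_ge_zero order_trans by blast
  have "\<bar>Re z\<bar> = n * \<bar>Re \<theta>\<bar>" using n by (simp add: z_def abs_mult)
  also have "\<dots> \<le> n * \<tau>" using n \<theta> by (intro mult_left_mono) auto
  finally have rz: "\<bar>Re z\<bar> \<le> n * \<tau>" .
  have E: "exp \<bar>Re z\<bar> \<le> E" "E > 0" using rz by (auto simp: E_def)
  have ez: "norm (exp z) \<le> E" using E by (simp add: order_trans[OF _ E(1)])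
  have tay: "norm (exp z - (\<Sum>k\<le>N. z ^ k / fact k)) \<le> E * T ^ Suc N" for N
  proof -
    have "norm (exp z - (\<Sum>k\<le>N. z ^ k / fact k)) \<le> exp \<bar>Re z\<bar> * norm z ^ Suc N / fact N" by (rule Taylor_exp)
    also have "\<dots> \<le> exp \<bar>Re z\<bar> * norm z ^ Suc N / 1" by (intro divide_left_mono) auto
    also have "\<dots> \<le> E * T ^ Suc N" using E nz by (simp only: div_by_1) (intro mult_mono power_mono, auto)
    finally show ?thesis .
  qed
  \<comment> \<open>The exponential series is cut off so that, after multiplication with the corresponding Bernoulli term, every remainder has order \<open>h\<^sup>3\<close>.\<close>
  define r4 where "r4 = exp z - (1 + z + z ^ 2 / 2 + z ^ 3 / 6 + z ^ 4 / 24)"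
  define r2 where "r2 = exp z - (1 + z + z ^ 2 / 2)"
  define r0 where "r0 = exp z - 1"
  have r4: "norm r4 \<le> E * T ^ 5" using tay[of 4] by (simp add: r4_def eval_nat_numeral)
  have r2: "norm r2 \<le> E * T ^ 3" using tay[of 2] by (simp add: r2_def eval_nat_numeral)
  have r0: "norm r0 \<le> E * T" using tay[of 0] by (simp add: r0_def)
  have n0: "n \<noteq> 0" "\<mu> \<noteq> 0" "h \<noteq> 0" using n \<mu> h by auto
  have id: "exp z / of_real (n * (1 - exp (- s))) - qdilog_term_poly \<mu> h \<theta> n =
      r4 / of_real (n * s) + r2 / of_real (2 * n) + r0 * of_real (s / (12 * n)) + exp z * of_real (\<rho> / n)"
  proof -
    define c where "c = 1 / (1 - exp (- s))"
    have c: "c = 1 / s + 1 / 2 + s / 12 + \<rho>" unfolding \<rho>_def c_def by simp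
    have "c / n = 1 / (n * s) + 1 / (2 * n) + s / (12 * n) + \<rho> / n"
      unfolding c add_divide_distrib by (simp add: mult.commute)
    moreover have "exp z / of_real (n * (1 - exp (- s))) = exp z * of_real (c / n)"
      unfolding c_def by (simp add: mult.commute)
    ultimately have "exp z / of_real (n * (1 - exp (- s))) = exp z / of_real (n * s) + exp z / of_real (2 * n)
        + exp z * of_real (s / (12 * n)) + exp z * of_real (\<rho> / n)"
      by (simp only: of_real_add distrib_left of_real_divide of_real_1 times_divide_eq_right mult_1_right)
    moreover have "qdilog_term_poly \<mu> h \<theta> n = (1 + z + z ^ 2 / 2 + z ^ 3 / 6 + z ^ 4 / 24) / of_real (n * s)
        + (1 + z + z ^ 2 / 2) / of_real (2 * n) + of_real (s / (12 * n))"
    proof -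
      define N where "N = complex_of_real n"
      have N: "N \<noteq> 0" using n0 by (simp add: N_def)
      have 1: "1 / N ^ 2 + \<theta> / N + \<theta> ^ 2 / 2 + N * \<theta> ^ 3 / 6 + N ^ 2 * \<theta> ^ 4 / 24 =
          (1 + N * \<theta> + (N * \<theta>) ^ 2 / 2 + (N * \<theta>) ^ 3 / 6 + (N * \<theta>) ^ 4 / 24) / N ^ 2"
        using N by (simp add: add_divide_distrib power_mult_distrib power2_eq_square power3_eq_cube power4_eq_xxxx mult_ac)
      have 2: "1 / N + \<theta> + N * \<theta> ^ 2 / 2 = (1 + N * \<theta> + (N * \<theta>) ^ 2 / 2) / N"
        using N by (simp add: add_divide_distrib power_mult_distrib power2_eq_square)
      have 3: "complex_of_real (n * s) = N ^ 2 * of_real (\<mu> * h\<^sup>2)" "complex_of_real (2 * n) = N * 2"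
        "complex_of_real (s / (12 * n)) = of_real (\<mu> * h\<^sup>2) / 12"
        using n0 by (simp_all add: s_def N_def power2_eq_square)
      show ?thesis
        unfolding qdilog_term_poly_def z_def N_def[symmetric] 1 2 3 by (simp only: divide_divide_eq_left)
    qed
    ultimately show ?thesis
      unfolding r4_def r2_def r0_def by (simp only: diff_divide_distrib left_diff_distrib) simp
  qed
  define K where "K = h ^ 3 * B ^ 5 * n ^ 3 * E"
  have K0: "K \<ge> 0" using h B n E by (simp add: K_def)
  have pw: "n ^ i * B ^ j \<le> n ^ 3 * B ^ 5" if "i \<le> 3" "j \<le> 5" for i j
    using that n B by (intro mult_mono power_increasing) auto
  have hp: "h ^ 4 \<le> h ^ 3" using h by (intro power_decreasing) auto
  have b1: "norm (r4 / of_real (n * s)) \<le> (1 / \<mu>) * K"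
  proof -
    have "norm (r4 / of_real (n * s)) \<le> E * T ^ 5 / (n * s)"
      using r4 s n by (simp add: norm_divide norm_mult divide_right_mono)
    also have "\<dots> = (1 / \<mu>) * K"
      unfolding T_def s_def K_def using n0 by (simp add: field_simps eval_nat_numeral)
    finally show ?thesis .
  qed
  have b2: "norm (r2 / of_real (2 * n)) \<le> K"
  proof -
    have "norm (r2 / of_real (2 * n)) \<le> E * T ^ 3 / (2 * n)"
      using r2 n by (simp add: norm_divide norm_mult divide_right_mono)
    also have "\<dots> \<le> E * T ^ 3 / n" using E T0 n by (intro divide_left_mono) auto
    also have "\<dots> = E * h ^ 3 * (n ^ 2 * B ^ 3)"
      unfolding T_def using n0 by (simp add: field_simps eval_nat_numeral)
    also have "\<dots> \<le> E * h ^ 3 * (n ^ 3 * B ^ 5)" using E h pw[of 2 3] by (intro mult_left_mono) auto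
    finally show ?thesis by (simp add: K_def mult_ac)
  qed
  have b3: "norm (r0 * of_real (s / (12 * n))) \<le> \<mu> * K"
  proof -
    have "norm (r0 * of_real (s / (12 * n))) \<le> E * T * (s / n)"
      unfolding norm_mult norm_of_real using r0 s n E T0 by (intro mult_mono) (auto simp: field_simps)
    also have "\<dots> = \<mu> * E * h ^ 3 * (n ^ 1 * B ^ 1)"
      unfolding T_def s_def using n0 by (simp add: field_simps eval_nat_numeral)
    also have "\<dots> \<le> \<mu> * E * h ^ 3 * (n ^ 3 * B ^ 5)" using E h \<mu> pw[of 1 1] by (intro mult_left_mono) auto
    finally show ?thesis by (simp add: K_def mult_ac)
  qed
  have b4: "norm (exp z * of_real (\<rho> / n)) \<le> \<mu>\<^sup>2 * K"
  proof -
    have "norm (exp z * of_real (\<rho> / n)) \<le> E * (s\<^sup>2 / n)"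
      unfolding norm_mult norm_of_real using ez \<rho> n E by (intro mult_mono) (auto simp: divide_right_mono)
    also have "\<dots> = \<mu>\<^sup>2 * E * (h ^ 4 * (n ^ 1 * B ^ 0))"
      unfolding s_def using n0 by (simp add: field_simps eval_nat_numeral)
    also have "\<dots> \<le> \<mu>\<^sup>2 * E * (h ^ 3 * (n ^ 3 * B ^ 5))"
    proof (rule mult_left_mono)
      show "h ^ 4 * (n ^ 1 * B ^ 0) \<le> h ^ 3 * (n ^ 3 * B ^ 5)"
        by (rule mult_mono[OF hp pw]) (use h n in auto)
    qed (use E in auto)
    finally show ?thesis by (simp add: K_def mult_ac)
  qed
  have "norm (exp z / of_real (n * (1 - exp (- s))) - qdilog_term_poly \<mu> h \<theta> n) \<le> (1 / \<mu>) * K + K + \<mu> * K + \<mu>\<^sup>2 * K"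
    unfolding id using b1 b2 b3 b4 by (intro norm_triangle_mono)
  also have "\<dots> = (1 / \<mu> + 1 + \<mu> + \<mu>\<^sup>2) * h ^ 3 * B ^ 5 * (n ^ 3 * exp (n * \<tau>))"
    unfolding K_def E_def by algebra
  finally show ?thesis unfolding z_def s_def .
qed

text \<open>
  The truncated terms summed over \<open>n\<close>: every power of \<open>n\<close> becomes a polylogarithm of \<open>x = exp (- t)\<close>.
\<close>

definition qdilog_poly :: "real \<Rightarrow> real \<Rightarrow> real \<Rightarrow> complex \<Rightarrow> complex" where
  "qdilog_poly \<mu> x h \<theta> =
     (of_real (polylog 2 x) + of_real (polylog 1 x) * \<theta> + of_real (polylog 0 x) * \<theta> ^ 2 / 2 + of_real (polylog (-1) x) * \<theta> ^ 3 / 6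
       + of_real (polylog (-2) x) * \<theta> ^ 4 / 24) / of_real (\<mu> * h\<^sup>2)
     + (of_real (polylog 1 x) + of_real (polylog 0 x) * \<theta> + of_real (polylog (-1) x) * \<theta> ^ 2 / 2) / 2
     + of_real (polylog 0 x) * of_real (\<mu> * h\<^sup>2) / 12"

lemma qdilog_poly_sums:
  assumes "0 < x" "x < 1"
  shows "(\<lambda>k. of_real (x ^ Suc k) * qdilog_term_poly \<mu> h \<theta> (real (Suc k))) sums qdilog_poly \<mu> x h \<theta>"
proof -
  have S: "(\<lambda>k. complex_of_real (x ^ Suc k / real (Suc k) powi s)) sums of_real (polylog s x)" for s
    using polylog_sums[OF assms, of s] by (rule sums_of_real)
  let ?c = "\<lambda>k s. complex_of_real (x ^ Suc k / real (Suc k) powi s)"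
  have "(\<lambda>k. (?c k 2 + ?c k 1 * \<theta> + ?c k 0 * \<theta> ^ 2 / 2 + ?c k (-1) * \<theta> ^ 3 / 6 + ?c k (-2) * \<theta> ^ 4 / 24) / of_real (\<mu> * h\<^sup>2)
      + (?c k 1 + ?c k 0 * \<theta> + ?c k (-1) * \<theta> ^ 2 / 2) / 2 + ?c k 0 * of_real (\<mu> * h\<^sup>2) / 12) sums qdilog_poly \<mu> x h \<theta>"
    unfolding qdilog_poly_def by (intro sums_add sums_divide sums_mult2 S)
  moreover have "(?c k 2 + ?c k 1 * \<theta> + ?c k 0 * \<theta> ^ 2 / 2 + ?c k (-1) * \<theta> ^ 3 / 6 + ?c k (-2) * \<theta> ^ 4 / 24) / of_real (\<mu> * h\<^sup>2)
      + (?c k 1 + ?c k 0 * \<theta> + ?c k (-1) * \<theta> ^ 2 / 2) / 2 + ?c k 0 * of_real (\<mu> * h\<^sup>2) / 12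
      = of_real (x ^ Suc k) * qdilog_term_poly \<mu> h \<theta> (real (Suc k))" for k
  proof -
    define n where "n = real (Suc k)"
    define X where "X = complex_of_real (x ^ Suc k)"
    define N where "N = complex_of_real n"
    have pw: "complex_of_real (x ^ Suc k / n powi 2) = X / N ^ 2" "complex_of_real (x ^ Suc k / n powi 1) = X / N"
      "complex_of_real (x ^ Suc k / n powi 0) = X" "complex_of_real (x ^ Suc k / n powi (-1)) = X * N"
      "complex_of_real (x ^ Suc k / n powi (-2)) = X * N ^ 2"
      by (simp_all add: power_int_minus divide_inverse X_def N_def)
    show ?thesis
      unfolding n_def[symmetric] pw qdilog_term_poly_def N_def[symmetric] X_def[symmetric]
      by (simp only: distrib_left times_divide_eq_right times_divide_eq_left mult_1_right mult.assoc)
  qed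
  ultimately show ?thesis by simp
qed

text \<open>
  Only half of the exponential decay of the series is used to absorb \<open>exp (n Re \<theta>)\<close> and the powers of \<open>n\<close>,
  which is possible once \<open>h\<^sup>2 \<bar>b\<bar> \<le> t / 2\<close>. The imaginary part \<open>h w\<close> does not affect the size of the terms, so
  the estimate holds for all real \<open>w\<close>.
\<close>

lemma qdilog_expansion:
  fixes t \<mu> b :: real
  assumes t: "t > 0" and \<mu>: "\<mu> > 0"
  shows "\<exists>C h0. h0 > 0 \<and> (\<forall>h w. 0 < h \<and> h < h0 \<longrightarrow>
     norm (qdilog (\<mu> * h\<^sup>2) (- of_real t + (\<i> * of_real (h * w) - of_real (h\<^sup>2 * b)))
       - qdilog_poly \<mu> (exp (- t)) h (\<i> * of_real (h * w) - of_real (h\<^sup>2 * b))) \<le> C * h ^ 3 * (1 + \<bar>w\<bar>) ^ 5)"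
proof -
  define x \<tau> where "x = exp (- t)" and "\<tau> = t / 2"
  have x: "0 < x" "x < 1" using t by (auto simp: x_def)
  define y where "y = exp (- \<tau>)"
  have y: "0 < y" "y < 1" using t by (auto simp: y_def \<tau>_def)
  define h0 where "h0 = min 1 (\<tau> / (1 + \<bar>b\<bar>))"
  have h0: "h0 > 0" using t by (auto simp: h0_def \<tau>_def)
  define K where "K = 1 / \<mu> + 1 + \<mu> + \<mu>\<^sup>2"
  define S where "S = (\<Sum>k. real (Suc k) ^ 3 * y ^ Suc k)"
  have Ssum: "summable (\<lambda>k. real (Suc k) ^ 3 * y ^ Suc k)" by (rule summable_power_times_geometric[OF y])
  show ?thesis
  proof (rule exI[of _ "K * (1 + \<bar>b\<bar>) ^ 5 * S"], rule exI[of _ h0], intro conjI h0 allI impI)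
    fix h w :: real assume "0 < h \<and> h < h0"
    then have h: "0 < h" "h < h0" by auto
    define \<theta> where "\<theta> = \<i> * of_real (h * w) - of_real (h\<^sup>2 * b)"
    define B where "B = (1 + \<bar>b\<bar>) * (1 + \<bar>w\<bar>)"
    have B: "B \<ge> 1" unfolding B_def using mult_mono[of 1 "1 + \<bar>b\<bar>" 1 "1 + \<bar>w\<bar>"] by simp
    have h1: "h \<le> 1" "h * (1 + \<bar>b\<bar>) \<le> \<tau>" using h unfolding h0_def by (auto simp: field_simps)
    have hh: "h\<^sup>2 \<le> h" using h h1 by (simp add: power2_eq_square mult_left_le)
    have Re: "\<bar>Re \<theta>\<bar> \<le> \<tau>"
    proof -
      have "\<bar>Re \<theta>\<bar> = h\<^sup>2 * \<bar>b\<bar>" using h by (simp add: \<theta>_def abs_mult)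
      also have "\<dots> \<le> h * (1 + \<bar>b\<bar>)" using hh h by (intro mult_mono) auto
      finally show ?thesis using h1 by simp
    qed
    have nt: "norm \<theta> \<le> h * B"
    proof -
      have "norm \<theta> \<le> norm (\<i> * of_real (h * w)) + norm (complex_of_real (h\<^sup>2 * b))"
        unfolding \<theta>_def by (rule norm_triangle_ineq4)
      also have "\<dots> = h * \<bar>w\<bar> + h\<^sup>2 * \<bar>b\<bar>" using h by (simp add: norm_mult abs_mult del: of_real_mult)
      also have "\<dots> \<le> h * \<bar>w\<bar> + h * \<bar>b\<bar>" using hh by (intro add_left_mono mult_right_mono) auto
      also have "\<dots> \<le> h * B" using h by (auto simp: B_def algebra_simps)
      finally show ?thesis .
    qed
    define f where "f k = exp (of_nat (Suc k) * (- of_real t + \<theta>)) / of_real (real (Suc k) * (1 - exp (- (real (Suc k) * (\<mu> * h\<^sup>2)))))" for k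
    define g where "g k = of_real (x ^ Suc k) * qdilog_term_poly \<mu> h \<theta> (real (Suc k))" for k
    have g: "g sums qdilog_poly \<mu> x h \<theta>" unfolding g_def by (rule qdilog_poly_sums[OF x])
    have bd: "norm (f k - g k) \<le> K * h ^ 3 * B ^ 5 * (real (Suc k) ^ 3 * y ^ Suc k)" for k
    proof -
      let ?n = "real (Suc k)"
      have e1: "exp (of_nat (Suc k) * (- of_real t + \<theta>)) = of_real (x ^ Suc k) * exp (of_real ?n * \<theta>)"
      proof -
        have "of_real (x ^ Suc k) = exp (of_nat (Suc k) * (- complex_of_real t))"
          unfolding x_def exp_of_nat_mult by (simp add: exp_of_real[symmetric])
        then show ?thesis by (simp only: exp_add[symmetric] distrib_left of_real_of_nat_eq)
      qed
      have e2: "x ^ Suc k * exp (?n * \<tau>) = y ^ Suc k"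
        unfolding x_def y_def exp_of_nat_mult[symmetric] exp_add[symmetric] \<tau>_def by (simp add: field_simps)
      have "f k - g k = of_real (x ^ Suc k) * (exp (of_real ?n * \<theta>) / of_real (?n * (1 - exp (- (?n * (\<mu> * h\<^sup>2))))) - qdilog_term_poly \<mu> h \<theta> ?n)"
        unfolding f_def g_def e1 right_diff_distrib times_divide_eq_right ..
      then have "norm (f k - g k) = x ^ Suc k * norm (exp (of_real ?n * \<theta>) / of_real (?n * (1 - exp (- (?n * (\<mu> * h\<^sup>2))))) - qdilog_term_poly \<mu> h \<theta> ?n)"
        using x by (simp only: norm_mult norm_of_real abs_of_pos zero_less_power)
      also have "\<dots> \<le> x ^ Suc k * (K * h ^ 3 * B ^ 5 * (?n ^ 3 * exp (?n * \<tau>)))"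
        unfolding K_def using x by (intro mult_left_mono qdilog_term_bound \<mu> h h1 B nt Re) auto
      also have "\<dots> = K * h ^ 3 * B ^ 5 * (?n ^ 3 * (x ^ Suc k * exp (?n * \<tau>)))"
        by (simp only: mult_ac)
      finally show ?thesis unfolding e2 .
    qed
    have sb: "summable (\<lambda>k. K * h ^ 3 * B ^ 5 * (real (Suc k) ^ 3 * y ^ Suc k))"
      by (intro summable_mult Ssum)
    have sd: "summable (\<lambda>k. f k - g k)"
      by (rule summable_comparison_test[OF _ sb]) (use bd in blast)
    have sf: "summable f"
      using summable_add[OF sd sums_summable[OF g]] by simp
    have "norm (suminf f - qdilog_poly \<mu> x h \<theta>) = norm (\<Sum>k. f k - g k)"
      using suminf_diff[OF sf sums_summable[OF g]] sums_unique[OF g] by simp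
    also have "\<dots> \<le> (\<Sum>k. K * h ^ 3 * B ^ 5 * (real (Suc k) ^ 3 * y ^ Suc k))"
      by (rule norm_suminf_le[OF bd sb])
    also have "\<dots> = K * h ^ 3 * B ^ 5 * S" unfolding S_def by (rule suminf_mult[OF Ssum])
    also have "\<dots> = K * (1 + \<bar>b\<bar>) ^ 5 * S * h ^ 3 * (1 + \<bar>w\<bar>) ^ 5"
      unfolding B_def power_mult_distrib by (simp only: mult_ac)
    finally show "norm (qdilog (\<mu> * h\<^sup>2) (- of_real t + (\<i> * of_real (h * w) - of_real (h\<^sup>2 * b)))
       - qdilog_poly \<mu> (exp (- t)) h (\<i> * of_real (h * w) - of_real (h\<^sup>2 * b))) \<le> K * (1 + \<bar>b\<bar>) ^ 5 * S * h ^ 3 * (1 + \<bar>w\<bar>) ^ 5"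
      unfolding \<theta>_def[symmetric] x_def[symmetric] qdilog_def f_def[symmetric] .
  qed
qed

text \<open>
  After the substitution \<open>\<theta> = i h w - h\<^sup>2 b\<close> the truncated expansion is sorted by powers of \<open>h\<close>. The coefficient
  of \<open>h\<close> is odd in \<open>w\<close> and equals \<open>- i qdilog_coeff1\<close>; that of \<open>h\<^sup>2\<close> is even and equals \<open>qdilog_coeff2\<close>.
  The values of \<open>b\<close> occur through the Bernoulli polynomials of \<open>b / \<mu>\<close>.
\<close>

definition qdilog_coeff1 :: "real \<Rightarrow> real \<Rightarrow> real \<Rightarrow> real \<Rightarrow> real" where
  "qdilog_coeff1 \<mu> b x w = polylog 0 x * (b / \<mu> - 1 / 2) * w + polylog (-1) x / (6 * \<mu>) * w ^ 3"

definition qdilog_coeff2 :: "real \<Rightarrow> real \<Rightarrow> real \<Rightarrow> real \<Rightarrow> real" where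
  "qdilog_coeff2 \<mu> b x w = polylog 0 x * (b\<^sup>2 / (2 * \<mu>) - b / 2 + \<mu> / 12)
     + polylog (-1) x * (b / (2 * \<mu>) - 1 / 4) * w\<^sup>2 + polylog (-2) x / (24 * \<mu>) * w ^ 4"

definition qdilog_const :: "real \<Rightarrow> real \<Rightarrow> real \<Rightarrow> real \<Rightarrow> real" where
  "qdilog_const \<mu> b x h = polylog 2 x / (\<mu> * h\<^sup>2) + polylog 1 x * (1 / 2 - b / \<mu>)"

definition qdilog_rest :: "real \<Rightarrow> real \<Rightarrow> real \<Rightarrow> real \<Rightarrow> real \<Rightarrow> complex" where
  "qdilog_rest \<mu> b x h w =
     of_real (polylog (-1) x / (6 * \<mu>)) * (3 * \<i> * of_real (b\<^sup>2) * of_real w - of_real h * of_real (b ^ 3))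
   + of_real (polylog (-2) x / (24 * \<mu>)) * (4 * \<i> * of_real b * of_real w ^ 3 - 6 * of_real h * of_real (b\<^sup>2) * of_real w ^ 2
        - 4 * \<i> * of_real h * of_real h * of_real (b ^ 3) * of_real w + of_real h * of_real h * of_real h * of_real (b ^ 4))
   + of_real (polylog (-1) x / 4) * (of_real h * of_real (b\<^sup>2) - 2 * \<i> * of_real b * of_real w)"

text \<open>
  The powers of \<open>\<theta>\<close> are split into real and imaginary parts, and the factor \<open>1 / h\<^sup>2\<close> is cancelled in each
  of them separately (\<open>fold1\<close>, \<open>fold2\<close>). What remains is a polynomial identity.
\<close>

lemma qdilog_poly_expand:
  assumes "\<mu> > 0" "h > 0"
  shows "qdilog_poly \<mu> x h (\<i> * of_real (h * w) - of_real (h\<^sup>2 * b)) =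
    of_real (qdilog_const \<mu> b x h) + \<i> * of_real (polylog 1 x * w / (\<mu> * h)) - of_real (polylog 0 x * w\<^sup>2 / (2 * \<mu>))
    + of_real h * (- \<i> * of_real (qdilog_coeff1 \<mu> b x w)) + of_real h ^ 2 * of_real (qdilog_coeff2 \<mu> b x w) + of_real h ^ 3 * qdilog_rest \<mu> b x h w"
proof -
  define L2 L1 L0 M1 M2 where L: "L2 = polylog 2 x" "L1 = polylog 1 x" "L0 = polylog 0 x" "M1 = polylog (-1) x" "M2 = polylog (-2) x"
  define n where "n = 1 / \<mu>"
  have n: "1 / \<mu> = n" "\<And>y. y / \<mu> = y * n" by (simp_all add: n_def)
  define k where "k = 1 / h"
  have hk: "h * k = 1" using assms by (simp add: k_def)
  define \<theta> where "\<theta> = \<i> * complex_of_real (h * w) - of_real (h\<^sup>2 * b)"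
  have t2: "\<theta> ^ 2 = of_real (h^2 * (h^2 * b^2 - w^2)) - \<i> * of_real (2 * h ^ 3 * b * w)"
    unfolding \<theta>_def by (simp add: complex_eq_iff power2_eq_square power3_eq_cube algebra_simps)
  have t3: "\<theta> ^ 3 = of_real (h^4 * (3 * b * w^2 - h^2 * b^3)) + \<i> * of_real (h^3 * (3 * h^2 * b^2 * w - w^3))"
    unfolding power3_eq_cube[of \<theta>] power2_eq_square[symmetric] t2 unfolding \<theta>_def
    by (simp add: complex_eq_iff eval_nat_numeral algebra_simps)
  have t4: "\<theta> ^ 4 = of_real (h^4 * (w^4 - 6 * h^2 * b^2 * w^2 + h^4 * b^4)) + \<i> * of_real (h^5 * (4 * b * w^3 - 4 * h^2 * b^3 * w))"
  proof -
    have "\<theta> ^ 4 = \<theta> ^ 2 * \<theta> ^ 2" by simp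
    then show ?thesis unfolding t2
      by (simp add: complex_eq_iff eval_nat_numeral algebra_simps)
  qed
  have d: "z / complex_of_real (\<mu> * h\<^sup>2) = z * of_real (n * k\<^sup>2)" for z
    by (simp add: n_def k_def power_divide divide_inverse power_inverse)
  have fold1: "(c + h\<^sup>2 * Z) * (n * k\<^sup>2) = n * (c * k\<^sup>2 + Z)" for c Z
  proof -
    have "(c + h\<^sup>2 * Z) * (n * k\<^sup>2) = n * (c * k\<^sup>2 + (h * k) * (h * k) * Z)"
      by (simp add: power2_eq_square algebra_simps)
    then show ?thesis unfolding hk by simp
  qed
  have fold2: "(c * h + h ^ 3 * Z) * (n * k\<^sup>2) = n * (c * k + h * Z)" for c Z
  proof -
    have "(c * h + h ^ 3 * Z) * (n * k\<^sup>2) = n * (c * k * (h * k) + h * (h * k) * (h * k) * Z)"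
      by (simp add: power2_eq_square power3_eq_cube algebra_simps)
    then show ?thesis unfolding hk by simp
  qed
  have rest: "qdilog_rest \<mu> b x h w =
      of_real (- (M1 * n / 6 * h * b^3) + M2 * n / 24 * (h^3 * b^4 - 6 * h * b^2 * w^2) + M1 / 4 * h * b^2)
      + \<i> * of_real (M1 * n / 6 * (3 * b^2 * w) + M2 * n / 24 * (4 * b * w^3 - 4 * h^2 * b^3 * w) - M1 / 4 * (2 * b * w))"
    unfolding qdilog_rest_def L n_def by (simp add: complex_eq_iff eval_nat_numeral algebra_simps)
  have c: "qdilog_const \<mu> b x h = L2 * n * k\<^sup>2 + L1 * (1 / 2 - b * n)"
    unfolding qdilog_const_def L n_def k_def by (simp add: power_divide)
  have q1: "qdilog_coeff1 \<mu> b x w = L0 * (b * n - 1 / 2) * w + M1 * n / 6 * w ^ 3"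
    unfolding qdilog_coeff1_def L n_def by simp
  have q2: "qdilog_coeff2 \<mu> b x w = L0 * (b\<^sup>2 * n / 2 - b / 2 + \<mu> / 12) + M1 * (b * n / 2 - 1 / 4) * w\<^sup>2 + M2 * n / 24 * w ^ 4"
    unfolding qdilog_coeff2_def L n_def by (simp add: mult.commute)
  have l: "polylog 1 x * w / (\<mu> * h) = L1 * w * n * k" "polylog 0 x * w\<^sup>2 / (2 * \<mu>) = L0 * w\<^sup>2 * n / 2"
    unfolding L n_def k_def by simp_all
  define ZR where "ZR = L1 * (- b) + L0 * (h\<^sup>2 * b\<^sup>2 - w\<^sup>2) / 2 + M1 * h\<^sup>2 * (3 * b * w\<^sup>2 - h\<^sup>2 * b ^ 3) / 6
      + M2 * h\<^sup>2 * (w ^ 4 - 6 * h\<^sup>2 * b\<^sup>2 * w\<^sup>2 + h ^ 4 * b ^ 4) / 24"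
  define ZI where "ZI = - (L0 * b * w) + M1 * (3 * h\<^sup>2 * b\<^sup>2 * w - w ^ 3) / 6 + M2 * h\<^sup>2 * (4 * b * w ^ 3 - 4 * h\<^sup>2 * b ^ 3 * w) / 24"
  define R2 where "R2 = (L1 - L0 * h\<^sup>2 * b + M1 * h\<^sup>2 * (h\<^sup>2 * b\<^sup>2 - w\<^sup>2) / 2) / 2 + L0 * \<mu> * h\<^sup>2 / 12"
  define I2 where "I2 = (L0 * h * w - M1 * h ^ 3 * b * w) / 2"
  have "qdilog_poly \<mu> x h \<theta> = of_real ((L2 + h\<^sup>2 * ZR) * (n * k\<^sup>2) + R2) + \<i> * of_real ((L1 * w * h + h ^ 3 * ZI) * (n * k\<^sup>2) + I2)"
  proof -
    have A: "of_real L2 + of_real L1 * \<theta> + of_real L0 * \<theta> ^ 2 / 2 + of_real M1 * \<theta> ^ 3 / 6 + of_real M2 * \<theta> ^ 4 / 24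
      = of_real (L2 + h\<^sup>2 * ZR) + \<i> * of_real (L1 * w * h + h ^ 3 * ZI)"
      unfolding t2 t3 t4 unfolding \<theta>_def ZR_def ZI_def
      by (simp add: complex_eq_iff eval_nat_numeral field_simps)
    have B: "(of_real L1 + of_real L0 * \<theta> + of_real M1 * \<theta> ^ 2 / 2) / 2 + of_real L0 * of_real (\<mu> * h\<^sup>2) / 12 = of_real R2 + \<i> * of_real I2"
      unfolding t2 unfolding \<theta>_def R2_def I2_def
      by (simp add: complex_eq_iff eval_nat_numeral field_simps)
    show ?thesis
      unfolding qdilog_poly_def L[symmetric] A d add.assoc[of "_ * _" "_ / 2"] B
      by (simp add: algebra_simps)
  qed
  also have "\<dots> = of_real (n * (L2 * k\<^sup>2 + ZR) + R2) + \<i> * of_real (n * (L1 * w * k + h * ZI) + I2)"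
    unfolding fold1 fold2 ..
  also have "\<dots> = of_real (L2 * n * k\<^sup>2 + L1 * (1 / 2 - b * n)) + \<i> * of_real (L1 * w * n * k) - of_real (L0 * w\<^sup>2 * n / 2)
    + of_real h * (- \<i> * of_real (L0 * (b * n - 1 / 2) * w + M1 * n / 6 * w ^ 3))
    + of_real h ^ 2 * of_real (L0 * (b\<^sup>2 * n / 2 - b / 2 + \<mu> / 12) + M1 * (b * n / 2 - 1 / 4) * w\<^sup>2 + M2 * n / 24 * w ^ 4)
    + of_real h ^ 3 * (of_real (- (M1 * n / 6 * h * b^3) + M2 * n / 24 * (h^3 * b^4 - 6 * h * b^2 * w^2) + M1 / 4 * h * b^2)
      + \<i> * of_real (M1 * n / 6 * (3 * b^2 * w) + M2 * n / 24 * (4 * b * w^3 - 4 * h^2 * b^3 * w) - M1 / 4 * (2 * b * w)))"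
    unfolding ZR_def ZI_def R2_def I2_def by (simp add: complex_eq_iff eval_nat_numeral field_simps)
  finally show ?thesis unfolding c q1 q2 l rest \<theta>_def .
qed

lemma poly_bigo_mult0: "poly_bigo 0 f \<Longrightarrow> poly_bigo 0 g \<Longrightarrow> poly_bigo 0 (\<lambda>h z. f h z * g h z)"
  by (rule poly_bigo_mult) auto

lemma poly_bigo_h0: "poly_bigo 0 (\<lambda>h z. of_real h)"
  using poly_bigo_mono[OF poly_bigo_h[of 1], of 0] by simp

lemma qdilog_poly_bigo:
  assumes t: "t > 0" and \<mu>: "\<mu> > 0" and W: "poly_bigo 0 (\<lambda>h z. of_real (W z))"
  shows "poly_bigo 3 (\<lambda>h z. qdilog (\<mu> * h\<^sup>2) (- of_real t + (\<i> * of_real (h * W z) - of_real (h\<^sup>2 * b))) -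
    (of_real (qdilog_const \<mu> b (exp (- t)) h) + \<i> * of_real (polylog 1 (exp (- t)) * W z / (\<mu> * h)) - of_real (polylog 0 (exp (- t)) * (W z)\<^sup>2 / (2 * \<mu>))
    + of_real h * (- \<i> * of_real (qdilog_coeff1 \<mu> b (exp (- t)) (W z))) + of_real h ^ 2 * of_real (qdilog_coeff2 \<mu> b (exp (- t)) (W z))))"
proof -
  let ?x = "exp (- t)"
  let ?\<theta> = "\<lambda>h z. \<i> * complex_of_real (h * W z) - of_real (h\<^sup>2 * b)"
  have 1: "poly_bigo 3 (\<lambda>h z. qdilog (\<mu> * h\<^sup>2) (- of_real t + ?\<theta> h z) - qdilog_poly \<mu> ?x h (?\<theta> h z))"
  proof -
    obtain C h0 where h0: "h0 > 0" and C: "\<forall>h w. 0 < h \<and> h < h0 \<longrightarrow>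
       norm (qdilog (\<mu> * h\<^sup>2) (- of_real t + (\<i> * of_real (h * w) - of_real (h\<^sup>2 * b)))
       - qdilog_poly \<mu> (exp (- t)) h (\<i> * of_real (h * w) - of_real (h\<^sup>2 * b))) \<le> C * h ^ 3 * (1 + \<bar>w\<bar>) ^ 5"
      using qdilog_expansion[OF t \<mu>, of b] by (elim exE conjE) (rule that)
    obtain D N where D: "D \<ge> 0" and ev: "\<forall>\<^sub>F h in at_right 0. 0 < h \<and> h < 1 \<and> (\<forall>z. norm (complex_of_real (W z)) \<le> D * h ^ 0 * poly_weight z ^ N)"
      by (rule poly_bigoE[OF W])
    obtain h1 where "\<forall>z. norm (complex_of_real (W z)) \<le> D * h1 ^ 0 * poly_weight z ^ N"
      using eventually_happens'[OF _ ev] trivial_limit_at_right_real by blast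
    then have Wb: "\<bar>W z\<bar> \<le> D * poly_weight z ^ N" for z
      unfolding norm_of_real power_0 mult_1_right by blast
    show ?thesis
    proof (rule poly_bigoI[OF _ h0, of _ "\<bar>C\<bar> * (1 + D) ^ 5" 3 "N * 5"])
      fix h :: real and z :: "real \<times> real" assume h: "0 < h" "h < h0"
      have "1 + \<bar>W z\<bar> \<le> (1 + D) * poly_weight z ^ N"
        using Wb[of z] one_le_power[OF poly_weight_ge_1[of z], of N] by (simp add: algebra_simps)
      then have p: "(1 + \<bar>W z\<bar>) ^ 5 \<le> ((1 + D) * poly_weight z ^ N) ^ 5" by (intro power_mono) auto
      have "norm (qdilog (\<mu> * h\<^sup>2) (- of_real t + ?\<theta> h z) - qdilog_poly \<mu> ?x h (?\<theta> h z)) \<le> C * h ^ 3 * (1 + \<bar>W z\<bar>) ^ 5"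
        using C h by blast
      also have "\<dots> \<le> \<bar>C\<bar> * h ^ 3 * ((1 + D) * poly_weight z ^ N) ^ 5"
        using h p by (intro mult_mono) auto
      finally show "norm (qdilog (\<mu> * h\<^sup>2) (- of_real t + ?\<theta> h z) - qdilog_poly \<mu> ?x h (?\<theta> h z))
          \<le> \<bar>C\<bar> * (1 + D) ^ 5 * h ^ 3 * poly_weight z ^ (N * 5)"
        by (simp add: power_mult_distrib power_mult mult_ac)
    qed
  qed
  have "poly_bigo 0 (\<lambda>h z. qdilog_rest \<mu> b ?x h (W z))"
    unfolding qdilog_rest_def
    by (intro poly_bigo_add poly_bigo_diff poly_bigo_mult0 poly_bigo_power poly_bigo_const poly_bigo_h0 W)
  then have 2: "poly_bigo 3 (\<lambda>h z. of_real h ^ 3 * qdilog_rest \<mu> b ?x h (W z))"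
    by (rule poly_bigo_mult[OF poly_bigo_h]) simp
  have 3: "(A - p) + r = A - m" if "p = m + r" for A p m r :: complex
    using that by simp
  show ?thesis
    by (rule poly_bigo_cong[OF poly_bigo_add[OF 1 2]]) (rule 3[OF qdilog_poly_expand[OF \<mu>]])
qed

section \<open>A Gaussian integral for the Nahm sum\<close>

text \<open>
  At \<open>q = exp (- \<epsilon>)\<close> the summand of the Nahm sum is a positive real number, in which \<open>m\<close> may be replaced by
  a real parameter \<open>\<mu>\<close>.
\<close>

definition nahm_term :: "real \<Rightarrow> real \<Rightarrow> real \<Rightarrow> real \<Rightarrow> real \<Rightarrow> real \<Rightarrow> real \<Rightarrow> nat \<Rightarrow> nat \<Rightarrow> real" where
  "nahm_term \<alpha> \<beta> \<gamma> \<mu> a b \<epsilon> r s =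
     exp (- (\<epsilon> * ((\<alpha> * real r ^ 2 + 2 * \<beta> * real r * real s + \<gamma> * real s ^ 2) / 2 + a * real r + b * real s)))
     / (qfact (exp (- \<epsilon>)) r * qfact (exp (- (\<mu> * \<epsilon>))) s)"

text \<open>
  With \<open>x = exp (- t)\<close> and \<open>y = exp (- u)\<close> the two saddle point equations read
  \<open>x = (1 - x)\<^bsup>\<alpha>\<^esup> (1 - y)\<^bsup>\<beta>/\<mu>\<^esup>\<close> and \<open>y = (1 - x)\<^bsup>\<beta>\<^esup> (1 - y)\<^bsup>\<gamma>/\<mu>\<^esup>\<close>, which are Nahm's equations for \<open>1 - x\<close> and
  \<open>1 - y\<close>; recall that \<open>polylog 1 x = - ln (1 - x)\<close>. They make the terms of the exponent that are linear
  in the Gaussian vector cancel.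
\<close>

locale nahm_saddle =
  fixes \<alpha> \<beta> \<gamma> \<mu> a b t u :: real
  assumes \<alpha>: "\<alpha> > 0" and det: "\<alpha> * \<gamma> - \<beta>\<^sup>2 > 0" and \<mu>: "\<mu> > 0" and t: "t > 0" and u: "u > 0"
    and saddle1: "t = \<alpha> * polylog 1 (exp (- t)) + \<beta> * (polylog 1 (exp (- u)) / \<mu>)"
    and saddle2: "u = \<beta> * polylog 1 (exp (- t)) + \<gamma> * (polylog 1 (exp (- u)) / \<mu>)"
begin

definition "x = exp (- t)"
definition "y = exp (- u)"
definition "\<kappa>\<^sub>1 = polylog 1 x"
definition "\<kappa>\<^sub>2 = polylog 1 y / \<mu>"
definition "X z = fst (gauss_pair \<alpha> \<beta> \<gamma> z)"
definition "Y z = snd (gauss_pair \<alpha> \<beta> \<gamma> z)"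

lemma eventually_arguments_positive: "\<forall>\<^sub>F h in at_right 0. t + h\<^sup>2 * a > 0" "\<forall>\<^sub>F h in at_right 0. u + h\<^sup>2 * b > 0"
proof -
  have l1: "((\<lambda>h. t + h\<^sup>2 * a) \<longlongrightarrow> t + 0\<^sup>2 * a) (at_right 0)" and l2: "((\<lambda>h. u + h\<^sup>2 * b) \<longlongrightarrow> u + 0\<^sup>2 * b) (at_right 0)"
    by (intro tendsto_intros)+
  have t1: "\<forall>\<^sub>F h in at_right 0. t + h\<^sup>2 * a > 0" using order_tendstoD(1)[OF l1, of 0] t by simp
  have t2: "\<forall>\<^sub>F h in at_right 0. u + h\<^sup>2 * b > 0" using order_tendstoD(1)[OF l2, of 0] u by simp
  show "\<forall>\<^sub>F h in at_right 0. t + h\<^sup>2 * a > 0" "\<forall>\<^sub>F h in at_right 0. u + h\<^sup>2 * b > 0" by fact+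
qed

lemma XY_measurable [measurable]: "X \<in> borel_measurable borel" "Y \<in> borel_measurable borel"
  unfolding X_def[abs_def] Y_def[abs_def] gauss_pair_def fst_conv snd_conv
  by (intro borel_measurable_continuous_onI continuous_intros)+

text \<open>
  The exponent of the integrand. The first two summands are the logarithms of Euler's products, and the
  last one is the phase by which the Gaussian measure changes when the contour is moved by \<open>(- t, - u)\<close>.
\<close>

definition expo :: "real \<Rightarrow> real \<times> real \<Rightarrow> complex" where
  "expo h z = qdilog (1 * h\<^sup>2) (- of_real t + (\<i> * of_real (h * X z) - of_real (h\<^sup>2 * a)))
     + qdilog (\<mu> * h\<^sup>2) (- of_real u + (\<i> * of_real (h * Y z) - of_real (h\<^sup>2 * b)))
     - \<i> * of_real ((\<kappa>\<^sub>1 * X z + \<kappa>\<^sub>2 * Y z) / h)"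

text \<open>
  The expectation is a value of the characteristic function, at \<open>(r h - \<kappa>\<^sub>1 / h, s h - \<kappa>\<^sub>2 / h)\<close>. When the square
  in the exponent is multiplied out, the mixed terms are \<open>t r + u s\<close> by the saddle point equations, and they
  cancel the factor \<open>exp (- t r - u s)\<close>.
\<close>

lemma char_term:
  assumes h: "h > 0"
  shows "(LINT z|normal_plane. exp (of_nat r * (- of_real t + (\<i> * of_real (h * X z) - of_real (h\<^sup>2 * a)))) *
      exp (of_nat s * (- of_real u + (\<i> * of_real (h * Y z) - of_real (h\<^sup>2 * b)))) *
      exp (- (\<i> * of_real ((\<kappa>\<^sub>1 * X z + \<kappa>\<^sub>2 * Y z) / h))))
    = of_real (exp (- ((t * \<kappa>\<^sub>1 + u * \<kappa>\<^sub>2) / (2 * h\<^sup>2))) *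
        exp (- (h\<^sup>2 * ((\<alpha> * real r ^ 2 + 2 * \<beta> * real r * real s + \<gamma> * real s ^ 2) / 2 + a * real r + b * real s))))"
    (is "?I = _")
proof -
  define c where "c = - (real r * (t + h\<^sup>2 * a)) - real s * (u + h\<^sup>2 * b)"
  define v w where "v = real r * h - \<kappa>\<^sub>1 / h" and "w = real s * h - \<kappa>\<^sub>2 / h"
  have "?I = (LINT z|normal_plane. of_real (exp c) * iexp (v * X z + w * Y z))"
  proof (intro Bochner_Integration.integral_cong refl)
    fix z
    have "of_nat r * (- complex_of_real t + (\<i> * of_real (h * X z) - of_real (h\<^sup>2 * a)))
        + of_nat s * (- of_real u + (\<i> * of_real (h * Y z) - of_real (h\<^sup>2 * b)))
        + - (\<i> * of_real ((\<kappa>\<^sub>1 * X z + \<kappa>\<^sub>2 * Y z) / h)) = of_real c + \<i> * of_real (v * X z + w * Y z)"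
      unfolding c_def v_def w_def by (simp add: complex_eq_iff algebra_simps add_divide_distrib)
    then show "exp (of_nat r * (- complex_of_real t + (\<i> * of_real (h * X z) - of_real (h\<^sup>2 * a)))) *
      exp (of_nat s * (- of_real u + (\<i> * of_real (h * Y z) - of_real (h\<^sup>2 * b)))) *
      exp (- (\<i> * of_real ((\<kappa>\<^sub>1 * X z + \<kappa>\<^sub>2 * Y z) / h))) = of_real (exp c) * iexp (v * X z + w * Y z)"
      by (simp only: exp_add[symmetric] exp_of_real[symmetric])
  qed
  also have "\<dots> = of_real (exp c) * of_real (exp (- (\<alpha> * v\<^sup>2 + 2 * \<beta> * v * w + \<gamma> * w\<^sup>2) / 2))"
    unfolding X_def Y_def integral_mult_right_zero char_gauss_pair[OF \<alpha> det] ..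
  also have "\<dots> = of_real (exp (c + - (\<alpha> * v\<^sup>2 + 2 * \<beta> * v * w + \<gamma> * w\<^sup>2) / 2))"
    by (simp only: exp_add of_real_mult)
  also have "c + - (\<alpha> * v\<^sup>2 + 2 * \<beta> * v * w + \<gamma> * w\<^sup>2) / 2 =
     - ((t * \<kappa>\<^sub>1 + u * \<kappa>\<^sub>2) / (2 * h\<^sup>2)) +
        - (h\<^sup>2 * ((\<alpha> * real r ^ 2 + 2 * \<beta> * real r * real s + \<gamma> * real s ^ 2) / 2 + a * real r + b * real s))"
  proof -
    define k where "k = 1 / h"
    have k: "h * k = 1" using h by (simp add: k_def)
    \<comment> \<open>The constants \<open>\<kappa>\<^sub>1\<close> and \<open>\<kappa>\<^sub>2\<close> contain \<open>t\<close> and \<open>u\<close>, so the saddle point equations can serve as rewrite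
      rules for \<open>t\<close> and \<open>u\<close> only once those constants are replaced by variables.\<close>
    obtain k1 k2 where kk: "\<kappa>\<^sub>1 = k1" "\<kappa>\<^sub>2 = k2" by blast
    have s: "t = \<alpha> * k1 + \<beta> * k2" "u = \<beta> * k1 + \<gamma> * k2"
      using saddle1 saddle2 by (simp_all add: kk[symmetric] \<kappa>\<^sub>1_def \<kappa>\<^sub>2_def x_def y_def)
    have vw: "v = real r * h - k1 * k" "w = real s * h - k2 * k"
      by (simp_all add: v_def w_def k_def kk)
    have d: "(t * \<kappa>\<^sub>1 + u * \<kappa>\<^sub>2) / (2 * h\<^sup>2) = (t * \<kappa>\<^sub>1 + u * \<kappa>\<^sub>2) * k\<^sup>2 / 2"
      by (simp add: k_def power_divide)
    define R S where "R = real r" and "S = real s"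
    have prod: "(A * h - B * k) * (C * h - D * k) = A * C * h\<^sup>2 - A * D - B * C + B * D * k\<^sup>2" for A B C D :: real
    proof -
      have "(A * h - B * k) * (C * h - D * k) = A * C * h\<^sup>2 - A * D * (h * k) - B * C * (h * k) + B * D * k\<^sup>2"
        by (simp add: algebra_simps power2_eq_square)
      then show ?thesis unfolding k by simp
    qed
    have "2 * c - (\<alpha> * v\<^sup>2 + 2 * \<beta> * v * w + \<gamma> * w\<^sup>2) = 2 * c - (\<alpha> * (v * v) + 2 * \<beta> * (v * w) + \<gamma> * (w * w))"
      by (simp add: power2_eq_square)
    also have "\<dots> = - ((t * \<kappa>\<^sub>1 + u * \<kappa>\<^sub>2) * k\<^sup>2) - h\<^sup>2 * (\<alpha> * R ^ 2 + 2 * \<beta> * R * S + \<gamma> * S ^ 2 + 2 * (a * R) + 2 * (b * S))"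
      unfolding kk unfolding c_def vw prod R_def[symmetric] S_def[symmetric] s by (simp add: algebra_simps power2_eq_square)
    finally have "2 * c - (\<alpha> * v\<^sup>2 + 2 * \<beta> * v * w + \<gamma> * w\<^sup>2) =
      - ((t * \<kappa>\<^sub>1 + u * \<kappa>\<^sub>2) * k\<^sup>2) - h\<^sup>2 * (\<alpha> * R ^ 2 + 2 * \<beta> * R * S + \<gamma> * S ^ 2 + 2 * (a * R) + 2 * (b * S))" .
    then show ?thesis unfolding d R_def[symmetric] S_def[symmetric] by (simp add: field_simps)
  qed
  finally show ?thesis by (simp only: exp_add)
qed

text \<open>
  Summation and expectation may be interchanged because the modulus of every summand is independent
  of the sample point and these moduli form a product of two convergent series.
\<close>

lemma integral_representation:
  assumes h: "h > 0" "t + h\<^sup>2 * a > 0" "u + h\<^sup>2 * b > 0"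
  shows "(LINT z|normal_plane. exp (expo h z)) =
    of_real (exp (- ((t * \<kappa>\<^sub>1 + u * \<kappa>\<^sub>2) / (2 * h\<^sup>2)))) * of_real (\<Sum>\<^sub>\<infinity>(r, s)\<in>UNIV. nahm_term \<alpha> \<beta> \<gamma> \<mu> a b (h\<^sup>2) r s)"
    and "(\<lambda>(r, s). nahm_term \<alpha> \<beta> \<gamma> \<mu> a b (h\<^sup>2) r s) summable_on UNIV"
proof -
  define q1 q2 where "q1 = exp (- h\<^sup>2)" and "q2 = exp (- (\<mu> * h\<^sup>2))"
  have q: "0 < q1" "q1 < 1" "0 < q2" "q2 < 1" using h \<mu> by (auto simp: q1_def q2_def)
  define U where "U z = - complex_of_real t + (\<i> * of_real (h * X z) - of_real (h\<^sup>2 * a))" for z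
  define V where "V z = - complex_of_real u + (\<i> * of_real (h * Y z) - of_real (h\<^sup>2 * b))" for z
  define P where "P z = exp (- (\<i> * complex_of_real ((\<kappa>\<^sub>1 * X z + \<kappa>\<^sub>2 * Y z) / h)))" for z
  have [measurable]: "U \<in> borel_measurable borel" "V \<in> borel_measurable borel" "P \<in> borel_measurable borel"
    unfolding U_def[abs_def] V_def[abs_def] P_def[abs_def] by measurable
  have UV: "Re (U z) < 0" "Re (V z) < 0" for z using h by (simp_all add: U_def V_def)
  define g where "g p z = exp (of_nat (fst p) * U z) / of_real (qfact q1 (fst p)) * (exp (of_nat (snd p) * V z) / of_real (qfact q2 (snd p)))"
    for p :: "nat \<times> nat" and z
  define f where "f = (\<lambda>(p, z). g p z * P z)"
  define e1 e2 where "e1 = exp (- (t + h\<^sup>2 * a))" and "e2 = exp (- (u + h\<^sup>2 * b))"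
  define c where "c = (\<lambda>(r, s). (e1 ^ r / qfact q1 r) * (e2 ^ s / qfact q2 s))"
  have e: "0 < e1" "e1 < 1" "0 < e2" "e2 < 1" using h by (auto simp: e1_def e2_def)
  have abs1: "Infinite_Set_Sum.abs_summable_on (\<lambda>r. w ^ r / of_real (qfact q r)) UNIV" if "0 < q" "q < 1" "norm w < 1" for q and w :: complex
    unfolding abs_summable_on_nat_iff'
  proof -
    have "summable (\<lambda>n. of_real (norm w) ^ n / complex_of_real (qfact q n))"
      by (rule qexp_summable) (use that in auto)
    then have "summable (\<lambda>n. complex_of_real (norm w ^ n / qfact q n))" by simp
    then have "summable (\<lambda>n. norm w ^ n / qfact q n)" by (rule summable_of_real_iff[THEN iffD1])
    moreover have "norm (w ^ n / of_real (qfact q n)) = norm w ^ n / qfact q n" for n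
      using qfact_pos[OF that(1,2), of n] by (simp add: norm_divide norm_power)
    ultimately show "summable (\<lambda>n. norm (w ^ n / of_real (qfact q n)))" by simp
  qed
  have nU: "norm (exp (U z)) = e1" and nV: "norm (exp (V z)) = e2" for z
    by (simp_all add: U_def V_def e1_def e2_def)
  have gsum: "g p z = (\<lambda>(r, s). (exp (U z) ^ r / of_real (qfact q1 r)) * (exp (V z) ^ s / of_real (qfact q2 s))) p" for p z
    by (simp add: g_def exp_of_nat_mult case_prod_beta)
  have aU: "Infinite_Set_Sum.abs_summable_on (\<lambda>r. exp (U z) ^ r / of_real (qfact q1 r)) UNIV" for z
    by (rule abs1) (use q e nU in auto)
  have aV: "Infinite_Set_Sum.abs_summable_on (\<lambda>r. exp (V z) ^ r / of_real (qfact q2 r)) UNIV" for z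
    by (rule abs1) (use q e nV in auto)
  note cnt = countableI_type[of "UNIV :: nat set"]
  have as: "Infinite_Set_Sum.abs_summable_on (\<lambda>p. g p z) UNIV" for z
    unfolding gsum using abs_summable_on_product[OF cnt cnt aU aV] by simp
  have "infsetsum (\<lambda>p. g p z) UNIV = exp (qdilog (1 * h\<^sup>2) (U z)) * exp (qdilog (\<mu> * h\<^sup>2) (V z))" for z
  proof -
    have 1: "infsetsum (\<lambda>r. exp (U z) ^ r / of_real (qfact q1 r)) UNIV = exp (qdilog (1 * h\<^sup>2) (U z))"
      using sums_infsetsum_nat'[OF aU[of z]] exp_qdilog_sums[OF UV(1)[of z], of "1 * h\<^sup>2"] q e nU h
      by (simp add: q1_def exp_of_nat_mult sums_iff)
    have 2: "infsetsum (\<lambda>s. exp (V z) ^ s / of_real (qfact q2 s)) UNIV = exp (qdilog (\<mu> * h\<^sup>2) (V z))"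
      using sums_infsetsum_nat'[OF aV[of z]] exp_qdilog_sums[OF UV(2)[of z], of "\<mu> * h\<^sup>2"] q e nV h \<mu>
      by (simp add: q2_def exp_of_nat_mult sums_iff)
    show ?thesis unfolding gsum
      using infsetsum_product[OF cnt cnt aU[of z] aV[of z]] unfolding 1 2 by simp
  qed
  then have E: "exp (expo h z) = (LINT p|count_space UNIV. f (p, z))" for z
    unfolding expo_def U_def[symmetric] V_def[symmetric] f_def infsetsum_def
    by (simp add: exp_add exp_diff P_def exp_minus divide_inverse del: of_real_divide)
  interpret pair_sigma_finite "count_space (UNIV :: (nat \<times> nat) set)" normal_plane
    by (intro pair_sigma_finite.intro sigma_finite_measure_count_space_countable prob_space_imp_sigma_finite prob_space_normal_plane) auto
  interpret NP: prob_space normal_plane by (rule prob_space_normal_plane)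
  have fm: "(\<lambda>z. f (p, z)) \<in> borel_measurable normal_plane" for p
    unfolding f_def g_def split_conv by measurable
  have nf: "norm (f (p, z)) = c p" for p z
  proof -
    have "norm (P z) = 1" by (simp add: P_def)
    moreover have "norm (g p z) = c p"
      unfolding g_def c_def exp_of_nat_mult norm_mult norm_divide norm_power nU nV
      using qfact_pos[of q1 "fst p"] qfact_pos[of q2 "snd p"] q by (simp add: case_prod_beta abs_mult)
    ultimately show ?thesis by (simp add: f_def norm_mult)
  qed
  have csum: "Infinite_Set_Sum.abs_summable_on c UNIV"
  proof -
    have "Infinite_Set_Sum.abs_summable_on (\<lambda>p. norm (g p (0,0))) UNIV" using as[of "(0,0)"] by simp
    moreover have "norm (g p (0,0)) = c p" for p using nf[of p "(0,0)"] by (simp add: f_def norm_mult P_def)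
    ultimately show ?thesis by simp
  qed
  have fint: "integrable normal_plane (\<lambda>z. f (p, z))" for p
    by (rule NP.integrable_const_bound[of _ "c p"]) (use nf fm in auto)
  have int: "integrable (count_space UNIV \<Otimes>\<^sub>M normal_plane) f"
  proof (rule Fubini_integrable)
    show "f \<in> borel_measurable (count_space UNIV \<Otimes>\<^sub>M normal_plane)"
      by (rule measurable_pair_measure_countable1) (use fm in auto)
    show "integrable (count_space UNIV) (\<lambda>p. LINT z|normal_plane. norm (f (p, z)))"
      unfolding nf using csum by (simp add: abs_summable_on_def NP.prob_space)
  qed (use fint in auto)
  define K where "K = exp (- ((t * \<kappa>\<^sub>1 + u * \<kappa>\<^sub>2) / (2 * h\<^sup>2)))"
  define n where "n = (\<lambda>(r, s). nahm_term \<alpha> \<beta> \<gamma> \<mu> a b (h\<^sup>2) r s)"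
  have K: "K > 0" by (simp add: K_def)
  have trm: "(LINT z|normal_plane. f (p, z)) = of_real (K * n p)" for p
  proof -
    obtain r s where p: "p = (r, s)" by fastforce
    have "(LINT z|normal_plane. f (p, z)) = (LINT z|normal_plane. (exp (of_nat r * U z) * exp (of_nat s * V z) * P z) / of_real (qfact q1 r * qfact q2 s))"
      unfolding f_def g_def p split_conv fst_conv snd_conv
      by (intro Bochner_Integration.integral_cong refl) simp
    also have "\<dots> = of_real (K * n p)"
      unfolding integral_divide_zero U_def V_def P_def char_term[OF h(1)] p n_def split_conv nahm_term_def K_def q1_def q2_def
      by simp
    finally show ?thesis .
  qed
  have ks: "Infinite_Set_Sum.abs_summable_on (\<lambda>p. complex_of_real (K * n p)) UNIV"
    unfolding abs_summable_on_def trm[symmetric] using integrable_fst'[OF int] .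
  then have ns: "Infinite_Set_Sum.abs_summable_on n UNIV"
  proof -
    have "Infinite_Set_Sum.abs_summable_on (\<lambda>p. norm (complex_of_real (K * n p))) UNIV"
      using ks unfolding abs_summable_on_norm_iff .
    then have "Infinite_Set_Sum.abs_summable_on (\<lambda>p. norm (K * n p)) UNIV"
      unfolding norm_of_real real_norm_def .
    then have "Infinite_Set_Sum.abs_summable_on (\<lambda>p. K * n p) UNIV"
      unfolding abs_summable_on_norm_iff .
    then have "Infinite_Set_Sum.abs_summable_on (\<lambda>p. (1 / K) * (K * n p)) UNIV" by (rule abs_summable_on_cmult_right)
    then show ?thesis using K by simp
  qed
  have ns': "Infinite_Sum.abs_summable_on n UNIV" using ns abs_summable_equivalent by blast
  have "(LINT z|normal_plane. exp (expo h z)) = (LINT z|normal_plane. LINT p|count_space UNIV. f (p, z))"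
    unfolding E ..
  also have "\<dots> = (LINT p|count_space UNIV. LINT z|normal_plane. f (p, z))"
    using Fubini_integral[of "\<lambda>p z. f (p, z)"] int by simp
  also have "\<dots> = infsetsum (\<lambda>p. complex_of_real (K * n p)) UNIV"
    unfolding trm infsetsum_def ..
  also have "\<dots> = infsum (\<lambda>p. complex_of_real (K * n p)) UNIV"
    by (rule infsetsum_infsum) (use ks abs_summable_equivalent in blast)
  also have "\<dots> = of_real K * of_real (infsum n UNIV)"
  proof (rule infsumI)
    have "(n has_sum infsum n UNIV) UNIV"
      using abs_summable_summable[OF ns'] by (rule has_sum_infsum)
    then have "((\<lambda>p. K * n p) has_sum K * infsum n UNIV) UNIV" by (rule has_sum_cmult_right)
    then show "((\<lambda>p. complex_of_real (K * n p)) has_sum of_real K * of_real (infsum n UNIV)) UNIV"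
      unfolding of_real_mult[of K "infsum n UNIV", symmetric] has_sum_of_real_iff .
  qed
  finally show "(LINT z|normal_plane. exp (expo h z)) =
    of_real (exp (- ((t * \<kappa>\<^sub>1 + u * \<kappa>\<^sub>2) / (2 * h\<^sup>2)))) * of_real (\<Sum>\<^sub>\<infinity>(r, s)\<in>UNIV. nahm_term \<alpha> \<beta> \<gamma> \<mu> a b (h\<^sup>2) r s)"
    unfolding K_def n_def .
  show "(\<lambda>(r, s). nahm_term \<alpha> \<beta> \<gamma> \<mu> a b (h\<^sup>2) r s) summable_on UNIV"
    using abs_summable_summable[OF ns'] unfolding n_def .
qed

end

section \<open>The two leading terms at the cusp 0\<close>

text \<open>
  The expectation of \<open>e\<^sub>2 + e\<^sub>1\<^sup>2 / 2\<close> under the Gaussian measure with covariance \<open>(s, u; u, v)\<close>, where \<open>p0\<close>, \<open>p1\<close>,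
  \<open>p2\<close> and \<open>q0\<close>, \<open>q1\<close>, \<open>q2\<close> stand for the polylogarithms of orders 0, -1, -2 at the two coordinates of the saddle point.
\<close>

definition nahm_c1 :: "real \<Rightarrow> real \<Rightarrow> real \<Rightarrow> real \<Rightarrow> real \<Rightarrow> real \<Rightarrow> real \<Rightarrow> real \<Rightarrow> real \<Rightarrow> real \<Rightarrow> real \<Rightarrow> real \<Rightarrow> real" where
  "nahm_c1 \<mu> a b p0 p1 p2 q0 q1 q2 s u v = (let
     A1 = p0 * (a - 1 / 2); B1 = p1 / 6;
     A2 = q0 * (b / \<mu> - 1 / 2); B2 = q1 / (6 * \<mu>) in
     p0 * (a\<^sup>2 / 2 - a / 2 + 1 / 12) + p1 * (a / 2 - 1 / 4) * s + p2 / 24 * (3 * s\<^sup>2)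
   + q0 * (b\<^sup>2 / (2 * \<mu>) - b / 2 + \<mu> / 12) + q1 * (b / (2 * \<mu>) - 1 / 4) * v + q2 / (24 * \<mu>) * (3 * v\<^sup>2)
   - (A1\<^sup>2 * s + 2 * A1 * B1 * (3 * s\<^sup>2) + B1\<^sup>2 * (15 * s ^ 3) + A2\<^sup>2 * v + 2 * A2 * B2 * (3 * v\<^sup>2) + B2\<^sup>2 * (15 * v ^ 3)
      + 2 * A1 * A2 * u + 2 * A1 * B2 * (3 * u * v) + 2 * B1 * A2 * (3 * s * u) + 2 * B1 * B2 * (9 * s * u * v + 6 * u ^ 3)) / 2)"

abbreviation "nahm_c1_at \<mu> a b x y \<equiv> nahm_c1 \<mu> a b (polylog 0 x) (polylog (-1) x) (polylog (-2) x) (polylog 0 y) (polylog (-1) y) (polylog (-2) y)"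

lemma gauss_expectation_e1:
  assumes "s > 0" "s * v - u\<^sup>2 > 0"
  shows "has_bochner_integral normal_plane (\<lambda>z. qdilog_coeff1 1 a x (fst (gauss_pair s u v z)) + qdilog_coeff1 \<mu> b y (snd (gauss_pair s u v z))) 0"
proof -
  have "has_bochner_integral normal_plane (\<lambda>z. qdilog_coeff1 1 a x (fst (gauss_pair s u v z)) + qdilog_coeff1 \<mu> b y (snd (gauss_pair s u v z)))
     (polylog 0 x * (a / 1 - 1 / 2) * 0 + polylog (-1) x / (6 * 1) * 0 + (polylog 0 y * (b / \<mu> - 1 / 2) * 0 + polylog (-1) y / (6 * \<mu>) * 0))"
    unfolding qdilog_coeff1_def by (intro has_bochner_integral_add has_bochner_integral_mult_right gauss_pair_moments[OF assms])
  then show ?thesis by simp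
qed

lemma gauss_expectation_e2:
  assumes S: "s > 0" "s * v - u\<^sup>2 > 0"
  shows "has_bochner_integral normal_plane (\<lambda>z. qdilog_coeff2 1 a x (fst (gauss_pair s u v z)) + qdilog_coeff2 \<mu> b y (snd (gauss_pair s u v z))
     - (qdilog_coeff1 1 a x (fst (gauss_pair s u v z)) + qdilog_coeff1 \<mu> b y (snd (gauss_pair s u v z)))\<^sup>2 / 2) (nahm_c1_at \<mu> a b x y s u v)"
proof -
  define A1 B1 A2 B2 where AB: "A1 = polylog 0 x * (a - 1 / 2)" "B1 = polylog (-1) x / 6"
    "A2 = polylog 0 y * (b / \<mu> - 1 / 2)" "B2 = polylog (-1) y / (6 * \<mu>)"
  define X Y where "X z = fst (gauss_pair s u v z)" and "Y z = snd (gauss_pair s u v z)" for z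
  note mom = gauss_pair_moments[OF S, folded X_def Y_def]
  interpret prob_space normal_plane by (rule prob_space_normal_plane)
  have one: "has_bochner_integral normal_plane (\<lambda>z. 1 :: real) 1"
    by (simp add: has_bochner_integral_iff prob_space)
  have sq: "(qdilog_coeff1 1 a x (X z) + qdilog_coeff1 \<mu> b y (Y z))\<^sup>2 =
      A1\<^sup>2 * X z ^ 2 + 2 * A1 * B1 * X z ^ 4 + B1\<^sup>2 * X z ^ 6 + A2\<^sup>2 * Y z ^ 2 + 2 * A2 * B2 * Y z ^ 4 + B2\<^sup>2 * Y z ^ 6
      + 2 * A1 * A2 * (X z * Y z) + 2 * A1 * B2 * (X z * Y z ^ 3) + 2 * B1 * A2 * (X z ^ 3 * Y z) + 2 * B1 * B2 * (X z ^ 3 * Y z ^ 3)" for z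
  proof -
    have q: "qdilog_coeff1 1 a x (X z) + qdilog_coeff1 \<mu> b y (Y z) = A1 * X z + B1 * X z ^ 3 + (A2 * Y z + B2 * Y z ^ 3)"
      by (simp add: qdilog_coeff1_def AB)
    show ?thesis unfolding q by (simp add: power2_eq_square power3_eq_cube power4_eq_xxxx eval_nat_numeral(2,3) algebra_simps)
  qed
  define C1 where C: "C1 = polylog 0 x * (a\<^sup>2 / 2 - a / 2 + 1 / 12) + polylog 0 y * (b\<^sup>2 / (2 * \<mu>) - b / 2 + \<mu> / 12)"
  have q2: "qdilog_coeff2 1 a x (X z) + qdilog_coeff2 \<mu> b y (Y z) = C1 * 1 + polylog (-1) x * (a / 2 - 1 / 4) * X z ^ 2 + polylog (-2) x / 24 * X z ^ 4
      + polylog (-1) y * (b / (2 * \<mu>) - 1 / 4) * Y z ^ 2 + polylog (-2) y / (24 * \<mu>) * Y z ^ 4" for z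
    by (simp add: qdilog_coeff2_def C)
  have "has_bochner_integral normal_plane (\<lambda>z. qdilog_coeff2 1 a x (X z) + qdilog_coeff2 \<mu> b y (Y z) - (qdilog_coeff1 1 a x (X z) + qdilog_coeff1 \<mu> b y (Y z))\<^sup>2 / 2)
    (C1 * 1 + polylog (-1) x * (a / 2 - 1 / 4) * s + polylog (-2) x / 24 * (3 * s\<^sup>2)
      + polylog (-1) y * (b / (2 * \<mu>) - 1 / 4) * v + polylog (-2) y / (24 * \<mu>) * (3 * v\<^sup>2)
     - (A1\<^sup>2 * s + 2 * A1 * B1 * (3 * s\<^sup>2) + B1\<^sup>2 * (15 * s ^ 3) + A2\<^sup>2 * v + 2 * A2 * B2 * (3 * v\<^sup>2) + B2\<^sup>2 * (15 * v ^ 3)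
      + 2 * A1 * A2 * u + 2 * A1 * B2 * (3 * u * v) + 2 * B1 * A2 * (3 * s * u) + 2 * B1 * B2 * (9 * s * u * v + 6 * u ^ 3)) / 2)"
    unfolding sq q2
    by (intro has_bochner_integral_add has_bochner_integral_diff has_bochner_integral_mult_right has_bochner_integral_divide_zero one mom)
  then show ?thesis unfolding X_def Y_def nahm_c1_def Let_def C AB by (simp add: algebra_simps)
qed

context nahm_saddle
begin

text \<open>
  On the contour through the saddle point the exponent is \<open>const_part h - Q / 2 + h e\<^sub>1 + h\<^sup>2 e\<^sub>2 + O(h\<^sup>3)\<close>, and \<open>\<delta>\<close> is what
  remains of it without the constant and the quadratic part.
\<close>

definition "Q z = polylog 0 x * (X z)\<^sup>2 + polylog 0 y / \<mu> * (Y z)\<^sup>2"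
definition "e1 z = - \<i> * complex_of_real (qdilog_coeff1 1 a x (X z) + qdilog_coeff1 \<mu> b y (Y z))"
definition "e2 z = complex_of_real (qdilog_coeff2 1 a x (X z) + qdilog_coeff2 \<mu> b y (Y z))"
definition "const_part h = qdilog_const 1 a x h + qdilog_const \<mu> b y h"
definition "\<delta> h z = expo h z - of_real (const_part h) + of_real (Q z / 2)"

lemma x01: "0 < x" "x < 1" and y01: "0 < y" "y < 1"
  using t u by (auto simp: x_def y_def)

lemma poly_bigo_XY: "poly_bigo 0 (\<lambda>h z. of_real (X z))" "poly_bigo 0 (\<lambda>h z. of_real (Y z))"
  unfolding X_def Y_def gauss_pair_def fst_conv snd_conv of_real_mult of_real_add
  by (intro poly_bigo_add poly_bigo_cmult poly_bigo_fst poly_bigo_snd)+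

lemma poly_bigo_e: "poly_bigo 0 (\<lambda>h. e1)" "poly_bigo 0 (\<lambda>h. e2)"
  unfolding e1_def[abs_def] e2_def[abs_def] qdilog_coeff1_def qdilog_coeff2_def of_real_mult of_real_add of_real_power
  by (intro poly_bigo_add poly_bigo_mult0 poly_bigo_power poly_bigo_const poly_bigo_XY)+

lemma poly_bigo_\<delta>: "poly_bigo 3 (\<lambda>h z. \<delta> h z - (of_real h * e1 z + of_real h ^ 2 * e2 z))"
proof (rule poly_bigo_cong[OF poly_bigo_add[OF
      qdilog_poly_bigo[OF t zero_less_one poly_bigo_XY(1), of a]
      qdilog_poly_bigo[OF u \<mu> poly_bigo_XY(2), of b], folded x_def y_def]])
  fix h :: real and z assume h: "h > 0"
  have k: "\<i> * complex_of_real ((\<kappa>\<^sub>1 * X z + \<kappa>\<^sub>2 * Y z) / h)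
      = \<i> * of_real (polylog 1 x * X z / (1 * h)) + \<i> * of_real (polylog 1 y * Y z / (\<mu> * h))"
    by (simp add: \<kappa>\<^sub>1_def \<kappa>\<^sub>2_def add_divide_distrib distrib_left)
  have q: "complex_of_real (Q z / 2) = of_real (polylog 0 x * (X z)\<^sup>2 / (2 * 1)) + of_real (polylog 0 y * (Y z)\<^sup>2 / (2 * \<mu>))"
    by (simp add: Q_def add_divide_distrib)
  show "qdilog (1 * h\<^sup>2) (- complex_of_real t + (\<i> * complex_of_real (h * X z) - complex_of_real (h\<^sup>2 * a))) -
       (complex_of_real (qdilog_const 1 a x h) + \<i> * complex_of_real (polylog 1 x * X z / (1 * h)) - complex_of_real (polylog 0 x * (X z)\<^sup>2 / (2 * 1)) +
         complex_of_real h * (- \<i> * complex_of_real (qdilog_coeff1 1 a x (X z))) + (complex_of_real h)\<^sup>2 * complex_of_real (qdilog_coeff2 1 a x (X z))) +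
       (qdilog (\<mu> * h\<^sup>2) (- complex_of_real u + (\<i> * complex_of_real (h * Y z) - complex_of_real (h\<^sup>2 * b))) -
        (complex_of_real (qdilog_const \<mu> b y h) + \<i> * complex_of_real (polylog 1 y * Y z / (\<mu> * h)) - complex_of_real (polylog 0 y * (Y z)\<^sup>2 / (2 * \<mu>)) +
         complex_of_real h * (- \<i> * complex_of_real (qdilog_coeff1 \<mu> b y (Y z))) + (complex_of_real h)\<^sup>2 * complex_of_real (qdilog_coeff2 \<mu> b y (Y z)))) =
       \<delta> h z - (complex_of_real h * e1 z + (complex_of_real h)\<^sup>2 * e2 z)"
    unfolding \<delta>_def expo_def k q const_part_def e1_def e2_def of_real_add by (simp only: algebra_simps)
qed

text \<open>
  The modulus of the integrand is largest at the origin, where its exponent is real and close to the constant part.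
\<close>

lemma \<delta>_bounded: "\<exists>B. \<forall>\<^sub>F h in at_right 0. \<forall>z. Re (\<delta> h z) - Q z / 2 \<le> B"
proof -
  have he1: "poly_bigo 0 (\<lambda>h z. of_real h * e1 z)" by (intro poly_bigo_mult0 poly_bigo_h0 poly_bigo_e)
  have he2: "poly_bigo 0 (\<lambda>h z. of_real h ^ 2 * e2 z)" by (intro poly_bigo_mult0 poly_bigo_power poly_bigo_h0 poly_bigo_e)
  have "poly_bigo 0 \<delta>"
    by (rule poly_bigo_cong[OF poly_bigo_add[OF poly_bigo_mono[OF poly_bigo_\<delta>] poly_bigo_add[OF he1 he2]]]) auto
  then obtain C N where "C \<ge> 0" and C: "\<forall>\<^sub>F h in at_right 0. 0 < h \<and> h < 1 \<and> (\<forall>z. norm (\<delta> h z) \<le> C * h ^ 0 * poly_weight z ^ N)"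
    by (rule poly_bigoE)
  have "\<forall>\<^sub>F h in at_right 0. \<forall>z. Re (\<delta> h z) - Q z / 2 \<le> C * poly_weight (0,0) ^ N"
    using C eventually_arguments_positive
  proof eventually_elim
    case (elim h)
    have X0: "X (0,0) = 0" "Y (0,0) = 0" by (simp_all add: X_def Y_def gauss_pair_def)
    have h2: "1 * h\<^sup>2 > 0" "\<mu> * h\<^sup>2 > 0" using elim \<mu> by auto
    show ?case
    proof
      fix z
      let ?U = "\<lambda>z. - complex_of_real t + (\<i> * of_real (h * X z) - of_real (h\<^sup>2 * a))"
      let ?V = "\<lambda>z. - complex_of_real u + (\<i> * of_real (h * Y z) - of_real (h\<^sup>2 * b))"
      have U: "Re (qdilog (1 * h\<^sup>2) (?U z)) \<le> Re (qdilog (1 * h\<^sup>2) (?U (0,0)))"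
      proof -
        have "Re (?U z) < 0" using elim by simp
        moreover have "complex_of_real (Re (?U z)) = ?U (0,0)" by (simp add: X0 complex_eq_iff)
        ultimately show ?thesis using Re_qdilog_le[of "?U z", OF _ h2(1)] by (simp only:)
      qed
      have V: "Re (qdilog (\<mu> * h\<^sup>2) (?V z)) \<le> Re (qdilog (\<mu> * h\<^sup>2) (?V (0,0)))"
      proof -
        have "Re (?V z) < 0" using elim by simp
        moreover have "complex_of_real (Re (?V z)) = ?V (0,0)" by (simp add: X0 complex_eq_iff)
        ultimately show ?thesis using Re_qdilog_le[of "?V z", OF _ h2(2)] by (simp only:)
      qed
      have "Re (\<delta> h z) - Q z / 2 \<le> Re (\<delta> h (0,0)) - Q (0,0) / 2"
        using U V by (simp add: \<delta>_def expo_def)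
      also have "\<dots> = Re (\<delta> h (0,0))" by (simp add: Q_def X0)
      also have "\<dots> \<le> norm (\<delta> h (0,0))" by (rule complex_Re_le_cmod)
      also have "\<dots> \<le> C * poly_weight (0,0) ^ N" using elim by (auto dest!: spec[of _ "0::real"])
      finally show "Re (\<delta> h z) - Q z / 2 \<le> C * poly_weight (0,0) ^ N" .
    qed
  qed
  then show ?thesis by blast
qed

lemma Q_nonneg: "Q z \<ge> 0"
  unfolding Q_def polylog_0[OF x01] polylog_0[OF y01] using x01 y01 \<mu> by simp

lemma expo_measurable: "expo h \<in> borel_measurable borel"
  unfolding expo_def[abs_def] qdilog_def by measurable

text \<open>
  Integrating the expansion of the integrand gives \<open>\<kappa> (1 + c\<^sub>1 h\<^sup>2 + O(h\<^sup>3))\<close>: the Gaussian factor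
  \<open>exp (- Q / 2)\<close> changes the covariance to \<open>(s, w; w, v)\<close> and contributes the total mass \<open>\<kappa>\<close>, and the term of
  order \<open>h\<close> vanishes because \<open>e\<^sub>1\<close> is odd.
\<close>

lemma asymptotics:
  assumes S: "s > 0" "s * v - w\<^sup>2 > 0"
    and inv: "v / (s * v - w\<^sup>2) = \<gamma> / (\<alpha> * \<gamma> - \<beta>\<^sup>2) + polylog 0 x" "s / (s * v - w\<^sup>2) = \<alpha> / (\<alpha> * \<gamma> - \<beta>\<^sup>2) + polylog 0 y / \<mu>"
      "w / (s * v - w\<^sup>2) = \<beta> / (\<alpha> * \<gamma> - \<beta>\<^sup>2)"
  shows "\<exists>A B. ((\<lambda>h. ((\<Sum>\<^sub>\<infinity>(r, s)\<in>UNIV. nahm_term \<alpha> \<beta> \<gamma> \<mu> a b (h\<^sup>2) r s) * exp (- A / h\<^sup>2 - B) - 1) / h\<^sup>2)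
    \<longlongrightarrow> nahm_c1_at \<mu> a b x y s w v) (at_right 0)"
proof -
  define c1 where "c1 = nahm_c1_at \<mu> a b x y s w v"
  define E where "E z = exp (- Q z / 2)" for z
  define \<kappa> where "\<kappa> = sqrt ((s * v - w\<^sup>2) / (\<alpha> * \<gamma> - \<beta>\<^sup>2))"
  have \<kappa>: "\<kappa> > 0" using S det by (simp add: \<kappa>_def)
  interpret prob_space normal_plane by (rule prob_space_normal_plane)
  obtain B0 where B0: "\<forall>\<^sub>F h in at_right 0. \<forall>z. Re (\<delta> h z) - Q z / 2 \<le> B0" using \<delta>_bounded by blast
  have main: "poly_bigo 3 (\<lambda>h z. of_real (E z) * (exp (\<delta> h z) - (1 + of_real h * e1 z + of_real h ^ 2 * (e2 z + e1 z ^ 2 / 2))))"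
    unfolding E_def by (rule poly_bigo_exp[OF poly_bigo_e poly_bigo_\<delta> Q_nonneg B0])
  have [measurable]: "Q \<in> borel_measurable borel" unfolding Q_def[abs_def] by measurable
  have [measurable]: "e1 \<in> borel_measurable borel" "e2 \<in> borel_measurable borel"
    unfolding e1_def[abs_def] e2_def[abs_def] qdilog_coeff1_def qdilog_coeff2_def by measurable
  have [measurable]: "E \<in> borel_measurable borel" unfolding E_def[abs_def] by measurable
  note expo_measurable [measurable]
  have [measurable]: "\<delta> h \<in> borel_measurable borel" for h unfolding \<delta>_def[abs_def] by measurable
  obtain C where C: "\<forall>\<^sub>F h in at_right 0. integrable normal_plane (\<lambda>z. of_real (E z) * (exp (\<delta> h z) - (1 + of_real h * e1 z + of_real h ^ 2 * (e2 z + e1 z ^ 2 / 2)))) \<and>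
     norm (LINT z|normal_plane. of_real (E z) * (exp (\<delta> h z) - (1 + of_real h * e1 z + of_real h ^ 2 * (e2 z + e1 z ^ 2 / 2)))) \<le> C * h ^ 3"
    using poly_bigo_integral[OF main] by auto
  have E01: "0 \<le> E z" "E z \<le> 1" for z using Q_nonneg[of z] by (auto simp: E_def)
  have intE: "integrable normal_plane (\<lambda>z. of_real (E z) * f z)" if f: "poly_bigo 0 (\<lambda>h. f)" and m[measurable]: "f \<in> borel_measurable borel" for f :: "real \<times> real \<Rightarrow> complex"
  proof -
    have "poly_bigo 0 (\<lambda>h z. of_real (E z))"
      using E01 by (intro poly_bigoI[of 1 _ 1 _ 0]) auto
    then have "poly_bigo 0 (\<lambda>h z. of_real (E z) * f z)" using f by (rule poly_bigo_mult0)
    from poly_bigo_integral[OF this] have "\<exists>C. \<forall>\<^sub>F h in at_right (0::real). integrable normal_plane (\<lambda>z. of_real (E z) * f z) \<and>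
      norm (LINT z|normal_plane. of_real (E z) * f z) \<le> C * h ^ 0" by simp
    then show ?thesis using eventually_happens'[OF trivial_limit_at_right_real] by blast
  qed
  have tilt: "(LINT z|normal_plane. of_real (E z) * of_real (f (gauss_pair \<alpha> \<beta> \<gamma> z))) = complex_of_real (\<kappa> * (LINT z|normal_plane. f (gauss_pair s w v z)))"
    if f: "f \<in> borel_measurable borel" for f :: "real \<times> real \<Rightarrow> real"
  proof -
    have "(LINT z|normal_plane. of_real (E z) * of_real (f (gauss_pair \<alpha> \<beta> \<gamma> z))) = complex_of_real (LINT z|normal_plane. E z *\<^sub>R f (gauss_pair \<alpha> \<beta> \<gamma> z))"
      by (simp flip: of_real_mult)
    also have "(LINT z|normal_plane. E z *\<^sub>R f (gauss_pair \<alpha> \<beta> \<gamma> z)) = \<kappa> *\<^sub>R (LINT z|normal_plane. f (gauss_pair s w v z))"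
      unfolding E_def Q_def X_def Y_def \<kappa>_def by (rule integral_gauss_pair_tilt[OF f \<alpha> det S inv])
    finally show ?thesis by simp
  qed
  have m1: "(\<lambda>p. qdilog_coeff1 1 a x (fst p) + qdilog_coeff1 \<mu> b y (snd p)) \<in> borel_measurable borel"
    unfolding qdilog_coeff1_def by (intro borel_measurable_continuous_onI continuous_intros)
  have m2: "(\<lambda>p. qdilog_coeff2 1 a x (fst p) + qdilog_coeff2 \<mu> b y (snd p) - (qdilog_coeff1 1 a x (fst p) + qdilog_coeff1 \<mu> b y (snd p))\<^sup>2 / 2) \<in> borel_measurable borel"
    unfolding qdilog_coeff1_def qdilog_coeff2_def by (intro borel_measurable_continuous_onI continuous_intros) auto
  have I0: "(LINT z|normal_plane. of_real (E z) * 1) = complex_of_real \<kappa>"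
    using tilt[of "\<lambda>_. 1"] by (simp add: prob_space)
  have I1: "(LINT z|normal_plane. of_real (E z) * e1 z) = 0"
  proof -
    have "(LINT z|normal_plane. of_real (E z) * e1 z) = (LINT z|normal_plane. - \<i> * (of_real (E z) * of_real (qdilog_coeff1 1 a x (X z) + qdilog_coeff1 \<mu> b y (Y z))))"
      by (simp only: e1_def mult_ac)
    also have "\<dots> = - \<i> * (LINT z|normal_plane. of_real (E z) * of_real (qdilog_coeff1 1 a x (X z) + qdilog_coeff1 \<mu> b y (Y z)))"
      by (rule integral_mult_right_zero)
    also have "(LINT z|normal_plane. complex_of_real (E z) * of_real (qdilog_coeff1 1 a x (X z) + qdilog_coeff1 \<mu> b y (Y z))) = 0"
      using tilt[OF m1] has_bochner_integral_integral_eq[OF gauss_expectation_e1[OF S, of a x \<mu> b y]] by (simp only: X_def Y_def mult_zero_right of_real_0)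
    finally show ?thesis by simp
  qed
  have I2: "(LINT z|normal_plane. of_real (E z) * (e2 z + e1 z ^ 2 / 2)) = of_real (\<kappa> * c1)"
  proof -
    have "e2 z + e1 z ^ 2 / 2 = of_real (qdilog_coeff2 1 a x (X z) + qdilog_coeff2 \<mu> b y (Y z) - (qdilog_coeff1 1 a x (X z) + qdilog_coeff1 \<mu> b y (Y z))\<^sup>2 / 2)" for z
      by (simp add: e1_def e2_def power_mult_distrib)
    then show ?thesis
      using tilt[OF m2] has_bochner_integral_integral_eq[OF gauss_expectation_e2[OF S, of a x \<mu> b y]] by (simp only: X_def Y_def c1_def)
  qed
  define F where "F h = (\<Sum>\<^sub>\<infinity>(r, s)\<in>UNIV. nahm_term \<alpha> \<beta> \<gamma> \<mu> a b (h\<^sup>2) r s)" for h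
  define A where "A = (t * \<kappa>\<^sub>1 + u * \<kappa>\<^sub>2) / 2 + polylog 2 x + polylog 2 y / \<mu>"
  define B where "B = polylog 1 x * (1 / 2 - a) + polylog 1 y * (1 / 2 - b / \<mu>) + ln \<kappa>"
  have bound: "\<forall>\<^sub>F h in at_right 0. norm ((F h * exp (- A / h\<^sup>2 - B) - 1) / h\<^sup>2 - c1) \<le> C / \<kappa> * h"
    using C eventually_arguments_positive eventually_at_right_01
  proof eventually_elim
    case (elim h)
    then have h: "h > 0" by simp
    let ?r = "\<lambda>z. complex_of_real (E z) * (exp (\<delta> h z) - (1 + of_real h * e1 z + of_real h ^ 2 * (e2 z + e1 z ^ 2 / 2)))"
    have ir: "integrable normal_plane ?r" and nr: "norm (LINT z|normal_plane. ?r z) \<le> C * h ^ 3" using elim by auto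
    have split: "exp (expo h z) * of_real (exp (- const_part h)) = ?r z + (of_real (E z) * 1 + of_real h * (of_real (E z) * e1 z) + of_real h ^ 2 * (of_real (E z) * (e2 z + e1 z ^ 2 / 2)))" for z
    proof -
      have "of_real (E z) * exp (\<delta> h z) = exp (expo h z) * of_real (exp (- const_part h))"
        unfolding E_def exp_of_real[symmetric] exp_add[symmetric] \<delta>_def by simp
      then show ?thesis by (simp only: algebra_simps)
    qed
    have i0: "integrable normal_plane (\<lambda>z. complex_of_real (E z) * 1)" by (rule intE) (auto intro: poly_bigo_const)
    have i1: "integrable normal_plane (\<lambda>z. complex_of_real (E z) * e1 z)" by (rule intE) (auto intro: poly_bigo_e)
    have i2: "integrable normal_plane (\<lambda>z. complex_of_real (E z) * (e2 z + e1 z ^ 2 / 2))"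
    proof (rule intE)
      have "poly_bigo 0 (\<lambda>h z. e2 z + 1 / 2 * e1 z ^ 2)" by (intro poly_bigo_add poly_bigo_cmult poly_bigo_power poly_bigo_e)
      then show "poly_bigo 0 (\<lambda>h z. e2 z + e1 z ^ 2 / 2)" by simp
    qed measurable
    have "(LINT z|normal_plane. exp (expo h z)) * of_real (exp (- const_part h)) = (LINT z|normal_plane. exp (expo h z) * of_real (exp (- const_part h)))"
      by (rule integral_mult_left_zero[symmetric])
    also have "\<dots> = (LINT z|normal_plane. ?r z) + (complex_of_real \<kappa> + of_real h * 0 + of_real h ^ 2 * of_real (\<kappa> * c1))"
      unfolding split
      using ir i0 i1 i2 I0 I1 I2 by (simp only: Bochner_Integration.integral_add integral_mult_right_zero
        integrable_mult_right Bochner_Integration.integrable_add)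
    finally have eq: "(LINT z|normal_plane. exp (expo h z)) * of_real (exp (- const_part h)) - of_real (\<kappa> * (1 + h\<^sup>2 * c1)) = (LINT z|normal_plane. ?r z)"
      by (simp add: algebra_simps)
    have "(LINT z|normal_plane. exp (expo h z)) * of_real (exp (- const_part h)) = of_real (\<kappa> * (F h * exp (- A / h\<^sup>2 - B)))"
    proof -
      have "exp (- ((t * \<kappa>\<^sub>1 + u * \<kappa>\<^sub>2) / (2 * h\<^sup>2))) * exp (- const_part h) = exp (- A / h\<^sup>2 - B + ln \<kappa>)"
        unfolding exp_add[symmetric] A_def B_def const_part_def qdilog_const_def by (simp add: add_divide_distrib diff_divide_distrib)
      also have "\<dots> = \<kappa> * exp (- A / h\<^sup>2 - B)" using \<kappa> by (simp only: exp_add exp_ln mult.commute)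
      finally have fin: "exp (- ((t * \<kappa>\<^sub>1 + u * \<kappa>\<^sub>2) / (2 * h\<^sup>2))) * F h * exp (- const_part h) = \<kappa> * (F h * exp (- A / h\<^sup>2 - B))"
        by (simp only: mult_ac)
      show ?thesis
        unfolding integral_representation(1)[OF h elim(2,3)] F_def[symmetric] of_real_mult[symmetric] fin ..
    qed
    with eq have "complex_of_real (\<kappa> * (F h * exp (- A / h\<^sup>2 - B)) - \<kappa> * (1 + h\<^sup>2 * c1)) = (LINT z|normal_plane. ?r z)"
      by (simp only: of_real_diff)
    then have "\<bar>\<kappa> * (F h * exp (- A / h\<^sup>2 - B)) - \<kappa> * (1 + h\<^sup>2 * c1)\<bar> \<le> C * h ^ 3"
      using nr by (metis norm_of_real)
    moreover have "\<kappa> * (F h * exp (- A / h\<^sup>2 - B)) - \<kappa> * (1 + h\<^sup>2 * c1) = (\<kappa> * h\<^sup>2) * ((F h * exp (- A / h\<^sup>2 - B) - 1) / h\<^sup>2 - c1)"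
      using h by (simp add: field_simps)
    ultimately have "(\<kappa> * h\<^sup>2) * \<bar>(F h * exp (- A / h\<^sup>2 - B) - 1) / h\<^sup>2 - c1\<bar> \<le> C * h ^ 3"
      using h \<kappa> by (simp add: abs_mult)
    then have "\<bar>(F h * exp (- A / h\<^sup>2 - B) - 1) / h\<^sup>2 - c1\<bar> \<le> C * h ^ 3 / (\<kappa> * h\<^sup>2)"
      using h \<kappa> by (simp add: pos_le_divide_eq mult.commute)
    also have "\<dots> = C / \<kappa> * h" using h by (simp add: power2_eq_square power3_eq_cube)
    finally show ?case by simp
  qed
  have "((\<lambda>h. C / \<kappa> * h) \<longlongrightarrow> C / \<kappa> * 0) (at_right 0)" by (intro tendsto_intros)
  then have "((\<lambda>h. (F h * exp (- A / h\<^sup>2 - B) - 1) / h\<^sup>2 - c1) \<longlongrightarrow> 0) (at_right 0)"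
    by (intro Lim_null_comparison[OF bound]) simp
  then have "((\<lambda>h. (F h * exp (- A / h\<^sup>2 - B) - 1) / h\<^sup>2) \<longlongrightarrow> c1) (at_right 0)"
    by (rule LIM_zero_cancel)
  then show ?thesis unfolding F_def c1_def by blast
qed

end

section \<open>Modular functions near the cusp 0\<close>

text \<open>
  The difference quotient of \<open>P\<close> at 0 stays bounded, and \<open>exp (- K / h\<^sup>2)\<close> is small compared with \<open>h\<^sup>2\<close>.
\<close>

lemma analytic_remainder:
  fixes P :: "complex \<Rightarrow> complex" and K :: real
  assumes "P holomorphic_on cball 0 r" "r > 0" "K > 0"
  shows "((\<lambda>h. (P (of_real (exp (- K / h\<^sup>2))) - P 0) / of_real (h\<^sup>2)) \<longlongrightarrow> 0) (at_right 0)"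
proof -
  have "P field_differentiable at 0"
    using assms(1,2) holomorphic_on_imp_differentiable_at[of P "ball 0 r" 0] by (simp add: holomorphic_on_subset)
  then obtain D where "(P has_field_derivative D) (at 0)" unfolding field_differentiable_def by blast
  then have d: "((\<lambda>w. (P w - P 0) / w) \<longlongrightarrow> D) (at 0)" by (simp add: has_field_derivative_iff)
  have w: "((\<lambda>h::real. exp (- K / h\<^sup>2)) \<longlongrightarrow> 0) (at_right 0)" using assms(3) by real_asymp
  have "filterlim (\<lambda>h. complex_of_real (exp (- K / h\<^sup>2))) (at 0) (at_right 0)"
    using tendsto_of_real[OF w, where 'a = complex] by (intro filterlim_atI) auto
  from filterlim_compose[OF d this]
  have 1: "((\<lambda>h. (P (of_real (exp (- K / h\<^sup>2))) - P 0) / of_real (exp (- K / h\<^sup>2))) \<longlongrightarrow> D) (at_right 0)" .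
  have "((\<lambda>h::real. exp (- K / h\<^sup>2) / h\<^sup>2) \<longlongrightarrow> 0) (at_right 0)" using assms(3) by real_asymp
  from tendsto_mult[OF 1 tendsto_of_real[OF this, where 'a = complex]]
  show ?thesis by simp
qed

text \<open>
  Near 0 the function \<open>G\<close> is \<open>w\<^sup>n P(w)\<close> with \<open>P\<close> holomorphic and \<open>P(0) \<noteq> 0\<close>. At \<open>w = exp (- K / h\<^sup>2)\<close> the power \<open>w\<^sup>n\<close>
  is a pure exponential in \<open>1 / h\<^sup>2\<close>, which has to cancel \<open>exp (- A / h\<^sup>2)\<close> for the limit 1 to exist; what is
  left is \<open>P(w) exp (- B)\<close>, whose distance from its limit is smaller than every power of \<open>h\<close>.
\<close>

lemma cusp_expansion_no_linear_term:
  fixes G :: "complex \<Rightarrow> complex" and f :: "real \<Rightarrow> real" and K A B c1 :: real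
  assumes G: "G meromorphic_on {0}" and K: "K > 0"
    and fG: "\<forall>\<^sub>F h in at_right 0. complex_of_real (f h) = G (of_real (exp (- K / h\<^sup>2)))"
    and lim: "((\<lambda>h. (f h * exp (- A / h\<^sup>2 - B) - 1) / h\<^sup>2) \<longlongrightarrow> c1) (at_right 0)"
  shows "c1 = 0"
proof -
  have h2: "((\<lambda>h::real. h\<^sup>2) \<longlongrightarrow> 0\<^sup>2) (at_right 0)" by (intro tendsto_intros)
  have "((\<lambda>h. (f h * exp (- A / h\<^sup>2 - B) - 1) / h\<^sup>2 * h\<^sup>2) \<longlongrightarrow> c1 * 0\<^sup>2) (at_right 0)"
    by (rule tendsto_mult[OF lim h2])
  then have "((\<lambda>h. (f h * exp (- A / h\<^sup>2 - B) - 1) / h\<^sup>2 * h\<^sup>2 + 1) \<longlongrightarrow> c1 * 0\<^sup>2 + 1) (at_right 0)"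
    by (rule tendsto_add[OF _ tendsto_const])
  moreover have "\<forall>\<^sub>F h in at_right 0. (f h * exp (- A / h\<^sup>2 - B) - 1) / h\<^sup>2 * h\<^sup>2 + 1 = f h * exp (- A / h\<^sup>2 - B)"
    using eventually_at_right_01 by eventually_elim simp
  ultimately have "((\<lambda>h. f h * exp (- A / h\<^sup>2 - B)) \<longlongrightarrow> c1 * 0\<^sup>2 + 1) (at_right 0)"
    by (rule Lim_transform_eventually)
  then have \<Phi>: "((\<lambda>h. f h * exp (- A / h\<^sup>2 - B)) \<longlongrightarrow> 1) (at_right 0)" by simp
  have w: "((\<lambda>h::real. exp (- K / h\<^sup>2)) \<longlongrightarrow> 0) (at_right 0)" using K by real_asymp
  have wlim: "filterlim (\<lambda>h. complex_of_real (exp (- K / h\<^sup>2))) (at 0) (at_right 0)"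
    using tendsto_of_real[OF w, where 'a = complex] by (intro filterlim_atI) auto
  have iso: "isolated_singularity_at G 0" "not_essential G 0"
    using G by (auto simp: meromorphic_on_isolated_singularity meromorphic_on_not_essential)
  have freq: "\<exists>\<^sub>Fw in at 0. G w \<noteq> 0"
  proof (rule ccontr)
    assume "\<not> (\<exists>\<^sub>Fw in at 0. G w \<noteq> 0)"
    then have "\<forall>\<^sub>F w in at 0. G w = 0" by (simp add: frequently_def)
    then have "\<forall>\<^sub>F h in at_right 0. G (of_real (exp (- K / h\<^sup>2))) = 0"
      using wlim by (rule eventually_compose_filterlim)
    moreover have "\<forall>\<^sub>F h in at_right 0. f h * exp (- A / h\<^sup>2 - B) > 0"
      using order_tendstoD(1)[OF \<Phi>, of 0] by simp
    ultimately have "\<forall>\<^sub>F h in at_right (0::real). False" using fG by eventually_elim auto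
    then show False by simp
  qed
  obtain n P r where r: "r > 0" and P0: "P 0 \<noteq> 0" and P: "P holomorphic_on cball 0 r"
    and GP: "\<forall>w\<in>cball 0 r - {0}. G w = P w * (w - 0) powi n \<and> P w \<noteq> 0"
    using zorder_exist[OF iso freq] by blast
  have "\<forall>\<^sub>F w in at 0. w \<in> cball 0 r - {0 :: complex}"
    using r by (auto simp: eventually_at intro!: exI[of _ r])
  then have ev: "\<forall>\<^sub>F h in at_right 0. complex_of_real (exp (- K / h\<^sup>2)) \<in> cball 0 r - {0}"
    using wlim by (rule eventually_compose_filterlim)
  define L where "L = K * of_int n + A"
  define p where "p h = P (of_real (exp (- K / h\<^sup>2))) * of_real (exp (- B))" for h :: real
  have key: "\<forall>\<^sub>F h in at_right 0. complex_of_real (f h * exp (- A / h\<^sup>2 - B)) = p h * of_real (exp (- L / h\<^sup>2))"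
    using fG ev
  proof eventually_elim
    case (elim h)
    have pw: "complex_of_real (exp (- K / h\<^sup>2)) powi n = of_real (exp (- (K * of_int n) / h\<^sup>2))"
    proof -
      have "complex_of_real (exp (- K / h\<^sup>2)) powi n = of_real (exp (- K / h\<^sup>2) powi n)" by simp
      also have "exp (- K / h\<^sup>2) powi n = exp (of_int n * (- K / h\<^sup>2))" by (rule exp_power_int)
      also have "of_int n * (- K / h\<^sup>2) = - (K * of_int n) / h\<^sup>2" by simp
      finally show ?thesis .
    qed
    have "complex_of_real (f h) = P (of_real (exp (- K / h\<^sup>2))) * of_real (exp (- (K * of_int n) / h\<^sup>2))"
      using elim GP pw by simp
    moreover have "exp (- (K * of_int n) / h\<^sup>2) * exp (- A / h\<^sup>2 - B) = exp (- B) * exp (- L / h\<^sup>2)"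
      unfolding exp_add[symmetric] L_def by (simp add: add_divide_distrib diff_divide_distrib)
    ultimately show ?case
      unfolding p_def of_real_mult by (metis (no_types, opaque_lifting) mult.assoc of_real_mult)
  qed
  have plim: "(p \<longlongrightarrow> P 0 * of_real (exp (- B))) (at_right 0)"
  proof -
    have "isCont P 0"
      using holomorphic_on_imp_continuous_on[OF P] r by (intro continuous_on_interior[of "cball 0 r"]) auto
    then have "(P \<longlongrightarrow> P 0) (at 0)" by (simp add: isCont_def)
    from filterlim_compose[OF this wlim] show ?thesis unfolding p_def[abs_def] by (intro tendsto_intros)
  qed
  have p0: "P 0 * of_real (exp (- B)) \<noteq> 0" using P0 by simp
  have \<Phi>c: "((\<lambda>h. p h * of_real (exp (- L / h\<^sup>2))) \<longlongrightarrow> 1) (at_right 0)"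
    using tendsto_of_real[OF \<Phi>, where 'a = complex] key by (simp add: tendsto_cong)
  have L: "L = 0"
  proof (rule ccontr)
    assume "L \<noteq> 0"
    then consider "L > 0" | "L < 0" by linarith
    then show False
    proof cases
      case 1
      then have "((\<lambda>h::real. exp (- L / h\<^sup>2)) \<longlongrightarrow> 0) (at_right 0)" by real_asymp
      from tendsto_mult[OF plim tendsto_of_real[OF this, where 'a = complex]]
      have "((\<lambda>h. p h * of_real (exp (- L / h\<^sup>2))) \<longlongrightarrow> 0) (at_right 0)" by simp
      then show False using tendsto_unique[OF _ \<Phi>c] by fastforce
    next
      case 2
      then have "((\<lambda>h::real. exp (L / h\<^sup>2)) \<longlongrightarrow> 0) (at_right 0)" by real_asymp
      from tendsto_mult[OF \<Phi>c tendsto_of_real[OF this, where 'a = complex]]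
      have lim2: "((\<lambda>h. p h * of_real (exp (- L / h\<^sup>2)) * of_real (exp (L / h\<^sup>2))) \<longlongrightarrow> 0) (at_right 0)" by simp
      have cancel: "p h * of_real (exp (- L / h\<^sup>2)) * of_real (exp (L / h\<^sup>2)) = p h" for h
        by (simp add: mult.assoc of_real_mult[symmetric] exp_add[symmetric] del: of_real_mult)
      have "(p \<longlongrightarrow> 0) (at_right 0)" using lim2 unfolding cancel .
      then show False using tendsto_unique[OF _ plim] p0 by fastforce
    qed
  qed
  have P1: "P 0 * of_real (exp (- B)) = 1"
    using tendsto_unique[OF _ plim] \<Phi>c unfolding L by fastforce
  have "((\<lambda>h. (P (of_real (exp (- K / h\<^sup>2))) - P 0) / of_real (h\<^sup>2) * of_real (exp (- B))) \<longlongrightarrow> 0 * of_real (exp (- B))) (at_right 0)"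
    by (intro tendsto_intros analytic_remainder[OF P r K])
  moreover have "\<forall>\<^sub>F h in at_right 0. (P (of_real (exp (- K / h\<^sup>2))) - P 0) / of_real (h\<^sup>2) * of_real (exp (- B))
      = complex_of_real ((f h * exp (- A / h\<^sup>2 - B) - 1) / h\<^sup>2)"
    using key
  proof eventually_elim
    case (elim h)
    have "complex_of_real ((f h * exp (- A / h\<^sup>2 - B) - 1) / h\<^sup>2) = (complex_of_real (f h * exp (- A / h\<^sup>2 - B)) - 1) / of_real (h\<^sup>2)"
      by (simp only: of_real_divide of_real_diff of_real_1)
    also have "\<dots> = (P (of_real (exp (- K / h\<^sup>2))) * of_real (exp (- B)) - P 0 * of_real (exp (- B))) / of_real (h\<^sup>2)"
      unfolding elim P1 L p_def by simp
    also have "\<dots> = (P (of_real (exp (- K / h\<^sup>2))) - P 0) / of_real (h\<^sup>2) * of_real (exp (- B))"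
      by (simp only: left_diff_distrib times_divide_eq_left)
    finally show ?case by (rule sym)
  qed
  ultimately have "((\<lambda>h. complex_of_real ((f h * exp (- A / h\<^sup>2 - B) - 1) / h\<^sup>2)) \<longlongrightarrow> 0 * of_real (exp (- B))) (at_right 0)"
    by (rule Lim_transform_eventually)
  then have "((\<lambda>h. complex_of_real ((f h * exp (- A / h\<^sup>2 - B) - 1) / h\<^sup>2)) \<longlongrightarrow> 0) (at_right 0)"
    by (simp only: mult_zero_left)
  then have "complex_of_real c1 = 0"
    using tendsto_of_real[OF lim, where 'a = complex] tendsto_unique trivial_limit_at_right_real by blast
  then show ?thesis by simp
qed

text \<open>
  The matrix \<open>S\<close> acts by \<open>\<tau> \<mapsto> - 1 / \<tau>\<close>, so it takes \<open>2 \<pi> i / h\<^sup>2\<close> to \<open>i h\<^sup>2 / (2 \<pi>)\<close>, where \<open>q = exp (- h\<^sup>2)\<close>.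
\<close>

lemma modular_function_at_zero:
  assumes "meromorphic_modular_function g"
  obtains G and K :: real where "G meromorphic_on {0}" "K > 0"
    "\<forall>\<^sub>F h in at_right 0. g (\<i> * of_real (h\<^sup>2 / (2 * pi))) = G (of_real (exp (- K / h\<^sup>2)))"
proof -
  define S :: "int^2^2" where "S = vector [vector [0, - 1], vector [1, 0]]"
  have S: "S $ 1 $ 1 = 0" "S $ 1 $ 2 = - 1" "S $ 2 $ 1 = 1" "S $ 2 $ 2 = 0"
    by (simp_all add: S_def)
  have "S \<in> carrier SL2Z" by (simp add: SL2Z_def det_2 S)
  then obtain N G y where N: "N \<ge> (1::nat)" and G: "G meromorphic_on {0}"
    and gG: "\<forall>\<tau>\<in>upper_half_plane. Im \<tau> > y \<longrightarrow> g (moebius_act S \<tau>) = G (exp (2 * of_real pi * \<i> * \<tau> / of_nat N))"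
    using assms unfolding meromorphic_modular_function_def meromorphic_at_cusps_def by blast
  define K where "K = 4 * pi\<^sup>2 / real N"
  have K: "K > 0" using N by (simp add: K_def)
  have "filterlim (\<lambda>h::real. 2 * pi / h\<^sup>2) at_top (at_right 0)" by real_asymp
  then have "\<forall>\<^sub>F h in at_right 0. 2 * pi / h\<^sup>2 > y" by (simp add: filterlim_at_top_dense)
  then have "\<forall>\<^sub>F h in at_right 0. g (\<i> * of_real (h\<^sup>2 / (2 * pi))) = G (of_real (exp (- K / h\<^sup>2)))"
    using eventually_at_right_01
  proof eventually_elim
    case (elim h)
    define \<tau> where "\<tau> = \<i> * complex_of_real (2 * pi / h\<^sup>2)"
    have "\<tau> \<in> upper_half_plane" "Im \<tau> > y" using elim by (auto simp: \<tau>_def upper_half_plane_def)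
    then have "g (moebius_act S \<tau>) = G (exp (2 * of_real pi * \<i> * \<tau> / of_nat N))" using gG by blast
    moreover have "moebius_act S \<tau> = \<i> * of_real (h\<^sup>2 / (2 * pi))"
      using elim by (simp add: moebius_act_def S \<tau>_def field_simps)
    moreover have "exp (2 * of_real pi * \<i> * \<tau> / of_nat N) = of_real (exp (- K / h\<^sup>2))"
    proof -
      have "2 * of_real pi * \<i> * \<tau> / of_nat N = complex_of_real (- K / h\<^sup>2)"
        by (simp add: \<tau>_def K_def power2_eq_square)
      then show ?thesis by (simp only: exp_of_real)
    qed
    ultimately show ?case by simp
  qed
  then show ?thesis using that G K by blast
qed

lemma (in nahm_saddle) nahm_sum_on_imaginary_axis:
  assumes M: "\<And>r s. nahm_exponent M m a b r s = (\<alpha> * real r ^ 2 + 2 * \<beta> * real r * real s + \<gamma> * real s ^ 2) / 2 + a * real r + b * real s"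
    and m: "\<mu> = real m"
  shows "\<forall>\<^sub>F h in at_right 0. nahm_sum M m a b c (\<i> * of_real (h\<^sup>2 / (2 * pi))) =
    of_real (exp (- (c * h\<^sup>2)) * (\<Sum>\<^sub>\<infinity>(r, s)\<in>UNIV. nahm_term \<alpha> \<beta> \<gamma> \<mu> a b (h\<^sup>2) r s))"
proof -
  show ?thesis using eventually_at_right_01 eventually_arguments_positive
  proof eventually_elim
    case (elim h)
    define \<tau> where "\<tau> = \<i> * complex_of_real (h\<^sup>2 / (2 * pi))"
    have qp: "q_power \<tau> k = of_real (exp (- (h\<^sup>2 * k)))" for k
    proof -
      have "2 * of_real pi * \<i> * of_real k * \<tau> = complex_of_real (- (h\<^sup>2 * k))"
        by (simp add: \<tau>_def complex_eq_iff)
      then show ?thesis unfolding q_power_def by (simp only: exp_of_real)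
    qed
    have poch: "q_pochhammer (of_real q) (of_real q) n = of_real (qfact q n)" for q n
      by (simp add: q_pochhammer_def qfact_def)
    have q: "q_power \<tau> 1 = of_real (exp (- h\<^sup>2))" "q_power \<tau> 1 ^ m = of_real (exp (- (\<mu> * h\<^sup>2)))"
      unfolding qp by (simp_all add: m exp_of_nat_mult[symmetric] flip: of_real_power)
    have trm: "(\<lambda>(r, s). q_power \<tau> (nahm_exponent M m a b r s) / (q_pochhammer (q_power \<tau> 1) (q_power \<tau> 1) r * q_pochhammer (q_power \<tau> 1 ^ m) (q_power \<tau> 1 ^ m) s))
      = (\<lambda>p. complex_of_real ((\<lambda>(r, s). nahm_term \<alpha> \<beta> \<gamma> \<mu> a b (h\<^sup>2) r s) p))"
      unfolding q(2) unfolding q(1) poch qp M nahm_term_def by (auto simp: fun_eq_iff)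
    have h: "h > 0" using elim by simp
    have "((\<lambda>(r, s). nahm_term \<alpha> \<beta> \<gamma> \<mu> a b (h\<^sup>2) r s) has_sum (\<Sum>\<^sub>\<infinity>(r, s)\<in>UNIV. nahm_term \<alpha> \<beta> \<gamma> \<mu> a b (h\<^sup>2) r s)) UNIV"
      using integral_representation(2)[OF h elim(2,3)] by (rule has_sum_infsum)
    then have "((\<lambda>p. complex_of_real ((\<lambda>(r, s). nahm_term \<alpha> \<beta> \<gamma> \<mu> a b (h\<^sup>2) r s) p)) has_sum
        of_real (\<Sum>\<^sub>\<infinity>(r, s)\<in>UNIV. nahm_term \<alpha> \<beta> \<gamma> \<mu> a b (h\<^sup>2) r s)) UNIV"
      unfolding has_sum_of_real_iff .
    then have "infsum (\<lambda>p. complex_of_real ((\<lambda>(r, s). nahm_term \<alpha> \<beta> \<gamma> \<mu> a b (h\<^sup>2) r s) p)) UNIV =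
        of_real (\<Sum>\<^sub>\<infinity>(r, s)\<in>UNIV. nahm_term \<alpha> \<beta> \<gamma> \<mu> a b (h\<^sup>2) r s)" by (rule infsumI)
    then show ?case
      unfolding \<tau>_def[symmetric] nahm_sum_def Let_def trm qp[of c] by (simp only: of_real_mult mult.commute)
  qed
qed

text \<open>
  The factor \<open>q\<^sup>c = exp (- c h\<^sup>2)\<close> shifts the coefficient of \<open>h\<^sup>2\<close> by \<open>- c\<close>.
\<close>

lemma (in nahm_saddle) modular_imp_c1_eq:
  assumes M: "\<And>r s. nahm_exponent M m a b r s = (\<alpha> * real r ^ 2 + 2 * \<beta> * real r * real s + \<gamma> * real s ^ 2) / 2 + a * real r + b * real s"
    and m: "\<mu> = real m"
    and S: "s > 0" "s * v - w\<^sup>2 > 0"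
    and inv: "v / (s * v - w\<^sup>2) = \<gamma> / (\<alpha> * \<gamma> - \<beta>\<^sup>2) + polylog 0 x" "s / (s * v - w\<^sup>2) = \<alpha> / (\<alpha> * \<gamma> - \<beta>\<^sup>2) + polylog 0 y / \<mu>"
      "w / (s * v - w\<^sup>2) = \<beta> / (\<alpha> * \<gamma> - \<beta>\<^sup>2)"
    and mod: "meromorphic_modular_function (nahm_sum M m a b c)"
  shows "nahm_c1_at \<mu> a b x y s w v = c"
proof -
  define F where "F h = (\<Sum>\<^sub>\<infinity>(r, s)\<in>UNIV. nahm_term \<alpha> \<beta> \<gamma> \<mu> a b (h\<^sup>2) r s)" for h
  obtain A B where AB: "((\<lambda>h. (F h * exp (- A / h\<^sup>2 - B) - 1) / h\<^sup>2) \<longlongrightarrow> nahm_c1_at \<mu> a b x y s w v) (at_right 0)"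
    using asymptotics[OF S inv] unfolding F_def by blast
  obtain G K where G: "G meromorphic_on {0}" "K > 0"
    and gG: "\<forall>\<^sub>F h in at_right 0. nahm_sum M m a b c (\<i> * of_real (h\<^sup>2 / (2 * pi))) = G (of_real (exp (- K / h\<^sup>2)))"
    by (rule modular_function_at_zero[OF mod])
  have fG: "\<forall>\<^sub>F h in at_right 0. complex_of_real (exp (- (c * h\<^sup>2)) * F h) = G (of_real (exp (- K / h\<^sup>2)))"
    using gG nahm_sum_on_imaginary_axis[OF M m, of c] unfolding F_def by eventually_elim simp
  have e1: "((\<lambda>h::real. exp (- (c * h\<^sup>2))) \<longlongrightarrow> exp (- (c * 0\<^sup>2))) (at_right 0)" by (intro tendsto_intros)
  have e2: "((\<lambda>h::real. (exp (- (c * h\<^sup>2)) - 1) / h\<^sup>2) \<longlongrightarrow> - c) (at_right 0)" by real_asymp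
  have "((\<lambda>h. exp (- (c * h\<^sup>2)) * ((F h * exp (- A / h\<^sup>2 - B) - 1) / h\<^sup>2) + (exp (- (c * h\<^sup>2)) - 1) / h\<^sup>2) \<longlongrightarrow>
      exp (- (c * 0\<^sup>2)) * nahm_c1_at \<mu> a b x y s w v + - c) (at_right 0)"
    by (intro tendsto_add tendsto_mult e1 e2 AB)
  moreover have "exp (- (c * h\<^sup>2)) * ((F h * exp (- A / h\<^sup>2 - B) - 1) / h\<^sup>2) + (exp (- (c * h\<^sup>2)) - 1) / h\<^sup>2 =
      ((exp (- (c * h\<^sup>2)) * F h) * exp (- A / h\<^sup>2 - B) - 1) / h\<^sup>2" for h
    by (simp add: add_divide_distrib[symmetric] right_diff_distrib)
  ultimately have "((\<lambda>h. ((exp (- (c * h\<^sup>2)) * F h) * exp (- A / h\<^sup>2 - B) - 1) / h\<^sup>2) \<longlongrightarrow> nahm_c1_at \<mu> a b x y s w v - c) (at_right 0)"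
    by simp
  from cusp_expansion_no_linear_term[OF G fG this] show ?thesis by simp
qed

section \<open>Binary quadratic forms without rational points\<close>

text \<open>
  Infinite descent on a common denominator: if \<open>X\<^sup>2 - k Y\<^sup>2 = n Z\<^sup>2\<close>, then \<open>p\<close> divides \<open>X\<close> and \<open>Y\<close>, so \<open>p\<^sup>2\<close> divides \<open>n Z\<^sup>2\<close>,
  and as \<open>p\<close> divides \<open>n\<close> only once, it divides \<open>Z\<close> as well.
\<close>

lemma quadratic_form_no_rational_zero:
  fixes k n p :: int and x y :: real
  assumes p: "prime p" and res: "\<And>x y. p dvd x\<^sup>2 - k * y\<^sup>2 \<Longrightarrow> p dvd x \<and> p dvd y"
    and n: "p dvd n" "\<not> p\<^sup>2 dvd n" and xy: "x \<in> \<rat>" "y \<in> \<rat>"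
  shows "x\<^sup>2 - of_int k * y\<^sup>2 \<noteq> of_int n"
proof
  assume eq: "x\<^sup>2 - of_int k * y\<^sup>2 = of_int n"
  have desc: False if "X\<^sup>2 - k * Y\<^sup>2 = n * Z\<^sup>2" "Z \<noteq> 0" for X Y Z :: int
    using that
  proof (induction "nat \<bar>Z\<bar>" arbitrary: X Y Z rule: less_induct)
    case less
    have p0: "p > 1" using p by (rule prime_gt_1_int)
    have "p dvd X \<and> p dvd Y" using res[of X Y] n(1) less.prems by simp
    then obtain X' Y' where X: "X = p * X'" and Y: "Y = p * Y'" by (auto elim!: dvdE)
    obtain n' where n': "n = p * n'" using n(1) by (elim dvdE)
    have "\<not> p dvd n'" using n(2) unfolding n' power2_eq_square by auto
    have "p * (p * (X'\<^sup>2 - k * Y'\<^sup>2)) = p * (n' * Z\<^sup>2)"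
      using less.prems(1) unfolding X Y n' by (simp add: power2_eq_square algebra_simps)
    then have e: "p * (X'\<^sup>2 - k * Y'\<^sup>2) = n' * Z\<^sup>2" using p0 by simp
    then have "p dvd n' * Z\<^sup>2" by (metis dvd_triv_left)
    then have "p dvd Z\<^sup>2" using p \<open>\<not> p dvd n'\<close> by (simp add: prime_dvd_mult_iff)
    then have "p dvd Z" using p by (rule prime_dvd_power[rotated])
    then obtain Z' where Z: "Z = p * Z'" by (elim dvdE)
    have Z'0: "Z' \<noteq> 0" using less.prems(2) Z by auto
    have "p * (X'\<^sup>2 - k * Y'\<^sup>2) = p * (n * Z'\<^sup>2)"
      using e unfolding Z n' by (simp add: power2_eq_square algebra_simps)
    then have "X'\<^sup>2 - k * Y'\<^sup>2 = n * Z'\<^sup>2" using p0 by simp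
    moreover have "nat \<bar>Z'\<bar> < nat \<bar>Z\<bar>"
    proof -
      have "1 * \<bar>Z'\<bar> < p * \<bar>Z'\<bar>" using p0 Z'0 by (intro mult_strict_right_mono) auto
      then show ?thesis unfolding Z using p0 by (simp add: abs_mult)
    qed
    ultimately show False using less.hyps[of Z' X' Y'] Z'0 by blast
  qed
  obtain X1 Z1 where x: "Z1 \<noteq> 0" "x = of_int X1 / of_int Z1" using Rats_cases'[OF xy(1)] by (metis less_irrefl)
  obtain Y1 Z2 where y: "Z2 \<noteq> 0" "y = of_int Y1 / of_int Z2" using Rats_cases'[OF xy(2)] by (metis less_irrefl)
  have "real_of_int ((X1 * Z2)\<^sup>2 - k * (Y1 * Z1)\<^sup>2) = (x\<^sup>2 - of_int k * y\<^sup>2) * (of_int (Z1 * Z2))\<^sup>2"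
    using x(1) y(1) unfolding x(2) y(2) by (simp add: power2_eq_square field_simps)
  also have "\<dots> = real_of_int (n * (Z1 * Z2)\<^sup>2)" unfolding eq by simp
  finally have "(X1 * Z2)\<^sup>2 - k * (Y1 * Z1)\<^sup>2 = n * (Z1 * Z2)\<^sup>2" by (simp only: of_int_eq_iff)
  then show False using desc[of "X1 * Z2" "Y1 * Z1" "Z1 * Z2"] x(1) y(1) by simp
qed

text \<open>
  Otherwise \<open>y\<close> would be invertible modulo \<open>p\<close>, and \<open>k\<close> would be the square of \<open>x / y\<close>. The hypothesis is a list so
  that the simplifier can evaluate it for a given prime.
\<close>

lemma dvd_of_nonresidue:
  fixes p k x y :: int
  assumes p: "prime p" and dvd: "p dvd x\<^sup>2 - k * y\<^sup>2" and non: "list_all (\<lambda>i. (i * i - k) mod p \<noteq> 0) [0..p - 1]"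
  shows "p dvd x \<and> p dvd y"
proof -
  have p0: "p > 0" using prime_gt_0_int[OF p] .
  have y: "p dvd y"
  proof (rule ccontr)
    assume "\<not> p dvd y"
    then have "coprime y p" using p by (simp add: prime_imp_coprime coprime_commute)
    then obtain z where z: "[y * z = 1] (mod p)" using cong_solve_coprime_int by blast
    have "p dvd (x\<^sup>2 - k * y\<^sup>2) * z\<^sup>2" using dvd by (rule dvd_mult2)
    moreover have "p dvd (y * z - 1) * (y * z + 1)"
      using z by (intro dvd_mult2) (simp add: cong_iff_dvd_diff)
    ultimately have "p dvd (x\<^sup>2 - k * y\<^sup>2) * z\<^sup>2 + k * ((y * z - 1) * (y * z + 1))" by simp
    also have "\<dots> = (x * z) * (x * z) - k" by (simp add: power2_eq_square algebra_simps)
    finally have "((x * z) * (x * z) - k) mod p = 0" by simp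
    then have "((x * z) mod p * ((x * z) mod p) - k) mod p = 0" by (metis mod_diff_left_eq mod_mult_eq)
    moreover have "(x * z) mod p \<in> set [0..p - 1]" using p0 by simp
    from bspec[OF non[unfolded list_all_iff] this] have "((x * z) mod p * ((x * z) mod p) - k) mod p \<noteq> 0" .
    ultimately show False by contradiction
  qed
  then have "p dvd k * y\<^sup>2" by (simp add: power2_eq_square)
  then have "p dvd x\<^sup>2" using dvd by (metis diff_add_cancel dvd_add)
  then show ?thesis using y p prime_dvd_power by blast
qed

lemma residues_5: "(5::int) dvd x\<^sup>2 - (- 3) * y\<^sup>2 \<Longrightarrow> 5 dvd x \<and> 5 dvd y"
  by (erule dvd_of_nonresidue[rotated]) (simp_all add: upto.simps)

lemma residues_29: "(29::int) dvd x\<^sup>2 - 21 * y\<^sup>2 \<Longrightarrow> 29 dvd x \<and> 29 dvd y"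
  by (erule dvd_of_nonresidue[rotated]) (simp_all add: upto.simps)

lemma sqrt_coefficient_zero:
  fixes d :: nat
  assumes d: "prime d" and pq: "p \<in> \<rat>" "q \<in> \<rat>" "p + q * sqrt (real d) \<in> \<rat>"
  shows "q = 0"
proof (rule ccontr)
  assume q: "q \<noteq> 0"
  have "sqrt (real d) = ((p + q * sqrt (real d)) - p) / q" using q by simp
  then have "sqrt (real d) \<in> \<rat>" using pq by (metis Rats_diff Rats_divide)
  then obtain m n where n: "n \<noteq> 0" and mn: "\<bar>sqrt (real d)\<bar> = real m / real n" and cop: "coprime m n"
    by (rule Rats_abs_nat_div_natE)
  have "real d = (real m / real n)\<^sup>2" using mn by (metis abs_of_nonneg real_sqrt_ge_zero of_nat_0_le_iff real_sqrt_pow2)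
  then have "real (m ^ 2) = real (d * n ^ 2)" using n by (simp add: field_simps power2_eq_square)
  then have e: "m ^ 2 = d * n ^ 2" by (simp only: of_nat_eq_iff)
  then have "d dvd m" using d by (metis dvd_triv_left prime_dvd_power)
  then obtain m' where m': "m = d * m'" by (elim dvdE)
  have "d * (d * m' ^ 2) = d * n ^ 2" using e unfolding m' by (simp add: power2_eq_square mult_ac)
  then have "d * m' ^ 2 = n ^ 2" using d by (simp add: prime_gt_0_nat)
  then have "d dvd n" using d by (metis dvd_triv_left prime_dvd_power)
  then have "d dvd 1" using \<open>d dvd m\<close> cop by (meson coprime_common_divisor_nat coprime_def not_prime_unit)
  then show False using d by simp
qed

section \<open>The four matrices\<close>

text \<open>
  The form in which the asymptotic expansion is applied: \<open>D\<close> and \<open>E\<close> are the determinants of \<open>A D\<^sub>m\<close> and of the tilted covariance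
  matrix, and \<open>p\<close>, \<open>q\<close> are the values \<open>x / (1 - x)\<close>, \<open>y / (1 - y)\<close> of the polylogarithm of order 0, in terms of which
  those of orders -1 and -2 are polynomials. All hypotheses about numbers are free of divisions by irrational
  quantities, so that they can be checked in a quadratic field by multiplying out.
\<close>

lemma modular_imp_coefficient_eq:
  fixes \<alpha> \<beta> \<gamma> a b c x y :: real and M :: "real^2^2"
  assumes x: "0 < x" "x < 1" and y: "0 < y" "y < 1" and \<alpha>: "\<alpha> > 0" and D: "\<alpha> * \<gamma> - \<beta>\<^sup>2 = D" "D > 0" and m: "m > 0"
    and saddle: "ln x = \<alpha> * ln (1 - x) + \<beta> * (ln (1 - y) / real m)" "ln y = \<beta> * ln (1 - x) + \<gamma> * (ln (1 - y) / real m)"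
    and p: "p * (1 - x) = x" "p1 = p + p\<^sup>2" "p2 = p + 3 * p\<^sup>2 + 2 * p ^ 3"
    and q: "q * (1 - y) = y" "q1 = q + q\<^sup>2" "q2 = q + 3 * q\<^sup>2 + 2 * q ^ 3"
    and S: "s > 0" "s * v - w\<^sup>2 = E" "E > 0"
    and inv: "v = E * (\<gamma> / D + p)" "s = E * (\<alpha> / D + q / real m)" "w = E * (\<beta> / D)"
    and M: "\<And>r s. nahm_exponent M m a b r s = (\<alpha> * real r ^ 2 + 2 * \<beta> * real r * real s + \<gamma> * real s ^ 2) / 2 + a * real r + b * real s"
    and mod: "meromorphic_modular_function (nahm_sum M m a b c)"
  shows "nahm_c1 (real m) a b p p1 p2 q q1 q2 s w v = c"
proof -
  have ex: "exp (- (- ln x)) = x" "exp (- (- ln y)) = y" using x y by simp_all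
  have "- ln x > 0" "- ln y > 0" using x y by auto
  moreover have "- ln x = \<alpha> * polylog 1 (exp (- (- ln x))) + \<beta> * (polylog 1 (exp (- (- ln y))) / real m)"
    "- ln y = \<beta> * polylog 1 (exp (- (- ln x))) + \<gamma> * (polylog 1 (exp (- (- ln y))) / real m)"
    unfolding ex polylog_1[OF x] polylog_1[OF y] using saddle by simp_all
  ultimately interpret N: nahm_saddle \<alpha> \<beta> \<gamma> "real m" a b "- ln x" "- ln y"
    using \<alpha> D m by unfold_locales (simp_all only: of_nat_0_less_iff)
  have xy: "N.x = x" "N.y = y" using ex by (simp_all add: N.x_def N.y_def)
  have pol: "polylog 0 z = k \<and> polylog (-1) z = k + k\<^sup>2 \<and> polylog (-2) z = k + 3 * k\<^sup>2 + 2 * k ^ 3"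
    if z: "0 < z" "z < 1" and k: "k * (1 - z) = z" for z k :: real
  proof -
    define d where "d = 1 - z"
    have d: "d > 0" "z = 1 - d" using z by (auto simp: d_def)
    have k': "k = (1 - d) / d" using k d by (simp add: eq_divide_eq)
    show ?thesis
      unfolding polylog_0[OF z] polylog_minus_1[OF z] polylog_minus_2[OF z] k' using d
      by (simp add: d power2_eq_square power3_eq_cube divide_simps) (simp add: algebra_simps)
  qed
  note px = pol[OF x p(1)] and qy = pol[OF y q(1)]
  have "s * v - w\<^sup>2 > 0" "\<alpha> * \<gamma> - \<beta>\<^sup>2 > 0" using S D by auto
  moreover have "v / (s * v - w\<^sup>2) = \<gamma> / (\<alpha> * \<gamma> - \<beta>\<^sup>2) + polylog 0 N.x"
    "s / (s * v - w\<^sup>2) = \<alpha> / (\<alpha> * \<gamma> - \<beta>\<^sup>2) + polylog 0 N.y / real m" "w / (s * v - w\<^sup>2) = \<beta> / (\<alpha> * \<gamma> - \<beta>\<^sup>2)"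
    unfolding xy S(2) D(1) using px qy S(3) inv by (simp_all add: nonzero_divide_eq_eq mult.commute)
  ultimately have "nahm_c1_at (real m) a b N.x N.y s w v = c"
    by (intro N.modular_imp_c1_eq[OF M refl S(1) _ _ _ _ mod])
  then show ?thesis unfolding xy p(2,3) q(2,3) using px qy by simp
qed

lemma nahm_exponent_eq:
  assumes "M = vector [vector [k, l], vector [n, j]]" "n = real m * l"
  shows "nahm_exponent M m a b r s = (k * real r ^ 2 + 2 * n * real r * real s + real m * j * real s ^ 2) / 2 + a * real r + b * real s"
  unfolding nahm_exponent_def Let_def assms D_mat_def
  by (simp add: inner_vec_def matrix_vector_mult_def matrix_matrix_mult_def UNIV_2 power2_eq_square algebra_simps)

lemma matrix_inv_2x2:
  fixes k l n j :: real
  assumes "k * j - l * n = d" "d \<noteq> 0"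
  shows "matrix_inv (vector [vector [k, l], vector [n, j]] :: real^2^2) = vector [vector [j / d, - l / d], vector [- n / d, k / d]]"
    (is "matrix_inv ?M = ?N")
proof -
  have MN: "?M ** ?N = mat 1" "?N ** ?M = mat 1"
    using assms by (simp_all add: vec_eq_iff matrix_matrix_mult_def UNIV_2 mat_def forall_2 field_simps)
  then have "matrix_inv ?M ** ?M = mat 1"
    unfolding matrix_inv_def by (rule someI2[of _ ?N, OF conjI]) auto
  then have "matrix_inv ?M = matrix_inv ?M ** (?M ** ?N)" unfolding MN by simp
  also have "\<dots> = ?N" unfolding matrix_mul_assoc \<open>matrix_inv ?M ** ?M = mat 1\<close> by simp
  finally show ?thesis .
qed

text \<open>
  Nahm's equations have fractional exponents in general. They are therefore verified as identities between
  monomials with natural exponents, from which this lemma recovers the logarithmic form.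
\<close>

lemma ln_monomial_eq:
  fixes z u v :: real
  assumes "z ^ i * u ^ j * v ^ k = u ^ l * v ^ n" "z > 0" "u > 0" "v > 0"
  shows "real i * ln z + real j * ln u + real k * ln v = real l * ln u + real n * ln v"
proof -
  have "ln (z ^ i * u ^ j * v ^ k) = ln (u ^ l * v ^ n)" using assms(1) by simp
  then show ?thesis using assms(2-4) by (simp add: ln_mult ln_realpow)
qed

lemma nahm_exponent_A8: "nahm_exponent A8 8 a b r s = (4 * real r ^ 2 + 2 * 8 * real r * real s + 24 * real s ^ 2) / 2 + a * real r + b * real s"
  using nahm_exponent_eq[OF A8_def, of 8 a b r s] by simp

lemma nahm_exponent_A6: "nahm_exponent A6 6 a b r s = (3 / 2 * real r ^ 2 + 2 * 3 * real r * real s + 12 * real s ^ 2) / 2 + a * real r + b * real s"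
  using nahm_exponent_eq[OF A6_def, of 6 a b r s] by simp

lemma nahm_exponent_A8_inv:
  "nahm_exponent (matrix_inv A8) 8 a b r s = (3 / 4 * real r ^ 2 + 2 * (- 2) * real r * real s + 8 * real s ^ 2) / 2 + a * real r + b * real s"
proof -
  have "matrix_inv A8 = vector [vector [3 / 4, - 1 / 4], vector [- 8 / 4, 4 / 4]]"
    unfolding A8_def by (rule matrix_inv_2x2) simp_all
  from nahm_exponent_eq[OF this, of 8 a b r s] show ?thesis by simp
qed

lemma nahm_exponent_A6_inv:
  "nahm_exponent (matrix_inv A6) 6 a b r s = (4 / 3 * real r ^ 2 + 2 * (- 2) * real r * real s + 6 * real s ^ 2) / 2 + a * real r + b * real s"
proof -
  have "matrix_inv A6 = vector [vector [2 / (3 / 2), - (1 / 2) / (3 / 2)], vector [- 3 / (3 / 2), (3 / 2) / (3 / 2)]]"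
    unfolding A6_def by (rule matrix_inv_2x2) simp_all
  from nahm_exponent_eq[OF this, of 6 a b r s] show ?thesis by simp
qed

text \<open>
  In each case the saddle point, the tilted covariance matrix and hence \<open>c\<^sub>1(a,b)\<close> are elements of \<open>\<rat>(r)\<close>, and the
  rewrite rules for \<open>r * r\<close> reduce every polynomial in \<open>r\<close> to a linear one. The irrational part of
  \<open>c\<^sub>1(a,b)\<close> is a quadratic polynomial in \<open>a\<close> and \<open>b\<close>. Completing squares, first in \<open>b\<close> and
  then in \<open>a\<close>, turns its zeros into the points of the conic that appears at the end of the proof.
  For \<open>A8\<close>, the saddle point is \<open>x = 2 - \<surd>3\<close>, \<open>y = (2 - \<surd>3) / 4\<close>.
\<close>

lemma not_modular_A8:
  assumes rat: "a \<in> \<rat>" "b \<in> \<rat>" "c \<in> \<rat>"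
  shows "\<not> meromorphic_modular_function (nahm_sum A8 8 a b c)"
proof
  assume mod: "meromorphic_modular_function (nahm_sum A8 8 a b c)"
  define r where "r = sqrt (real 3)"
  have rr: "r * r = 3" "\<And>z. r * (r * z) = 3 * z" by (simp_all add: r_def mult.assoc[symmetric])
  have r: "17 / 10 < r" "r < 18 / 10"
    unfolding r_def by (rule real_less_rsqrt real_less_lsqrt; simp add: power2_eq_square)+
  note alg = power2_eq_square eval_nat_numeral algebra_simps rr
  have "(2 - r) = (-1 + r) ^ 4 * (1 / 2 + 1 / 4 * r)" "(1 / 2 - 1 / 4 * r) = (-1 + r) ^ 8 * (1 / 2 + 1 / 4 * r) ^ 3"
    by (simp_all add: alg)
  then have l: "ln (2 - r) = 4 * ln (1 - (2 - r)) + 8 * (ln (1 - (1 / 2 - 1 / 4 * r)) / real 8)"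
    "ln (1 / 2 - 1 / 4 * r) = 8 * ln (1 - (2 - r)) + 24 * (ln (1 - (1 / 2 - 1 / 4 * r)) / real 8)"
    using r ln_monomial_eq[where z = "2 - r" and u = "-1 + r" and v = "1 / 2 + 1 / 4 * r" and i = 1 and j = 0 and k = 0 and l = 4 and n = 1]
      ln_monomial_eq[where z = "1 / 2 - 1 / 4 * r" and u = "-1 + r" and v = "1 / 2 + 1 / 4 * r" and i = 1 and j = 0 and k = 0 and l = 8 and n = 3]
    by (simp_all add: field_simps)
  let ?c1 = "nahm_c1 (real 8) a b (-1 / 2 + 1 / 2 * r) (1 / 2) (1 / 2 * r) (7 - 4 * r) (104 - 60 * r) (3000 - 1732 * r) (8 / 9 * r) (4 / 3 + 8 / 9 * r) (20 / 3 + 32 / 9 * r)"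
  let ?U = "5 / 12 * a\<^sup>2 - 1 / 12 * a - 5 / 24 + 5 / 96 * b\<^sup>2 + 1 / 24 * b - 1 / 4 * (a * b)"
  let ?V = "- 7 / 36 * a\<^sup>2 + 1 / 12 * a + 7 / 72 - 1 / 36 * b\<^sup>2 - 1 / 72 * b + 5 / 36 * (a * b)"
  have "?c1 = c"
    by (rule modular_imp_coefficient_eq[where x = "2 - r" and y = "1 / 2 - 1 / 4 * r" and D = "32" and E = "16 / 3 + 32 / 9 * r", OF _ _ _ _ _ _ _ _ l _ _ _ _ _ _ _ _ _ _ _ _ nahm_exponent_A8 mod])
      (use r in \<open>simp_all add: power2_eq_square power3_eq_cube field_simps rr\<close>)
  moreover have "?c1 = ?U + ?V * r"
    unfolding nahm_c1_def Let_def by (simp add: power2_eq_square power3_eq_cube field_simps rr)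
  ultimately have "?U + ?V * sqrt (real 3) = c" unfolding r_def by simp
  then have "?V = 0"
    using rat by (intro sqrt_coefficient_zero[of 3 ?U]) (auto intro!: Rats_add Rats_diff Rats_mult Rats_power)
  then have "(6 * a - 7)\<^sup>2 - of_int (-3) * (4 * b + 1 - 10 * a)\<^sup>2 = real_of_int (220)"
    by (simp add: power2_eq_square field_simps)
  moreover have "(6 * a - 7)\<^sup>2 - of_int (-3) * (4 * b + 1 - 10 * a)\<^sup>2 \<noteq> real_of_int (220)"
    using rat by (intro quadratic_form_no_rational_zero[OF _ residues_5]) (auto intro!: Rats_add Rats_diff Rats_mult Rats_divide)
  ultimately show False by contradiction
qed

text \<open>
  Inverting the matrix exchanges \<open>x\<close> with \<open>1 - x\<close> and \<open>y\<close> with \<open>1 - y\<close> in Nahm's equations, so the saddle point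
  is the complement of the previous one.
\<close>

lemma not_modular_A8_inv:
  assumes rat: "a \<in> \<rat>" "b \<in> \<rat>" "c \<in> \<rat>"
  shows "\<not> meromorphic_modular_function (nahm_sum (matrix_inv A8) 8 a b c)"
proof
  assume mod: "meromorphic_modular_function (nahm_sum (matrix_inv A8) 8 a b c)"
  define r where "r = sqrt (real 3)"
  have rr: "r * r = 3" "\<And>z. r * (r * z) = 3 * z" by (simp_all add: r_def mult.assoc[symmetric])
  have r: "17 / 10 < r" "r < 18 / 10"
    unfolding r_def by (rule real_less_rsqrt real_less_lsqrt; simp add: power2_eq_square)+
  note alg = power2_eq_square eval_nat_numeral algebra_simps rr
  have "(-1 + r) ^ 4 * (1 / 2 - 1 / 4 * r) = (2 - r) ^ 3" "(1 / 2 + 1 / 4 * r) * (2 - r) ^ 2 = (1 / 2 - 1 / 4 * r)"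
    by (simp_all add: alg)
  then have l: "ln (-1 + r) = 3 / 4 * ln (1 - (-1 + r)) + -2 * (ln (1 - (1 / 2 + 1 / 4 * r)) / real 8)"
    "ln (1 / 2 + 1 / 4 * r) = -2 * ln (1 - (-1 + r)) + 8 * (ln (1 - (1 / 2 + 1 / 4 * r)) / real 8)"
    using r ln_monomial_eq[where z = "-1 + r" and u = "2 - r" and v = "1 / 2 - 1 / 4 * r" and i = 4 and j = 0 and k = 1 and l = 3 and n = 0]
      ln_monomial_eq[where z = "1 / 2 + 1 / 4 * r" and u = "2 - r" and v = "1 / 2 - 1 / 4 * r" and i = 1 and j = 2 and k = 0 and l = 0 and n = 1]
    by (simp_all add: field_simps)
  let ?c1 = "nahm_c1 (real 8) a b (1 + r) (5 + 3 * r) (33 + 19 * r) (7 + 4 * r) (104 + 60 * r) (3000 + 1732 * r) (5 / 6 - 7 / 18 * r) (-2 + 10 / 9 * r) (20 / 3 - 32 / 9 * r)"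
  let ?U = "- 1 / 6 + 5 / 96 * b\<^sup>2 - 1 / 24 * b + 1 / 6 * (a * b)"
  let ?V = "4 / 9 * a\<^sup>2 - 2 / 9 * a - 7 / 72 + 1 / 36 * b\<^sup>2 - 1 / 24 * b + 1 / 9 * (a * b)"
  have "?c1 = c"
    by (rule modular_imp_coefficient_eq[where x = "-1 + r" and y = "1 / 2 + 1 / 4 * r" and D = "2" and E = "2 - 10 / 9 * r", OF _ _ _ _ _ _ _ _ l _ _ _ _ _ _ _ _ _ _ _ _ nahm_exponent_A8_inv mod])
      (use r in \<open>simp_all add: power2_eq_square power3_eq_cube field_simps rr\<close>)
  moreover have "?c1 = ?U + ?V * r"
    unfolding nahm_c1_def Let_def by (simp add: power2_eq_square power3_eq_cube field_simps rr)
  ultimately have "?U + ?V * sqrt (real 3) = c" unfolding r_def by simp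
  then have "?V = 0"
    using rat by (intro sqrt_coefficient_zero[of 3 ?U]) (auto intro!: Rats_add Rats_diff Rats_mult Rats_power)
  then have "(24 * a - 5)\<^sup>2 - of_int (-3) * (4 * b + 8 * a - 3)\<^sup>2 = real_of_int (220)"
    by (simp add: power2_eq_square field_simps)
  moreover have "(24 * a - 5)\<^sup>2 - of_int (-3) * (4 * b + 8 * a - 3)\<^sup>2 \<noteq> real_of_int (220)"
    using rat by (intro quadratic_form_no_rational_zero[OF _ residues_5]) (auto intro!: Rats_add Rats_diff Rats_mult Rats_divide)
  ultimately show False by contradiction
qed

text \<open>
  Here the coefficients of \<open>c\<^sub>1(a,b)\<close> have denominators divisible by 7; the equation of the conic becomes integral in
  the variables \<open>7 a\<close> and \<open>7 b\<close>.
\<close>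

lemma not_modular_A6:
  assumes rat: "a \<in> \<rat>" "b \<in> \<rat>" "c \<in> \<rat>"
  shows "\<not> meromorphic_modular_function (nahm_sum A6 6 a b c)"
proof
  assume mod: "meromorphic_modular_function (nahm_sum A6 6 a b c)"
  define r where "r = sqrt (real 2)"
  have rr: "r * r = 2" "\<And>z. r * (r * z) = 2 * z" by (simp_all add: r_def mult.assoc[symmetric])
  have r: "14 / 10 < r" "r < 15 / 10"
    unfolding r_def by (rule real_less_rsqrt real_less_lsqrt; simp add: power2_eq_square)+
  note alg = power2_eq_square eval_nat_numeral algebra_simps rr
  have "(-1 + r) ^ 2 = (2 - r) ^ 3 * (1 / 2 + 1 / 4 * r)" "(1 / 2 - 1 / 4 * r) = (2 - r) ^ 3 * (1 / 2 + 1 / 4 * r) ^ 2"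
    by (simp_all add: alg)
  then have l: "ln (-1 + r) = 3 / 2 * ln (1 - (-1 + r)) + 3 * (ln (1 - (1 / 2 - 1 / 4 * r)) / real 6)"
    "ln (1 / 2 - 1 / 4 * r) = 3 * ln (1 - (-1 + r)) + 12 * (ln (1 - (1 / 2 - 1 / 4 * r)) / real 6)"
    using r ln_monomial_eq[where z = "-1 + r" and u = "2 - r" and v = "1 / 2 + 1 / 4 * r" and i = 2 and j = 0 and k = 0 and l = 3 and n = 1]
      ln_monomial_eq[where z = "1 / 2 - 1 / 4 * r" and u = "2 - r" and v = "1 / 2 + 1 / 4 * r" and i = 1 and j = 0 and k = 0 and l = 3 and n = 2]
    by (simp_all add: field_simps)
  let ?c1 = "nahm_c1 (real 6) a b (1 / 2 * r) (1 / 2 + 1 / 2 * r) (3 / 2 + r) (3 - 2 * r) (20 - 14 * r) (252 - 178 * r) (9 / 7 - 3 / 7 * r) (6 / 7 + 3 / 14 * r) (57 / 14 + 15 / 7 * r)"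
  let ?U = "- 9 / 28 * a\<^sup>2 + 57 / 196 * a - 1073 / 5488 + 1 / 336 * b\<^sup>2 - 13 / 392 * b + 5 / 28 * (a * b)"
  let ?V = "5 / 14 * a\<^sup>2 - 10 / 49 * a + 205 / 2058 + 1 / 168 * b\<^sup>2 + 2 / 49 * b - 1 / 7 * (a * b)"
  have "?c1 = c"
    by (rule modular_imp_coefficient_eq[where x = "-1 + r" and y = "1 / 2 - 1 / 4 * r" and D = "9" and E = "18 / 7 + 9 / 14 * r", OF _ _ _ _ _ _ _ _ l _ _ _ _ _ _ _ _ _ _ _ _ nahm_exponent_A6 mod])
      (use r in \<open>simp_all add: power2_eq_square power3_eq_cube field_simps rr\<close>)
  moreover have "?c1 = ?U + ?V * r"
    unfolding nahm_c1_def Let_def by (simp add: power2_eq_square power3_eq_cube field_simps rr)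
  ultimately have "?U + ?V * sqrt (real 2) = c" unfolding r_def by simp
  then have "?V = 0"
    using rat by (intro sqrt_coefficient_zero[of 2 ?U]) (auto intro!: Rats_add Rats_diff Rats_mult Rats_power)
  then have "((7 * b + 24 - 84 * a) / 2)\<^sup>2 - of_int (21) * (7 * a - 2)\<^sup>2 = real_of_int (-145)"
    by (simp add: power2_eq_square field_simps)
  moreover have "((7 * b + 24 - 84 * a) / 2)\<^sup>2 - of_int (21) * (7 * a - 2)\<^sup>2 \<noteq> real_of_int (-145)"
    using rat by (intro quadratic_form_no_rational_zero[OF _ residues_29]) (auto intro!: Rats_add Rats_diff Rats_mult Rats_divide)
  ultimately show False by contradiction
qed

lemma not_modular_A6_inv:
  assumes rat: "a \<in> \<rat>" "b \<in> \<rat>" "c \<in> \<rat>"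
  shows "\<not> meromorphic_modular_function (nahm_sum (matrix_inv A6) 6 a b c)"
proof
  assume mod: "meromorphic_modular_function (nahm_sum (matrix_inv A6) 6 a b c)"
  define r where "r = sqrt (real 2)"
  have rr: "r * r = 2" "\<And>z. r * (r * z) = 2 * z" by (simp_all add: r_def mult.assoc[symmetric])
  have r: "14 / 10 < r" "r < 15 / 10"
    unfolding r_def by (rule real_less_rsqrt real_less_lsqrt; simp add: power2_eq_square)+
  note alg = power2_eq_square eval_nat_numeral algebra_simps rr
  have "(2 - r) ^ 3 * (1 / 2 - 1 / 4 * r) = (-1 + r) ^ 4" "(1 / 2 + 1 / 4 * r) * (-1 + r) ^ 2 = (1 / 2 - 1 / 4 * r)"
    by (simp_all add: alg)
  then have l: "ln (2 - r) = 4 / 3 * ln (1 - (2 - r)) + -2 * (ln (1 - (1 / 2 + 1 / 4 * r)) / real 6)"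
    "ln (1 / 2 + 1 / 4 * r) = -2 * ln (1 - (2 - r)) + 6 * (ln (1 - (1 / 2 + 1 / 4 * r)) / real 6)"
    using r ln_monomial_eq[where z = "2 - r" and u = "-1 + r" and v = "1 / 2 - 1 / 4 * r" and i = 3 and j = 0 and k = 1 and l = 4 and n = 0]
      ln_monomial_eq[where z = "1 / 2 + 1 / 4 * r" and u = "-1 + r" and v = "1 / 2 - 1 / 4 * r" and i = 1 and j = 2 and k = 0 and l = 0 and n = 1]
    by (simp_all add: field_simps)
  let ?c1 = "nahm_c1 (real 6) a b (r) (2 + r) (6 + 5 * r) (3 + 2 * r) (20 + 14 * r) (252 + 178 * r) (-9 / 14 + 5 / 7 * r) (15 / 14 - 6 / 7 * r) (3 / 14 + 3 / 7 * r)"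
  let ?U = "9 / 14 * a\<^sup>2 - 33 / 98 * a - 1583 / 16464 + 19 / 336 * b\<^sup>2 - 31 / 392 * b + 1 / 7 * (a * b)"
  let ?V = "- 3 / 14 * a\<^sup>2 + 9 / 49 * a - 205 / 2058 + 5 / 168 * b\<^sup>2 + 1 / 49 * b + 1 / 28 * (a * b)"
  have "?c1 = c"
    by (rule modular_imp_coefficient_eq[where x = "2 - r" and y = "1 / 2 + 1 / 4 * r" and D = "4" and E = "-15 / 7 + 12 / 7 * r", OF _ _ _ _ _ _ _ _ l _ _ _ _ _ _ _ _ _ _ _ _ nahm_exponent_A6_inv mod])
      (use r in \<open>simp_all add: power2_eq_square power3_eq_cube field_simps rr\<close>)
  moreover have "?c1 = ?U + ?V * r"
    unfolding nahm_c1_def Let_def by (simp add: power2_eq_square power3_eq_cube field_simps rr)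
  ultimately have "?U + ?V * sqrt (real 2) = c" unfolding r_def by simp
  then have "?V = 0"
    using rat by (intro sqrt_coefficient_zero[of 2 ?U]) (auto intro!: Rats_add Rats_diff Rats_mult Rats_power)
  then have "(35 * b + 21 * a + 12)\<^sup>2 - of_int (21) * (21 * a - 8)\<^sup>2 = real_of_int (2900)"
    by (simp add: power2_eq_square field_simps)
  moreover have "(35 * b + 21 * a + 12)\<^sup>2 - of_int (21) * (21 * a - 8)\<^sup>2 \<noteq> real_of_int (2900)"
    using rat by (intro quadratic_form_no_rational_zero[OF _ residues_29]) (auto intro!: Rats_add Rats_diff Rats_mult Rats_divide)
  ultimately show False by contradiction
qed

theorem theorem4p1:
  fixes m :: nat and A :: "real^2^2"
  assumes "(m = 6 \<and> A \<in> {A6, matrix_inv A6}) \<or> (m = 8 \<and> A \<in> {A8, matrix_inv A8})"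
  shows "\<not> (\<exists>a\<in>\<rat>. \<exists>b\<in>\<rat>. \<exists>c\<in>\<rat>. meromorphic_modular_function (nahm_sum A m a b c))"
  using assms not_modular_A6 not_modular_A6_inv not_modular_A8 not_modular_A8_inv by auto

end
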